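(* Let $A\in\mathbb{R}^{n\times n}$ be cyclic. As $T\to0^+$, $$\gamma_1(A,T)=\kappa_n\,\delta_n(A)^2\,T^{2n-1}\,(1+\alpha_n(A)T+\mathrm{o}(T)),\qquad \kappa_n=\frac{((n-1)!)^2}{(2n-1)!\,(2n-2)!}.$$ Consequently, $$\rho_1(A,T)=n\,\kappa_n\,\delta_n(A)^2\,T^{2n-2}\Big(1+\Big(\alpha_n(A)-\frac{\operatorname{tr}A}{n}\Big)T+\mathrm{o}(T)\Big).$$
   Context: For $A\in\mathbb{R}^{n\times n}$, $T>0$ and $b\in\mathbb{R}^n$, let $G_T(A,b)=\int_0^Te^{tA}bb^\top e^{tA^\top}\,dt$ and $$\gamma_1(A,T)=\max_{\Vert b\Vert=1}\lambda_{\min}(G_T(A,b)),\qquad \gamma_{\mathrm{rel}}(A,T)=\max_{X\succeq0,\ \operatorname{tr}X=1}\lambda_{\min}\Big(\int_0^Te^{tA}Xe^{tA^\top}dt\Big),\qquad \rho_1(A,T)=\frac{\gamma_1(A,T)}{\gamma_{\mathrm{rel}}(A,T)},$$ where $X$ ranges over real symmetric $n\times n$ matrices. A vector $b$ is cyclic for $A$ if $\operatorname{span}(b,Ab,\ldots,A^{n-1}b)=\mathbb{R}^n$; $A$ is cyclic if it admits a cyclic vector. For a unit cyclic vector $b$, set $d_n(A,b)=\operatorname{dist}(A^{n-1}b,\operatorname{span}(b,Ab,\ldots,A^{n-2}b))$ (the span being $\{0\}$ when $n=1$); for a unit vector $b$ that is not cyclic, set $d_n(A,b)=0$. Let $\delta_n(A)=\max_{\Vert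 b\Vert=1}d_n(A,b)$ (the maximum is attained) and $\mathcal{M}(A)=\{b\in\mathbb{R}^n\mid\Vert b\Vert=1,\ d_n(A,b)=\delta_n(A)\}$. When $A$ is cyclic, $\delta_n(A)>0$ and $\mathcal{M}(A)$ is a compact set of cyclic vectors. For a cyclic vector $b$, let $K_{A,b}=(b,Ab,\ldots,A^{n-1}b)=QR$ be the QR factorization with positive diagonal in $R$ and let $q_n(A,b)$ be the last column of $Q$. Finally, $\alpha_n(A)=\max_{b\in\mathcal{M}(A)}q_n(A,b)^\top Aq_n(A,b)$. *)

theory Defs
  imports "HOL-Analysis.Analysis" "HOL-Library.Landau_Symbols"
begin

(* The product and power inherited by the type real^'n^'n from its ring structure
   are componentwise, so matrix powers and the exponential are built from ** here. *)
primrec mat_power :: "real^'n^'n \<Rightarrow> nat \<Rightarrow> real^'n^'n" where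
  "mat_power A 0 = mat 1"
| "mat_power A (Suc k) = A ** mat_power A k"

definition mat_exp :: "real^'n^'n \<Rightarrow> real^'n^'n" where
  "mat_exp A = (\<Sum>k. mat_power A k /\<^sub>R fact k)"

definition outer :: "real^'n \<Rightarrow> real^'n^'n" where
  "outer b = (\<chi> i j. b $ i * b $ j)"

definition lambda_min :: "real^'n^'n \<Rightarrow> real" where
  "lambda_min M = Min {l. \<exists>v. v \<noteq> 0 \<and> M *v v = l *\<^sub>R v}"

definition psd :: "real^'n^'n \<Rightarrow> bool" where
  "psd X \<longleftrightarrow> transpose X = X \<and> (\<forall>v. 0 \<le> v \<bullet> (X *v v))"

definition gramian_op :: "real^'n^'n \<Rightarrow> real \<Rightarrow> real^'n^'n \<Rightarrow> real^'n^'n" where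
  "gramian_op A T X =
     integral {0..T} (\<lambda>t. mat_exp (t *\<^sub>R A) ** X ** mat_exp (t *\<^sub>R transpose A))"

definition gramian :: "real^'n^'n \<Rightarrow> real \<Rightarrow> real^'n \<Rightarrow> real^'n^'n" where
  "gramian A T b = gramian_op A T (outer b)"

(* All maxima are taken over infinite sets in general, so Max is not applicable;
   GREATEST denotes the maximum whenever it is attained and is unspecified otherwise. *)
definition gamma1 :: "real^'n^'n \<Rightarrow> real \<Rightarrow> real" where
  "gamma1 A T = (GREATEST m. m \<in> (\<lambda>b. lambda_min (gramian A T b)) ` {b. norm b = 1})"

definition gamma_rel :: "real^'n^'n \<Rightarrow> real \<Rightarrow> real" where
  "gamma_rel A T =
     (GREATEST m. m \<in> (\<lambda>X. lambda_min (gramian_op A T X)) ` {X. psd X \<and> trace X = 1})"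

definition rho1 :: "real^'n^'n \<Rightarrow> real \<Rightarrow> real" where
  "rho1 A T = gamma1 A T / gamma_rel A T"

definition cyclic_vector :: "real^'n^'n \<Rightarrow> real^'n \<Rightarrow> bool" where
  "cyclic_vector A b \<longleftrightarrow> span ((\<lambda>k. mat_power A k *v b) ` {..<CARD('n)}) = UNIV"

definition cyclic_matrix :: "real^'n^'n \<Rightarrow> bool" where
  "cyclic_matrix A \<longleftrightarrow> (\<exists>b. cyclic_vector A b)"

definition d_n :: "real^'n^'n \<Rightarrow> real^'n \<Rightarrow> real" where
  "d_n A b =
     (if cyclic_vector A b
      then infdist (mat_power A (CARD('n) - 1) *v b)
             (span ((\<lambda>k. mat_power A k *v b) ` {..<CARD('n) - 1}))
      else 0)"

definition delta_n :: "real^'n^'n \<Rightarrow> real" where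
  "delta_n A = (GREATEST m. m \<in> d_n A ` {b. norm b = 1})"

definition maximizers :: "real^'n^'n \<Rightarrow> (real^'n) set" where
  "maximizers A = {b. norm b = 1 \<and> d_n A b = delta_n A}"

(* The index type 'n carries no order, so the factorization K = Q R of the Krylov matrix
   is written column by column: column k of K (0 <= k < n) is A^k b, column j of Q is q j,
   and r j k is the (j, k) entry of the upper triangular factor R. *)
definition krylov_QR ::
  "real^'n^'n \<Rightarrow> real^'n \<Rightarrow> (nat \<Rightarrow> real^'n) \<Rightarrow> (nat \<Rightarrow> nat \<Rightarrow> real) \<Rightarrow> bool" where
  "krylov_QR A b q r \<longleftrightarrow>
     (\<forall>i<CARD('n). \<forall>j<CARD('n). q i \<bullet> q j = (if i = j then 1 else 0)) \<and>
     (\<forall>j<CARD('n). \<forall>k<CARD('n). k < j \<longrightarrow> r j k = 0) \<and>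
     (\<forall>j<CARD('n). 0 < r j j) \<and>
     (\<forall>k<CARD('n). mat_power A k *v b = (\<Sum>j<CARD('n). r j k *\<^sub>R q j))"

definition q_n :: "real^'n^'n \<Rightarrow> real^'n \<Rightarrow> real^'n" where
  "q_n A b = (THE v. \<exists>q r. krylov_QR A b q r \<and> v = q (CARD('n) - 1))"

definition alpha_n :: "real^'n^'n \<Rightarrow> real" where
  "alpha_n A = (GREATEST m. m \<in> (\<lambda>b. q_n A b \<bullet> (A *v q_n A b)) ` maximizers A)"

definition kappa :: "nat \<Rightarrow> real" where
  "kappa n = (fact (n - 1))\<^sup>2 / (fact (2 * n - 1) * fact (2 * n - 2))"

end

theory Submission
  imports Defs "HOL-Computational_Algebra.Polynomial"
begin

text \<open>Call \<open>u\<close> dual to \<open>b\<close> if \<open>u \<bullet> A\<^sup>k b\<close> equals \<open>1\<close> for \<open>k = n - 1\<close> and \<open>0\<close> for smaller \<open>k\<close>.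
  A cyclic vector \<open>b\<close> has exactly one dual vector \<open>u\<close>; moreover \<open>d_n A b = 1 / norm u\<close> and
  \<open>q_n A b = u / norm u\<close>. The quadratic form of the Gramian at \<open>v\<close> is the squared \<open>L\<^sup>2\<close> norm of the
  response \<open>v \<bullet> exp (t A) b\<close> on \<open>[0, T]\<close>. Let \<open>B\<close> be the transpose of \<open>A\<close>. After scaling time
  to \<open>[0, 1]\<close>, the vectors \<open>T\<^sup>j B\<^sup>j u\<close> respond like monomials of degree \<open>n - 1 - j\<close>, so the
  form is minimised, up to relative errors of order \<open>T\<^sup>2\<close>, by the combination \<open>w\<close> whose response is
  a multiple of the shifted Legendre polynomial \<open>N'\<close> of degree \<open>n - 1\<close>. Because \<open>N\<close> is orthogonal
  to \<open>N'\<close>, the term of order \<open>T\<close> in the energy of \<open>w\<close> vanishes, and the first-order correction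
  comes only from \<open>norm w ^ 2 = norm u ^ 2 - T (u \<bullet> A u) + O(T\<^sup>2)\<close>. Testing with \<open>w\<close> bounds the
  smallest eigenvalue from above uniformly for dual vectors in a bounded set; completing squares bounds
  it from below for a fixed pair. Maximising over \<open>b\<close> is then an instance of Danskin's theorem. For the
  relaxed problem, \<open>X = I/n + T X\<^sub>1\<close> with \<open>X\<^sub>1\<close> cancelling the symmetric part of \<open>A\<close>
  is optimal to the order needed.\<close>

text \<open>The maximising \<open>b\<close> varies with \<open>T\<close>, so bounds for one fixed
  \<open>b\<close> cannot control \<open>gamma1\<close> from above; yet dual vectors are unbounded
  near non-cyclic \<open>b\<close>. The obstacle is met by proving the lower bound before the upper
  one: it makes the optimal eigenvalue at least a constant times \<open>T^(2n-1)\<close>, and an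
  eigenvalue of that size forces \<open>b\<close> to have a dual vector in a fixed ball. There all
  estimates are uniform and compactness applies.

  With \<open>c = u . A^n b\<close>, the scaled response of \<open>w\<close> is
  \<open>N' + T c N + O(T^2)\<close>: passing from the moment of order \<open>n - 1\<close> to that
  of order \<open>n\<close> integrates each monomial. The number \<open>c\<close> depends on the
  pair, so the expansion can depend on \<open>delta_n\<close> and \<open>alpha_n\<close> alone only
  because \<open>c\<close> drops out of the energy.

  The constant \<open>kappa n\<close> is the least integral of \<open>p^2\<close> over the unit
  interval among polynomials of degree \<open>n - 1\<close> with leading coefficient
  \<open>1 / (n - 1)!\<close>. The term \<open>- T (u . A u)\<close> comes from the second
  coefficient of \<open>N\<close>, which puts \<open>- (T / 2) B u\<close> into
  \<open>w\<close>.\<close>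

section \<open>The smallest eigenvalue of a symmetric matrix\<close>

lemma linear_term_zero:
  fixes a c :: real
  assumes "\<And>t. 0 \<le> 2 * t * a + t\<^sup>2 * c"
  shows "a = 0"
proof (rule ccontr)
  assume "a \<noteq> 0"
  define t where "t = - a / (\<bar>c\<bar> + 1)"
  have p: "\<bar>c\<bar> + 1 > 0" by simp
  have "2 * t * a + t\<^sup>2 * c = (a\<^sup>2 / (\<bar>c\<bar> + 1)\<^sup>2) * (c - 2 * (\<bar>c\<bar> + 1))"
  proof -
    have a: "a = - t * (\<bar>c\<bar> + 1)" using p by (simp add: t_def)
    have "a\<^sup>2 / (\<bar>c\<bar> + 1)\<^sup>2 = t\<^sup>2" using p by (simp add: t_def power_divide)
    then show ?thesis by (simp add: a power2_eq_square algebra_simps)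
  qed
  moreover have "c - 2 * (\<bar>c\<bar> + 1) < 0" by (simp add: abs_if)
  moreover have "a\<^sup>2 / (\<bar>c\<bar> + 1)\<^sup>2 > 0" using \<open>a \<noteq> 0\<close> p by simp
  ultimately have "2 * t * a + t\<^sup>2 * c < 0" by (metis mult_pos_neg)
  with assms[of t] show False by simp
qed

lemma inner_transpose:
  fixes M :: "real^'n^'n"
  shows "v \<bullet> (M *v w) = (transpose M *v v) \<bullet> w"
  by (metis dot_lmul_matrix transpose_matrix_vector)

text \<open>First variation of the Rayleigh quotient: in the direction \<open>w\<close> the
  inequality is a polynomial in \<open>t\<close> without constant term, and its linear coefficient
  is the residual of the eigenvalue equation paired with \<open>w\<close>.\<close>

lemma symmetric_minimizer_eigenvector:
  fixes M :: "real^'n^'n"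
  assumes sym: "transpose M = M" and v0: "norm v0 = 1"
    and min: "\<And>w. (v0 \<bullet> (M *v v0)) * (w \<bullet> w) \<le> w \<bullet> (M *v w)"
  shows "M *v v0 = (v0 \<bullet> (M *v v0)) *\<^sub>R v0"
proof -
  let ?l = "v0 \<bullet> (M *v v0)"
  have "(M *v v0 - ?l *\<^sub>R v0) \<bullet> w = 0" for w
  proof (rule linear_term_zero)
    fix t :: real
    have 1: "v0 \<bullet> (M *v w) = w \<bullet> (M *v v0)"
      using inner_transpose[of v0 M w] sym by (simp add: inner_commute)
    have 2: "v0 \<bullet> v0 = 1" using v0 by (simp add: norm_eq_1)
    have "?l * ((v0 + t *\<^sub>R w) \<bullet> (v0 + t *\<^sub>R w)) \<le> (v0 + t *\<^sub>R w) \<bullet> (M *v (v0 + t *\<^sub>R w))"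
      by (rule min)
    then show "0 \<le> 2 * t * ((M *v v0 - ?l *\<^sub>R v0) \<bullet> w) + t\<^sup>2 * (w \<bullet> (M *v w) - ?l * (w \<bullet> w))"
      by (simp add: matrix_vector_right_distrib matrix_vector_mult_scaleR inner_add_left
          inner_add_right inner_diff_left 1 2 inner_commute[of w v0] inner_commute[of "M *v v0" w]
          algebra_simps power2_eq_square)
  qed
  then show ?thesis by (metis inner_eq_zero_iff eq_iff_diff_eq_0)
qed

text \<open>Needed because \<open>lambda_min\<close> is a \<open>Min\<close>, which is meaningful
  only on a finite set. Eigenvectors of a symmetric matrix for distinct eigenvalues are orthogonal,
  hence independent, so the dimension bounds their number.\<close>

lemma finite_eigenvalues_symmetric:
  fixes M :: "real^'n^'n"
  assumes sym: "transpose M = M"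
  shows "finite {l. \<exists>v. v \<noteq> 0 \<and> M *v v = l *\<^sub>R v}" (is "finite ?E")
proof -
  define f where "f l = (SOME v. v \<noteq> 0 \<and> M *v v = l *\<^sub>R v)" for l
  have f: "f l \<noteq> 0 \<and> M *v f l = l *\<^sub>R f l" if "l \<in> ?E" for l
    unfolding f_def by (rule someI_ex) (use that in simp)
  have orth: "f l \<bullet> f m = 0" if "l \<in> ?E" "m \<in> ?E" "l \<noteq> m" for l m
  proof -
    have "f l \<bullet> (M *v f m) = (M *v f l) \<bullet> f m" using inner_transpose[of "f l" M "f m"] sym by simp
    then have "m * (f l \<bullet> f m) = l * (f l \<bullet> f m)" using f that by simp
    then show ?thesis using that by simp
  qed
  have inj: "inj_on f ?E"
  proof (rule inj_onI, rule ccontr)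
    fix x y assume a: "x \<in> ?E" "y \<in> ?E" "f x = f y" "x \<noteq> y"
    then have "f x \<bullet> f x = 0" using orth[of x y] by simp
    then show False using f a by simp
  qed
  have "pairwise orthogonal (f ` ?E)"
    unfolding pairwise_def orthogonal_def using orth by blast
  moreover have "0 \<notin> f ` ?E" using f by fastforce
  ultimately have "finite (f ` ?E)"
    using pairwise_orthogonal_independent independent_imp_finite by blast
  then show ?thesis using inj finite_image_iff by blast
qed

text \<open>A minimiser of the form on the unit sphere is an eigenvector, and no eigenvalue can be
  smaller than the minimum. Everything later uses \<open>lambda_min\<close> only through this
  variational description.\<close>

lemma lambda_min_rayleigh:
  fixes M :: "real^'n^'n"
  assumes sym: "transpose M = M"
  shows "lambda_min M * (v \<bullet> v) \<le> v \<bullet> (M *v v)"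
    and "\<exists>v. norm v = 1 \<and> v \<bullet> (M *v v) = lambda_min M"
proof -
  have "\<exists>v0\<in>sphere 0 1. \<forall>w\<in>sphere 0 1. v0 \<bullet> (M *v v0) \<le> w \<bullet> (M *v w)"
    by (rule continuous_attains_inf)
      (auto intro!: continuous_intros matrix_vector_mult_linear_continuous_on)
  then obtain v0 :: "real^'n" where v0: "norm v0 = 1" and
    le: "\<And>w. norm w = 1 \<Longrightarrow> v0 \<bullet> (M *v v0) \<le> w \<bullet> (M *v w)" by auto
  define l where "l = v0 \<bullet> (M *v v0)"
  have min: "l * (w \<bullet> w) \<le> w \<bullet> (M *v w)" for w
  proof (cases "w = 0")
    case False
    have "l \<le> (w /\<^sub>R norm w) \<bullet> (M *v (w /\<^sub>R norm w))" unfolding l_def using False by (intro le) simp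
    then have "l \<le> (w \<bullet> (M *v w)) / (norm w)\<^sup>2"
      by (simp add: matrix_vector_mult_scaleR power2_eq_square divide_inverse mult_ac)
    then show ?thesis using False by (simp add: field_simps dot_square_norm)
  qed simp
  have eig: "M *v v0 = l *\<^sub>R v0"
    unfolding l_def using min unfolding l_def by (rule symmetric_minimizer_eigenvector[OF sym v0])
  have "lambda_min M = l" unfolding lambda_min_def
  proof (rule Min_eqI)
    show "finite {l. \<exists>v. v \<noteq> 0 \<and> M *v v = l *\<^sub>R v}" by (rule finite_eigenvalues_symmetric[OF sym])
    show "l \<in> {l. \<exists>v. v \<noteq> 0 \<and> M *v v = l *\<^sub>R v}" using eig v0 by (auto intro!: exI[of _ v0])
  next
    fix m assume "m \<in> {l. \<exists>v. v \<noteq> 0 \<and> M *v v = l *\<^sub>R v}"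
    then obtain v where v: "v \<noteq> 0" "M *v v = m *\<^sub>R v" by auto
    then show "l \<le> m" using min[of v] by simp
  qed
  then show "lambda_min M * (v \<bullet> v) \<le> v \<bullet> (M *v v)"
    and "\<exists>v. norm v = 1 \<and> v \<bullet> (M *v v) = lambda_min M"
    using min v0 l_def by auto
qed

lemma lambda_min_ge:
  fixes M :: "real^'n^'n"
  assumes "transpose M = M" "\<And>v. norm v = 1 \<Longrightarrow> c \<le> v \<bullet> (M *v v)"
  shows "c \<le> lambda_min M"
  using lambda_min_rayleigh(2)[OF assms(1)] assms(2) by force

text \<open>Here \<open>norm M\<close> is the Euclidean norm of the entries, so Cauchy-Schwarz
  applied row by row is enough.\<close>

lemma norm_matrix_vector_le:
  fixes M :: "real^'n^'n"
  shows "norm (M *v v) \<le> norm M * norm v"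
proof -
  have "norm (M *v v) = L2_set (\<lambda>i. \<bar>(M $ i) \<bullet> v\<bar>) UNIV"
    by (simp add: norm_vec_def matrix_vector_mul_component)
  also have "\<dots> \<le> L2_set (\<lambda>i. norm (M $ i) * norm v) UNIV"
    by (rule L2_set_mono) (auto simp: Cauchy_Schwarz_ineq2)
  also have "\<dots> = norm M * norm v"
    by (simp add: L2_set_left_distrib norm_vec_def)
  finally show ?thesis .
qed

text \<open>Testing one matrix with a unit minimiser of the other shows that the smallest eigenvalue
  is Lipschitz with constant 1.\<close>

lemma continuous_on_lambda_min:
  "continuous_on {M :: real^'n^'n. transpose M = M} lambda_min"
proof -
  have *: "lambda_min M \<le> lambda_min M' + norm (M - M')"
    if M: "transpose M = M" and M': "transpose M' = M'" for M M' :: "real^'n^'n"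
  proof -
    obtain v where v: "norm v = 1" "v \<bullet> (M' *v v) = lambda_min M'"
      using lambda_min_rayleigh(2)[OF M'] by auto
    have "lambda_min M \<le> v \<bullet> (M *v v)"
      using lambda_min_rayleigh(1)[OF M, of v] v by (simp add: norm_eq_1)
    also have "\<dots> = v \<bullet> (M' *v v) + v \<bullet> ((M - M') *v v)"
      by (simp add: matrix_vector_mult_diff_rdistrib inner_diff_right)
    also have "v \<bullet> ((M - M') *v v) \<le> norm (M - M')"
      using norm_cauchy_schwarz[of v "(M - M') *v v"] norm_matrix_vector_le[of "M - M'" v] v by simp
    finally show ?thesis using v by simp
  qed
  have "dist (lambda_min M) (lambda_min M') \<le> 1 * dist M M'"
    if "transpose M = M" "transpose M' = M'" for M M' :: "real^'n^'n"
    using *[of M M'] *[of M' M] that by (simp add: dist_norm norm_minus_commute abs_le_iff)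
  then have "1-lipschitz_on {M :: real^'n^'n. transpose M = M} lambda_min"
    by (intro lipschitz_onI) auto
  then show ?thesis by (rule lipschitz_on_continuous_on)
qed

section \<open>The matrix exponential\<close>

lemma mat_power_scaleR: "mat_power (t *\<^sub>R A) k = t ^ k *\<^sub>R mat_power A k"
  by (induction k) (auto simp: scalar_matrix_assoc matrix_scalar_ac mult.commute)

lemma mat_power_commute: "mat_power A k ** A = A ** mat_power A k"
  by (induction k) (auto simp: matrix_mul_assoc[symmetric])

lemma transpose_mat_power: "transpose (mat_power A k) = mat_power (transpose A) k"
  by (induction k) (simp_all add: matrix_transpose_mul transpose_mat mat_power_commute)

lemma mat_power_add: "mat_power A (j + k) = mat_power A j ** mat_power A k"
  by (induction j) (auto simp: matrix_mul_assoc)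

lemma norm_mat_power_vec:
  fixes A :: "real^'n^'n"
  shows "norm (mat_power A k *v b) \<le> norm A ^ k * norm b"
proof (induction k)
  case (Suc k)
  have "norm (mat_power A (Suc k) *v b) \<le> norm A * norm (mat_power A k *v b)"
    using norm_matrix_vector_le by (simp add: matrix_vector_mul_assoc[symmetric])
  also have "\<dots> \<le> norm A * (norm A ^ k * norm b)"
    using Suc by (simp add: mult_left_mono)
  finally show ?case by (simp add: mult.assoc)
qed simp

lemma norm_matrix_mult_le:
  fixes A B :: "real^'n^'n"
  shows "norm (A ** B) \<le> norm A * norm B"
proof -
  have t: "norm (transpose M) = norm M" for M :: "real^'n^'n"
    by (simp add: norm_eq_sqrt_inner inner_vec_def transpose_def) (subst sum.swap, simp)
  have row: "transpose (A ** B) $ i = A *v (transpose B $ i)" for i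
    by (simp add: vec_eq_iff transpose_def matrix_matrix_mult_def matrix_vector_mult_def)
  have "norm (transpose (A ** B)) = L2_set (\<lambda>i. norm (A *v (transpose B $ i))) UNIV"
    by (simp add: norm_vec_def[of "transpose (A ** B)"] row)
  also have "\<dots> \<le> L2_set (\<lambda>i. norm A * norm (transpose B $ i)) UNIV"
    by (rule L2_set_mono) (auto simp: norm_matrix_vector_le)
  also have "\<dots> = norm A * norm (transpose B)"
    by (simp add: L2_set_right_distrib norm_vec_def[of "transpose B"])
  finally show ?thesis by (simp add: t)
qed

text \<open>The factor \<open>norm (mat 1)\<close> accounts for the entrywise norm of the identity,
  which is the square root of the dimension.\<close>

lemma norm_mat_power:
  fixes A :: "real^'n^'n"
  shows "norm (mat_power A k) \<le> norm (mat 1 :: real^'n^'n) * norm A ^ k"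
proof (induction k)
  case (Suc k)
  have "norm (mat_power A (Suc k)) \<le> norm A * norm (mat_power A k)"
    using norm_matrix_mult_le by simp
  also have "\<dots> \<le> norm A * (norm (mat 1 :: real^'n^'n) * norm A ^ k)"
    using Suc by (simp add: mult_left_mono)
  finally show ?case by (simp add: algebra_simps)
qed simp

lemma summable_mat_exp:
  fixes A :: "real^'n^'n"
  shows "summable (\<lambda>k. mat_power A k /\<^sub>R fact k)"
proof (rule summable_comparison_test')
  show "summable (\<lambda>k. norm (mat 1 :: real^'n^'n) * (norm A ^ k /\<^sub>R fact k))"
    by (intro summable_mult summable_exp_generic)
  show "norm (mat_power A k /\<^sub>R fact k) \<le> norm (mat 1 :: real^'n^'n) * (norm A ^ k /\<^sub>R fact k)" for k
    using norm_mat_power[of A k] by (simp add: field_simps)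
qed

lemma bounded_linear_mat_vec: "bounded_linear (\<lambda>M :: real^'n^'n. M *v b)"
  unfolding linear_conv_bounded_linear[symmetric]
  by (intro linearI) (auto simp: matrix_vector_mult_add_rdistrib scaleR_matrix_vector_assoc)

lemma mat_exp_vec_sums:
  fixes A :: "real^'n^'n"
  shows "(\<lambda>k. (t ^ k / fact k) *\<^sub>R (mat_power A k *v b)) sums (mat_exp (t *\<^sub>R A) *v b)"
proof -
  have "(\<lambda>k. mat_power (t *\<^sub>R A) k /\<^sub>R fact k) sums mat_exp (t *\<^sub>R A)"
    unfolding mat_exp_def by (rule summable_sums[OF summable_mat_exp])
  from bounded_linear.sums[OF bounded_linear_mat_vec[of b] this]
  show ?thesis
    by (simp add: mat_power_scaleR scaleR_matrix_vector_assoc[symmetric] divide_inverse mult.commute)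
qed

text \<open>Since \<open>(k + m)!\<close> is at least \<open>k!\<close> and \<open>t\<close> is at
  most 1, the tail is dominated by \<open>norm A ^ m * t ^ m\<close> times the exponential series of
  \<open>norm A\<close>. The explicit constant is what later makes estimates uniform in
  \<open>b\<close>.\<close>

lemma mat_exp_expansion:
  fixes A :: "real^'n^'n"
  assumes "0 \<le> t" "t \<le> 1"
  shows "norm (mat_exp (t *\<^sub>R A) *v b - (\<Sum>k<m. (t ^ k / fact k) *\<^sub>R (mat_power A k *v b)))
    \<le> norm A ^ m * exp (norm A) * t ^ m * norm b"
proof -
  let ?f = "\<lambda>k. (t ^ k / fact k) *\<^sub>R (mat_power A k *v b)"
  let ?g = "\<lambda>k. norm A ^ m * t ^ m * norm b * (norm A ^ k /\<^sub>R fact k)"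
  have s: "?f sums (mat_exp (t *\<^sub>R A) *v b)" by (rule mat_exp_vec_sums)
  have "mat_exp (t *\<^sub>R A) *v b - (\<Sum>k<m. ?f k) = (\<Sum>k. ?f (k + m))"
    using suminf_minus_initial_segment[OF sums_summable[OF s], of m] sums_unique[OF s] by simp
  moreover have "norm (?f (k + m)) \<le> ?g k" for k
  proof -
    have "t ^ (k + m) / fact (k + m) \<le> t ^ m / fact k"
      using assms by (intro frac_le) (auto simp: power_add mult_left_le_one_le power_le_one fact_mono)
    then have "t ^ (k + m) / fact (k + m) * norm (mat_power A (k + m) *v b)
        \<le> t ^ m / fact k * (norm A ^ (k + m) * norm b)"
      using assms norm_mat_power_vec[of A "k + m" b] by (intro mult_mono) auto
    then have "norm (?f (k + m)) \<le> t ^ m / fact k * (norm A ^ (k + m) * norm b)"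
      using assms by simp
    then show ?thesis by (simp add: power_add field_simps)
  qed
  moreover have "?g sums (norm A ^ m * t ^ m * norm b * exp (norm A))"
    by (intro sums_mult exp_converges)
  ultimately show ?thesis
    using norm_suminf_le[of "\<lambda>k. ?f (k + m)" ?g] by (auto simp: sums_iff algebra_simps)
qed

lemma transpose_scaleR: "transpose (c *\<^sub>R A) = c *\<^sub>R transpose (A :: real^'n^'m)"
  by (simp add: transpose_def vec_eq_iff)

lemma transpose_mat_exp: "transpose (mat_exp A) = mat_exp (transpose A)"
proof -
  have "bounded_linear (transpose :: real^'n^'n \<Rightarrow> real^'n^'n)"
    unfolding linear_conv_bounded_linear[symmetric]
    by (intro linearI) (auto simp: transpose_def vec_eq_iff)
  from bounded_linear.suminf[OF this summable_mat_exp[of A]]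
  show ?thesis unfolding mat_exp_def
    by (simp add: transpose_mat_power[symmetric] transpose_scaleR)
qed

lemma inner_mat_exp:
  fixes A :: "real^'n^'n"
  shows "v \<bullet> (mat_exp (t *\<^sub>R A) *v w) = (mat_exp (t *\<^sub>R transpose A) *v v) \<bullet> w"
proof -
  have "transpose (t *\<^sub>R A) = t *\<^sub>R transpose A" by (simp add: transpose_def vec_eq_iff)
  then show ?thesis by (simp add: inner_transpose transpose_mat_exp)
qed

text \<open>Each entry is an everywhere convergent power series in \<open>t\<close>.\<close>

lemma continuous_on_mat_exp:
  fixes A :: "real^'n^'n"
  shows "continuous_on S (\<lambda>t. mat_exp (t *\<^sub>R A))"
proof -
  have "isCont (\<lambda>t. mat_exp (t *\<^sub>R A) $ i $ j) x" for i j and x :: real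
  proof -
    let ?c = "\<lambda>k. mat_power A k $ i $ j / fact k"
    have "(\<lambda>k. ?c k * t ^ k) sums (mat_exp (t *\<^sub>R A) $ i $ j)" for t
    proof -
      have "(\<lambda>k. mat_power (t *\<^sub>R A) k /\<^sub>R fact k) sums mat_exp (t *\<^sub>R A)"
        unfolding mat_exp_def by (rule summable_sums[OF summable_mat_exp])
      then have "(\<lambda>k. (mat_power (t *\<^sub>R A) k /\<^sub>R fact k) $ i $ j) sums (mat_exp (t *\<^sub>R A) $ i $ j)"
        by (intro bounded_linear.sums[OF bounded_linear_vec_nth])
      then show ?thesis by (simp add: mat_power_scaleR field_simps)
    qed
    then have eq: "(\<lambda>t. mat_exp (t *\<^sub>R A) $ i $ j) = (\<lambda>t. \<Sum>k. ?c k * t ^ k)"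
      and "\<And>t. summable (\<lambda>k. ?c k * t ^ k)"
      by (auto simp: sums_iff)
    then show ?thesis using isCont_powser_converges_everywhere[of ?c x] by simp
  qed
  then have "continuous_on S (\<lambda>t. \<chi> i j. mat_exp (t *\<^sub>R A) $ i $ j)"
    by (intro continuous_intros continuous_at_imp_continuous_on) auto
  then show ?thesis by simp
qed

section \<open>The Gramian operator\<close>

lemma bounded_linear_matrix_form:
  fixes v w :: "real^'n"
  shows "bounded_linear (\<lambda>M :: real^'n^'n. v \<bullet> (M *v w))"
  by (rule bounded_linear_compose[OF bounded_linear_inner_right bounded_linear_mat_vec])

lemma continuous_on_matrix_mult [continuous_intros]:
  fixes f g :: "'a::topological_space \<Rightarrow> real^'n^'n"
  assumes "continuous_on S f" "continuous_on S g"
  shows "continuous_on S (\<lambda>t. f t ** g t)"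
  unfolding matrix_matrix_mult_def by (intro continuous_intros assms)

lemma continuous_on_matrix_vector [continuous_intros]:
  fixes f :: "'a::topological_space \<Rightarrow> real^'n^'n"
  assumes "continuous_on S f" "continuous_on S g"
  shows "continuous_on S (\<lambda>t. f t *v g t)"
  unfolding matrix_vector_mult_def by (intro continuous_intros assms)

lemma integrable_gramian:
  fixes A :: "real^'n^'n"
  shows "(\<lambda>t. mat_exp (t *\<^sub>R A) ** X ** mat_exp (t *\<^sub>R transpose A)) integrable_on {0..T}"
  by (intro integrable_continuous_real continuous_intros continuous_on_mat_exp)

text \<open>The functional sending \<open>M\<close> to \<open>v \<bullet> (M *v w)\<close> is
  bounded and linear, so it passes under the integral. From here on the matrix-valued integral is
  handled through scalar ones.\<close>

lemma gramian_op_form: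
  fixes A :: "real^'n^'n"
  shows "v \<bullet> (gramian_op A T X *v w) =
    integral {0..T} (\<lambda>t. (mat_exp (t *\<^sub>R transpose A) *v v) \<bullet> (X *v (mat_exp (t *\<^sub>R transpose A) *v w)))"
proof -
  have "v \<bullet> (gramian_op A T X *v w) =
    integral {0..T} (\<lambda>t. v \<bullet> ((mat_exp (t *\<^sub>R A) ** X ** mat_exp (t *\<^sub>R transpose A)) *v w))"
    unfolding gramian_op_def
    using integral_linear[OF integrable_gramian bounded_linear_matrix_form[of v w]]
    by (simp add: o_def)
  then show ?thesis
    by (simp add: matrix_vector_mul_assoc[symmetric] inner_mat_exp)
qed

lemma outer_vec: "outer b *v w = (b \<bullet> w) *\<^sub>R b"
  by (simp add: vec_eq_iff outer_def matrix_vector_mult_def inner_vec_def sum_distrib_left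
      sum_distrib_right mult_ac)

lemma gramian_form:
  fixes A :: "real^'n^'n"
  shows "v \<bullet> (gramian A T b *v v) = integral {0..T} (\<lambda>t. (v \<bullet> (mat_exp (t *\<^sub>R A) *v b))\<^sup>2)"
  unfolding gramian_def gramian_op_form
  unfolding outer_vec inner_mat_exp[of v _ A b] inner_scaleR_right power2_eq_square
  by (simp only: inner_commute)

lemma matrix_eq_form:
  fixes M N :: "real^'n^'n"
  assumes "\<And>v w. v \<bullet> (M *v w) = v \<bullet> (N *v w)"
  shows "M = N"
proof -
  have "M *v w = N *v w" for w
    using assms[of _ w] vector_eq_ldot[of "M *v w" "N *v w"] by simp
  then show ?thesis by (simp add: matrix_eq)
qed

lemma transpose_gramian_op:
  fixes A X :: "real^'n^'n"
  assumes "transpose X = X"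
  shows "transpose (gramian_op A T X) = gramian_op A T X"
proof (rule matrix_eq_form)
  fix v w
  have "v \<bullet> (transpose (gramian_op A T X) *v w) = w \<bullet> (gramian_op A T X *v v)"
    using inner_transpose[of w "gramian_op A T X" v] by (simp only: inner_commute)
  also have "\<dots> = v \<bullet> (gramian_op A T X *v w)"
    unfolding gramian_op_form
  proof (rule integral_cong)
    fix t
    let ?p = "mat_exp (t *\<^sub>R transpose A) *v v" and ?q = "mat_exp (t *\<^sub>R transpose A) *v w"
    show "?q \<bullet> (X *v ?p) = ?p \<bullet> (X *v ?q)"
      using inner_transpose[of ?p X ?q] assms by (simp add: inner_commute)
  qed
  finally show "v \<bullet> (transpose (gramian_op A T X) *v w) = v \<bullet> (gramian_op A T X *v w)" .
qed

lemma transpose_outer: "transpose (outer b) = outer b"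
  by (simp add: outer_def transpose_def vec_eq_iff mult.commute)

lemma continuous_on_gramian_op:
  fixes A :: "real^'n^'n"
  shows "continuous_on S (gramian_op A T)"
proof -
  have int: "(\<lambda>t. f t) integrable_on {0..T}" if "continuous_on {0..T} f" for f :: "real \<Rightarrow> real"
    using that by (rule integrable_continuous_real)
  have "linear (gramian_op A T)"
  proof (rule linearI)
    fix X Y :: "real^'n^'n" and c :: real
    show "gramian_op A T (X + Y) = gramian_op A T X + gramian_op A T Y"
    proof (rule matrix_eq_form)
      fix v w
      let ?p = "\<lambda>t. mat_exp (t *\<^sub>R transpose A) *v v" and ?q = "\<lambda>t. mat_exp (t *\<^sub>R transpose A) *v w"
      have "integral {0..T} (\<lambda>t. ?p t \<bullet> (X *v ?q t) + ?p t \<bullet> (Y *v ?q t)) =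
        integral {0..T} (\<lambda>t. ?p t \<bullet> (X *v ?q t)) + integral {0..T} (\<lambda>t. ?p t \<bullet> (Y *v ?q t))"
        by (intro integral_add int continuous_intros continuous_on_mat_exp)
      then show "v \<bullet> (gramian_op A T (X + Y) *v w) = v \<bullet> ((gramian_op A T X + gramian_op A T Y) *v w)"
        by (simp add: gramian_op_form matrix_vector_mult_add_rdistrib inner_add_right)
    qed
    show "gramian_op A T (c *\<^sub>R X) = c *\<^sub>R gramian_op A T X"
      by (rule matrix_eq_form) (simp add: gramian_op_form scaleR_matrix_vector_assoc[symmetric])
  qed
  then show ?thesis
    by (simp add: linear_continuous_on linear_conv_bounded_linear)
qed

lemma continuous_on_lambda_min_gramian_op:
  fixes A :: "real^'n^'n"
  shows "continuous_on {X. transpose X = X} (\<lambda>X. lambda_min (gramian_op A T X))"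
  by (rule continuous_on_compose2[OF continuous_on_lambda_min continuous_on_gramian_op])
     (auto simp: transpose_gramian_op)

section \<open>Attainment of the maxima\<close>

lemma Greatest_attained:
  fixes f :: "'a::topological_space \<Rightarrow> real"
  assumes "compact S" "S \<noteq> {}" "continuous_on S f"
  shows "\<exists>x\<in>S. f x = (GREATEST m. m \<in> f ` S)" "\<And>x. x \<in> S \<Longrightarrow> f x \<le> (GREATEST m. m \<in> f ` S)"
proof -
  obtain x where x: "x \<in> S" "\<And>y. y \<in> S \<Longrightarrow> f y \<le> f x"
    using continuous_attains_sup[OF assms] by auto
  then have "(GREATEST m. m \<in> f ` S) = f x" by (intro Greatest_equality) auto
  then show "\<exists>x\<in>S. f x = (GREATEST m. m \<in> f ` S)" "\<And>x. x \<in> S \<Longrightarrow> f x \<le> (GREATEST m. m \<in> f ` S)"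
    using x by auto
qed

lemma sphere_cart_nonempty: "{b :: real^'n. norm b = 1} \<noteq> {}"
proof -
  obtain b :: "real^'n" where "norm b = 1" using vector_choose_size[of 1] by auto
  then show ?thesis by auto
qed

lemma gamma1_attained:
  fixes A :: "real^'n^'n"
  shows "\<exists>b. norm b = 1 \<and> lambda_min (gramian A T b) = gamma1 A T"
    and "norm b = 1 \<Longrightarrow> lambda_min (gramian A T b) \<le> gamma1 A T"
proof -
  have s: "{b :: real^'n. norm b = 1} = sphere 0 1" by auto
  have c: "compact {b :: real^'n. norm b = 1}" unfolding s by simp
  have "continuous_on {b. norm b = 1} (\<lambda>b. lambda_min (gramian A T b))"
    unfolding gramian_def
    by (rule continuous_on_compose2[OF continuous_on_lambda_min_gramian_op])
       (auto simp: transpose_outer, simp add: outer_def, intro continuous_intros)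
  note * = Greatest_attained[OF c sphere_cart_nonempty this, folded gamma1_def]
  show "\<exists>b. norm b = 1 \<and> lambda_min (gramian A T b) = gamma1 A T"
    using *(1) by blast
  show "norm b = 1 \<Longrightarrow> lambda_min (gramian A T b) \<le> gamma1 A T"
    using *(2)[of b] by blast
qed

lemma matrix_form_axis:
  fixes X :: "real^'n^'n"
  shows "axis i 1 \<bullet> (X *v axis j 1) = X $ i $ j"
  by (simp add: inner_axis' matrix_vector_mul_component inner_axis)

text \<open>Testing with the sum and the difference of two coordinate vectors bounds an off-diagonal
  entry by the mean of two diagonal entries, and these are nonnegative with sum 1. This yields
  boundedness of the feasible set of the relaxed problem.\<close>

lemma psd_entry_le:
  fixes X :: "real^'n^'n"
  assumes "psd X" "trace X = 1"
  shows "\<bar>X $ i $ j\<bar> \<le> 1"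
proof -
  have sym: "X $ j $ i = X $ i $ j"
  proof -
    have "transpose X $ i $ j = X $ i $ j" using assms(1) by (simp add: psd_def)
    then show ?thesis by (simp add: transpose_def)
  qed
  have pos: "0 \<le> v \<bullet> (X *v v)" for v using assms(1) by (simp add: psd_def)
  have diag: "0 \<le> X $ k $ k" for k using pos[of "axis k 1"] by (simp add: matrix_form_axis)
  have le: "X $ k $ k \<le> 1" for k
    using member_le_sum[of k UNIV "\<lambda>k. X $ k $ k"] diag assms(2) by (simp add: trace_def)
  have "0 \<le> X $ i $ i + X $ j $ j + 2 * X $ i $ j"
    using pos[of "axis i 1 + axis j 1"]
    by (simp add: matrix_vector_right_distrib inner_add_left inner_add_right matrix_form_axis sym)
  moreover have "0 \<le> X $ i $ i + X $ j $ j - 2 * X $ i $ j"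
    using pos[of "axis i 1 - axis j 1"]
    by (simp add: matrix_vector_mult_diff_distrib inner_diff_left inner_diff_right matrix_form_axis sym)
  ultimately show ?thesis using le[of i] le[of j] by linarith
qed

lemma psd_norm_le:
  fixes X :: "real^'n^'n"
  assumes "psd X" "trace X = 1"
  shows "norm X \<le> real CARD('n) * real CARD('n)"
proof -
  have "norm (X $ i) \<le> real CARD('n)" for i
  proof -
    have "norm (X $ i) \<le> (\<Sum>j\<in>UNIV. \<bar>X $ i $ j\<bar>)" by (rule norm_le_l1_cart)
    also have "\<dots> \<le> (\<Sum>j\<in>(UNIV::'n set). 1)" by (intro sum_mono psd_entry_le assms)
    finally show ?thesis by simp
  qed
  then have "(\<Sum>i\<in>UNIV. norm (X $ i)) \<le> (\<Sum>i\<in>(UNIV::'n set). real CARD('n))" by (intro sum_mono)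
  moreover have "norm X \<le> (\<Sum>i\<in>UNIV. norm (X $ i))"
    unfolding norm_vec_def by (rule L2_set_le_sum) simp
  ultimately show ?thesis by simp
qed

lemma trace_scaleR: "trace (c *\<^sub>R A) = c * trace (A :: real^'n^'n)"
  by (simp add: trace_def sum_distrib_left)

lemma trace_transpose: "trace (transpose A) = trace (A :: real^'n^'n)"
  by (simp add: trace_def transpose_def)

lemma trace_mat_1: "trace (mat 1 :: real^'n^'n) = real CARD('n)"
  by (simp add: trace_def mat_def)

lemma compact_psd: "compact {X :: real^'n^'n. psd X \<and> trace X = 1}"
proof -
  have "bounded {X :: real^'n^'n. psd X \<and> trace X = 1}"
    using psd_norm_le by (auto simp: bounded_iff)
  moreover have "closed {X :: real^'n^'n. psd X \<and> trace X = 1}"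
  proof -
    have "{X :: real^'n^'n. psd X \<and> trace X = 1} =
       {X. transpose X = X} \<inter> (\<Inter>v. {X. 0 \<le> v \<bullet> (X *v v)}) \<inter> {X. trace X = 1}"
      by (auto simp: psd_def)
    also have "closed \<dots>"
      unfolding transpose_def trace_def
      by (intro closed_Int closed_INT closed_Collect_eq closed_Collect_le ballI continuous_intros)
    finally show ?thesis .
  qed
  ultimately show ?thesis by (simp add: compact_eq_bounded_closed)
qed

lemma psd_trace_nonempty: "{X :: real^'n^'n. psd X \<and> trace X = 1} \<noteq> {}"
proof -
  have "psd ((1 / real CARD('n)) *\<^sub>R mat 1 :: real^'n^'n)"
    by (simp add: psd_def transpose_scaleR transpose_mat scaleR_matrix_vector_assoc[symmetric])
  moreover have "trace ((1 / real CARD('n)) *\<^sub>R mat 1 :: real^'n^'n) = 1"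
    by (simp add: trace_scaleR trace_mat_1)
  ultimately show ?thesis by blast
qed

lemma gamma_rel_attained:
  fixes A :: "real^'n^'n"
  shows "\<exists>X. psd X \<and> trace X = 1 \<and> lambda_min (gramian_op A T X) = gamma_rel A T"
    and "psd X \<Longrightarrow> trace X = 1 \<Longrightarrow> lambda_min (gramian_op A T X) \<le> gamma_rel A T"
proof -
  have "continuous_on {X. psd X \<and> trace X = 1} (\<lambda>X. lambda_min (gramian_op A T X))"
    by (rule continuous_on_subset[OF continuous_on_lambda_min_gramian_op]) (auto simp: psd_def)
  note * = Greatest_attained[OF compact_psd psd_trace_nonempty this, folded gamma_rel_def]
  show "\<exists>X. psd X \<and> trace X = 1 \<and> lambda_min (gramian_op A T X) = gamma_rel A T"
    using *(1) by blast
  show "psd X \<Longrightarrow> trace X = 1 \<Longrightarrow> lambda_min (gramian_op A T X) \<le> gamma_rel A T"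
    using *(2)[of X] by blast
qed

section \<open>Short horizons: the relaxed problem\<close>

lemma matrix_form_le:
  fixes X :: "real^'n^'n"
  shows "\<bar>v \<bullet> (X *v w)\<bar> \<le> norm X * (norm v * norm w)"
proof -
  have "\<bar>v \<bullet> (X *v w)\<bar> \<le> norm v * norm (X *v w)" by (rule Cauchy_Schwarz_ineq2)
  also have "\<dots> \<le> norm v * (norm X * norm w)" by (intro mult_left_mono norm_matrix_vector_le) simp
  finally show ?thesis by (simp add: algebra_simps)
qed

lemma symmetric_form_commute:
  fixes X :: "real^'n^'n"
  assumes "transpose X = X"
  shows "v \<bullet> (X *v w) = w \<bullet> (X *v v)"
  using inner_transpose[of v X w] assms by (simp add: inner_commute)

text \<open>With \<open>B = transpose A\<close>, the expansion
  \<open>exp (t B) v = v + t B v + O(t^2)\<close> is inserted into the form. Symmetry of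
  \<open>X\<close> merges the two cross terms, and the integral of \<open>2 t\<close> is the
  \<open>T\<^sup>2\<close> of the statement. The constant is independent of \<open>X\<close> and
  \<open>v\<close>.\<close>

lemma gramian_op_expansion:
  fixes A :: "real^'n^'n"
  obtains C where "0 \<le> C"
    "\<And>T X v. 0 \<le> T \<Longrightarrow> T \<le> 1 \<Longrightarrow> transpose X = X \<Longrightarrow>
      \<bar>v \<bullet> (gramian_op A T X *v v) - (T * (v \<bullet> (X *v v)) + T\<^sup>2 * ((transpose A *v v) \<bullet> (X *v v)))\<bar>
        \<le> C * norm X * (norm v)\<^sup>2 * T ^ 3"
proof -
  define B where "B = transpose A"
  define a where "a = norm B"
  \<comment> \<open>\<open>K * t\<^sup>2 * norm v\<close> bounds the second-order Taylor remainder
    \<open>r\<close>. The three summands of \<open>C\<close> bound the cross terms of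
    \<open>p\<close> and \<open>r\<close>, the form at \<open>r\<close>, and the form at
    \<open>t B v\<close>.\<close>
  define K where "K = a\<^sup>2 * exp a"
  define C where "C = 2 * (1 + a) * K + K\<^sup>2 + a\<^sup>2"
  have a0: "0 \<le> a" by (simp add: a_def)
  have K0: "0 \<le> K" by (simp add: K_def)
  have C0: "0 \<le> C" using a0 K0 by (simp add: C_def)
  have pt: "\<bar>(mat_exp (t *\<^sub>R B) *v v) \<bullet> (X *v (mat_exp (t *\<^sub>R B) *v v)) -
      (v \<bullet> (X *v v) + t * (2 * ((B *v v) \<bullet> (X *v v))))\<bar> \<le> C * norm X * (norm v)\<^sup>2 * t\<^sup>2"
    if t: "0 \<le> t" "t \<le> 1" and X: "transpose X = X" for t v and X :: "real^'n^'n"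
  proof -
    define p where "p = v + t *\<^sub>R (B *v v)"
    define r where "r = mat_exp (t *\<^sub>R B) *v v - p"
    have w: "mat_exp (t *\<^sub>R B) *v v = p + r" by (simp add: r_def)
    have r: "norm r \<le> K * t\<^sup>2 * norm v"
      using mat_exp_expansion[OF t, of B v 2]
      by (simp add: r_def p_def K_def a_def numeral_2_eq_2)
    have Bv: "norm (B *v v) \<le> a * norm v" using norm_matrix_vector_le by (simp add: a_def)
    have "norm p \<le> norm v + t * norm (B *v v)"
      using norm_triangle_ineq[of v "t *\<^sub>R (B *v v)"] t by (simp add: p_def)
    also have "t * norm (B *v v) \<le> 1 * (a * norm v)" using t Bv by (intro mult_mono) auto
    finally have p: "norm p \<le> (1 + a) * norm v" by (simp add: algebra_simps)
    have t2: "t\<^sup>2 * t\<^sup>2 \<le> t\<^sup>2" using t by (intro mult_left_le) (simp_all add: power_le_one)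
    have e1: "\<bar>p \<bullet> (X *v r)\<bar> \<le> norm X * ((1 + a) * norm v * (K * t\<^sup>2 * norm v))"
      by (rule order_trans[OF matrix_form_le]) (intro mult_left_mono mult_mono p r; use a0 in simp)
    have "\<bar>r \<bullet> (X *v r)\<bar> \<le> norm X * (K * t\<^sup>2 * norm v * (K * t\<^sup>2 * norm v))"
      by (rule order_trans[OF matrix_form_le]) (intro mult_left_mono mult_mono r; use K0 in simp)
    also have "\<dots> = norm X * K\<^sup>2 * (norm v)\<^sup>2 * (t\<^sup>2 * t\<^sup>2)" by (simp add: power2_eq_square)
    also have "\<dots> \<le> norm X * K\<^sup>2 * (norm v)\<^sup>2 * t\<^sup>2" using t2 by (intro mult_left_mono) auto
    finally have e2: "\<bar>r \<bullet> (X *v r)\<bar> \<le> norm X * K\<^sup>2 * (norm v)\<^sup>2 * t\<^sup>2" .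
    have e3: "\<bar>(B *v v) \<bullet> (X *v (B *v v))\<bar> \<le> norm X * (a * norm v * (a * norm v))"
      by (rule order_trans[OF matrix_form_le]) (intro mult_left_mono mult_mono Bv; use a0 in simp)
    have "(p + r) \<bullet> (X *v (p + r)) - (v \<bullet> (X *v v) + t * (2 * ((B *v v) \<bullet> (X *v v))))
      = 2 * (p \<bullet> (X *v r)) + r \<bullet> (X *v r) + t\<^sup>2 * ((B *v v) \<bullet> (X *v (B *v v)))"
      using symmetric_form_commute[OF X, of r p] symmetric_form_commute[OF X, of v "B *v v"]
      by (simp add: p_def matrix_vector_right_distrib inner_add_left inner_add_right
          matrix_vector_mult_scaleR power2_eq_square algebra_simps)
    also have "\<bar>\<dots>\<bar> \<le> 2 * \<bar>p \<bullet> (X *v r)\<bar> + \<bar>r \<bullet> (X *v r)\<bar> + t\<^sup>2 * \<bar>(B *v v) \<bullet> (X *v (B *v v))\<bar>"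
      by (intro order_trans[OF abs_triangle_ineq] add_mono) (auto simp: abs_mult)
    also have "\<dots> \<le> 2 * (norm X * ((1 + a) * norm v * (K * t\<^sup>2 * norm v))) + norm X * K\<^sup>2 * (norm v)\<^sup>2 * t\<^sup>2
        + t\<^sup>2 * (norm X * (a * norm v * (a * norm v)))"
      using e1 e2 e3 by (intro add_mono mult_left_mono) auto
    also have "\<dots> = C * norm X * (norm v)\<^sup>2 * t\<^sup>2"
      by (simp add: C_def power2_eq_square algebra_simps)
    finally show ?thesis unfolding w .
  qed
  show thesis
  proof (rule that[OF C0])
    fix T :: real and X :: "real^'n^'n" and v
    assume T: "0 \<le> T" "T \<le> 1" and X: "transpose X = X"
    let ?q = "\<lambda>t. (mat_exp (t *\<^sub>R B) *v v) \<bullet> (X *v (mat_exp (t *\<^sub>R B) *v v))"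
    let ?c = "v \<bullet> (X *v v)" and ?d = "(B *v v) \<bullet> (X *v v)"
    have i1: "((\<lambda>t. ?c + t * (2 * ?d)) has_integral (?c * T + T\<^sup>2 * ?d) - (?c * 0 + 0\<^sup>2 * ?d)) {0..T}"
      using T by (intro fundamental_theorem_of_calculus)
        (auto intro!: derivative_eq_intros simp: has_real_derivative_iff_has_vector_derivative[symmetric])
    have i2: "?q integrable_on {0..T}"
      by (intro integrable_continuous_real continuous_intros continuous_on_mat_exp)
    have "norm (integral {0..T} (\<lambda>t. ?q t - (?c + t * (2 * ?d))))
        \<le> integral {0..T} (\<lambda>t. C * norm X * (norm v)\<^sup>2 * T\<^sup>2)"
    proof (rule integral_norm_bound_integral)
      show "(\<lambda>t. ?q t - (?c + t * (2 * ?d))) integrable_on {0..T}"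
        using i1 i2 by (intro integrable_diff) auto
      fix t assume t: "t \<in> {0..T}"
      then have "norm (?q t - (?c + t * (2 * ?d))) \<le> C * norm X * (norm v)\<^sup>2 * t\<^sup>2"
        using pt[of t X v] T X by simp
      also have "\<dots> \<le> C * norm X * (norm v)\<^sup>2 * T\<^sup>2"
        using t C0 by (intro mult_left_mono power_mono) auto
      finally show "norm (?q t - (?c + t * (2 * ?d))) \<le> C * norm X * (norm v)\<^sup>2 * T\<^sup>2" .
    qed auto
    moreover have "integral {0..T} (\<lambda>t. ?q t - (?c + t * (2 * ?d))) = integral {0..T} ?q - (?c * T + T\<^sup>2 * ?d)"
      using i1 i2 by (subst integral_diff) (auto simp: integral_unique has_integral_integrable)
    ultimately show "\<bar>v \<bullet> (gramian_op A T X *v v) - (T * (v \<bullet> (X *v v)) + T\<^sup>2 * ((transpose A *v v) \<bullet> (X *v v)))\<bar>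
        \<le> C * norm X * (norm v)\<^sup>2 * T ^ 3"
      using T by (simp add: gramian_op_form B_def[symmetric] power2_eq_square power3_eq_cube mult_ac)
  qed
qed

text \<open>For each coordinate vector \<open>e\<close> the form is tested with
  \<open>z = e - (T / 2) B e\<close>. The factor one half makes the terms of order
  \<open>T\<^sup>2\<close> cancel and leaves \<open>T * X $ i $ i\<close>. Summing over the
  coordinates turns this into the trace, so the unknown optimal \<open>X\<close> disappears, while
  the squared norms sum to \<open>n - T tr A\<close> at first order.\<close>

lemma gamma_rel_upper:
  fixes A :: "real^'n^'n"
  obtains K where "\<And>T. 0 < T \<Longrightarrow> T \<le> 1 \<Longrightarrow> 0 \<le> gamma_rel A T \<Longrightarrow>
     gamma_rel A T * (real CARD('n) - T * trace A) \<le> T + K * T ^ 3"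
proof -
  obtain C where C: "0 \<le> C"
    "\<And>T X v. 0 \<le> T \<Longrightarrow> T \<le> 1 \<Longrightarrow> transpose X = X \<Longrightarrow>
      \<bar>v \<bullet> (gramian_op A T X *v v) - (T * (v \<bullet> (X *v v)) + T\<^sup>2 * ((transpose A *v v) \<bullet> (X *v v)))\<bar>
        \<le> C * norm X * (norm v)\<^sup>2 * T ^ 3"
    using gramian_op_expansion by blast
  define B where "B = transpose A"
  define a where "a = norm B"
  define n where "n = real CARD('n)"
  define K where "K = n\<^sup>2 * (C * (1 + a)\<^sup>2 + a\<^sup>2 + a ^ 3)"
  have a0: "0 \<le> a" by (simp add: a_def)
  show thesis
  proof (rule that[of "n * K"])
    fix T :: real assume T: "0 < T" "T \<le> 1" and pos: "0 \<le> gamma_rel A T"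
    obtain X where X: "psd X" "trace X = 1" "lambda_min (gramian_op A T X) = gamma_rel A T"
      using gamma_rel_attained(1) by blast
    have sym: "transpose X = X" using X by (simp add: psd_def)
    have nX: "norm X \<le> n\<^sup>2" using psd_norm_le X by (simp add: n_def power2_eq_square)
    have z: "gamma_rel A T * (1 - T * (axis i 1 \<bullet> (A *v axis i 1))) \<le> T * X $ i $ i + K * T ^ 3" for i
    proof -
      define e :: "real^'n" where "e = axis i 1"
      define z where "z = e - (T / 2) *\<^sub>R (B *v e)"
      have e: "norm e = 1" "e \<bullet> e = 1" by (simp_all add: e_def norm_axis_1 inner_axis_axis)
      have Be: "norm (B *v e) \<le> a" using norm_matrix_vector_le[of B e] e by (simp add: a_def)
      have "norm (B *v (B *v e)) \<le> a * norm (B *v e)" using norm_matrix_vector_le by (simp add: a_def)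
      also have "\<dots> \<le> a * a" using Be a0 by (rule mult_left_mono)
      finally have BBe: "norm (B *v (B *v e)) \<le> a * a" .
      have eB: "e \<bullet> (B *v e) = e \<bullet> (A *v e)"
        using inner_transpose[of e A e] by (simp add: B_def inner_commute)
      have "norm z \<le> norm e + norm ((T / 2) *\<^sub>R (B *v e))" unfolding z_def by (rule norm_triangle_ineq4)
      also have "norm ((T / 2) *\<^sub>R (B *v e)) \<le> 1 * a"
        using T Be unfolding norm_scaleR by (intro mult_mono) auto
      finally have nz: "norm z \<le> 1 + a" using e by simp
      \<comment> \<open>The nonnegative term \<open>T^2 / 4\<close> times the squared norm of
        \<open>B e\<close> is dropped. Multiplying this bound by \<open>gamma_rel A T\<close> uses
        the sign assumption \<open>pos\<close>.\<close>
      have zz: "1 - T * (e \<bullet> (A *v e)) \<le> z \<bullet> z"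
        using e(2) eB zero_le_mult_iff[of "T * T" "(B *v e) \<bullet> (B *v e)"]
        by (simp add: field_simps z_def inner_diff_left inner_diff_right inner_commute[of "B *v e" e])
      let ?P1 = "(B *v (B *v e)) \<bullet> (X *v e)" and ?P2 = "(B *v e) \<bullet> (X *v (B *v e))"
        and ?P3 = "(B *v (B *v e)) \<bullet> (X *v (B *v e))"
      have P1: "\<bar>?P1\<bar> \<le> n\<^sup>2 * (a * a * 1)"
        by (rule order_trans[OF matrix_form_le]) (intro mult_mono BBe nX; use e a0 in simp)
      have P2: "\<bar>?P2\<bar> \<le> n\<^sup>2 * (a * a)"
        by (rule order_trans[OF matrix_form_le]) (intro mult_mono Be nX; use e a0 in simp)
      have P3: "\<bar>?P3\<bar> \<le> n\<^sup>2 * (a * a * a)"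
        by (rule order_trans[OF matrix_form_le]) (intro mult_mono Be BBe nX; use e a0 in simp)
      have main: "T * (z \<bullet> (X *v z)) + T\<^sup>2 * ((B *v z) \<bullet> (X *v z)) =
          T * X $ i $ i + T ^ 3 * (?P2 / 4 - ?P1 / 2 - ?P2 / 2 + T * (?P3 / 4))"
      proof -
        have "X $ i $ i = e \<bullet> (X *v e)" by (simp add: e_def matrix_form_axis)
        then show ?thesis using symmetric_form_commute[OF sym, of e "B *v e"]
          by (simp add: z_def matrix_vector_mult_diff_distrib inner_diff_left inner_diff_right
             matrix_vector_mult_scaleR power2_eq_square power3_eq_cube field_simps)
      qed
      have TP3: "T * (?P3 / 4) \<le> n\<^sup>2 * (a * a * a)"
      proof -
        have "T * (?P3 / 4) \<le> T * \<bar>?P3\<bar>" using T by (intro mult_left_mono) auto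
        also have "\<dots> \<le> 1 * \<bar>?P3\<bar>" using T by (intro mult_right_mono) auto
        finally show ?thesis using P3 by simp
      qed
      have "?P2 / 4 - ?P1 / 2 - ?P2 / 2 + T * (?P3 / 4) \<le> n\<^sup>2 * (a * a) + n\<^sup>2 * (a * a * a)"
        using P1 P2 TP3 by (simp add: abs_le_iff)
      then have "T ^ 3 * (?P2 / 4 - ?P1 / 2 - ?P2 / 2 + T * (?P3 / 4)) \<le> T ^ 3 * (n\<^sup>2 * (a * a) + n\<^sup>2 * (a * a * a))"
        using T by (intro mult_left_mono) auto
      moreover have "z \<bullet> (gramian_op A T X *v z) \<le> T * (z \<bullet> (X *v z)) + T\<^sup>2 * ((B *v z) \<bullet> (X *v z))
          + C * norm X * (norm z)\<^sup>2 * T ^ 3"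
        using C(2)[of T X z] T sym by (simp add: B_def abs_le_iff)
      moreover have "C * norm X * (norm z)\<^sup>2 * T ^ 3 \<le> C * n\<^sup>2 * (1 + a)\<^sup>2 * T ^ 3"
        using C(1) nX nz T by (intro mult_mono power_mono) auto
      ultimately have "z \<bullet> (gramian_op A T X *v z) \<le> T * X $ i $ i + K * T ^ 3"
        unfolding main by (simp add: K_def power2_eq_square power3_eq_cube algebra_simps)
      moreover have "gamma_rel A T * (z \<bullet> z) \<le> z \<bullet> (gramian_op A T X *v z)"
        using lambda_min_rayleigh(1)[OF transpose_gramian_op[OF sym]] X by metis
      moreover have "gamma_rel A T * (1 - T * (e \<bullet> (A *v e))) \<le> gamma_rel A T * (z \<bullet> z)"
        using zz pos by (rule mult_left_mono)
      ultimately show ?thesis by (simp add: e_def)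
    qed
    have "(\<Sum>i\<in>UNIV. gamma_rel A T * (1 - T * (axis i 1 \<bullet> (A *v axis i 1)))) \<le> (\<Sum>i\<in>UNIV. T * X $ i $ i + K * T ^ 3)"
      by (intro sum_mono z)
    then show "gamma_rel A T * (real CARD('n) - T * trace A) \<le> T + (n * K) * T ^ 3"
      using X(2) by (simp add: sum_distrib_left[symmetric] sum.distrib sum_subtractf trace_def matrix_form_axis
          n_def mult.assoc)
  qed
qed

lemma gamma_rel_lower:
  fixes A :: "real^'n^'n"
  obtains K T0 where "0 < T0" "\<And>T. 0 < T \<Longrightarrow> T \<le> T0 \<Longrightarrow>
     T / real CARD('n) + T\<^sup>2 * (trace A / (real CARD('n))\<^sup>2) - K * T ^ 3 \<le> gamma_rel A T"
proof -
  obtain C where C: "0 \<le> C"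
    "\<And>T X v. 0 \<le> T \<Longrightarrow> T \<le> 1 \<Longrightarrow> transpose X = X \<Longrightarrow>
      \<bar>v \<bullet> (gramian_op A T X *v v) - (T * (v \<bullet> (X *v v)) + T\<^sup>2 * ((transpose A *v v) \<bullet> (X *v v)))\<bar>
        \<le> C * norm X * (norm v)\<^sup>2 * T ^ 3"
    using gramian_op_expansion by blast
  define n where "n = real CARD('n)"
  have n0: "n > 0" by (simp add: n_def)
  define B where "B = transpose A"
  \<comment> \<open>\<open>Y\<close> is the trace-free symmetric matrix for which
    \<open>v . Y v + (v . A v) / n\<close> equals \<open>tr A / n^2\<close> on the unit sphere. Up
    to order \<open>T\<^sup>2\<close> the form of the Gramian is then constant there, so no
    direction is weaker than another.\<close>
  define Y where "Y = (trace A / n\<^sup>2) *\<^sub>R mat 1 - (1 / (2 * n)) *\<^sub>R (A + B)"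
  \<comment> \<open>This horizon gives \<open>T * norm Y \<le> 1 / n\<close>, which keeps
    \<open>I / n + T Y\<close> positive semidefinite.\<close>
  define T0 where "T0 = min 1 (1 / (n * (norm Y + 1)))"
  define K where "K = C * n\<^sup>2 + norm Y * norm B"
  have T0: "0 < T0" using n0 by (auto simp: T0_def divide_simps add_nonneg_pos)
  have symY: "transpose Y = Y"
    by (simp add: Y_def B_def transpose_def vec_eq_iff mat_def)
  have trY: "trace Y = 0"
    using n0 by (simp add: Y_def B_def trace_sub trace_add trace_scaleR trace_transpose trace_mat_1
        n_def[symmetric] power2_eq_square field_simps)
  have Bv: "(B *v v) \<bullet> v = v \<bullet> (A *v v)" for v
    using inner_transpose[of v A v] by (simp add: B_def)
  have Yv: "v \<bullet> (Y *v v) = trace A / n\<^sup>2 * (v \<bullet> v) - (v \<bullet> (A *v v)) / n" for v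
    using Bv[of v] n0 by (simp add: Y_def matrix_vector_mult_diff_rdistrib matrix_vector_mult_add_rdistrib
        scaleR_matrix_vector_assoc[symmetric] inner_diff_right inner_add_right inner_commute field_simps)
  show thesis
  proof (rule that[OF T0])
    fix T :: real assume T: "0 < T" "T \<le> T0"
    have T1: "T \<le> 1" and TY: "T * norm Y \<le> 1 / n"
    proof -
      show "T \<le> 1" using T by (simp add: T0_def)
      have "T \<le> 1 / (n * (norm Y + 1))" using T by (simp add: T0_def)
      then have "T * (norm Y + 1) \<le> 1 / n" using n0
        by (simp add: pos_le_divide_eq add_nonneg_pos mult_ac)
      then show "T * norm Y \<le> 1 / n" using T by (simp add: algebra_simps)
    qed
    define X where "X = (1 / n) *\<^sub>R mat 1 + T *\<^sub>R Y"
    have Xv: "X *v v = (1 / n) *\<^sub>R v + T *\<^sub>R (Y *v v)" for v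
      by (simp add: X_def matrix_vector_mult_add_rdistrib scaleR_matrix_vector_assoc[symmetric])
    have symX: "transpose X = X"
    proof -
      have "transpose (U + V) = transpose U + transpose V" for U V :: "real^'n^'n"
        by (simp add: transpose_def vec_eq_iff)
      then show ?thesis by (simp add: X_def transpose_scaleR symY transpose_mat)
    qed
    have "psd X" unfolding psd_def
    proof (intro conjI allI symX)
      fix v
      have "\<bar>v \<bullet> (Y *v v)\<bar> \<le> norm Y * (norm v * norm v)" by (rule matrix_form_le)
      then have "T * - (v \<bullet> (Y *v v)) \<le> T * (norm Y * (norm v * norm v))"
        using T by (intro mult_left_mono) auto
      also have "\<dots> = (T * norm Y) * (v \<bullet> v)" by (simp add: dot_square_norm power2_eq_square)
      also have "\<dots> \<le> 1 / n * (v \<bullet> v)" by (rule mult_right_mono[OF TY]) simp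
      finally show "0 \<le> v \<bullet> (X *v v)" by (simp add: Xv inner_add_right)
    qed
    have trX: "trace X = 1"
      using n0 by (simp add: X_def trace_add trace_scaleR trace_mat_1 trY n_def[symmetric])
    have nX: "norm X \<le> n\<^sup>2" using psd_norm_le \<open>psd X\<close> trX by (simp add: n_def power2_eq_square)
    have "T / n + T\<^sup>2 * (trace A / n\<^sup>2) - K * T ^ 3 \<le> lambda_min (gramian_op A T X)"
    proof (rule lambda_min_ge[OF transpose_gramian_op[OF symX]])
      fix v :: "real^'n" assume v: "norm v = 1"
      have vv: "v \<bullet> v = 1" using v by (simp add: norm_eq_1)
      have "T * (v \<bullet> (X *v v)) + T\<^sup>2 * ((B *v v) \<bullet> (X *v v)) - C * norm X * T ^ 3 \<le> v \<bullet> (gramian_op A T X *v v)"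
        using C(2)[of T X v] T T1 symX v by (simp add: B_def abs_le_iff)
      moreover have "T * (v \<bullet> (X *v v)) + T\<^sup>2 * ((B *v v) \<bullet> (X *v v)) =
          T / n + T\<^sup>2 * (trace A / n\<^sup>2) + T ^ 3 * ((B *v v) \<bullet> (Y *v v))"
        using Bv[of v] vv n0
        by (simp add: Xv inner_add_right Yv power2_eq_square power3_eq_cube algebra_simps)
      moreover have "T ^ 3 * - ((B *v v) \<bullet> (Y *v v)) \<le> T ^ 3 * (norm Y * norm B)"
      proof (rule mult_left_mono)
        have "- ((B *v v) \<bullet> (Y *v v)) \<le> norm Y * (norm (B *v v) * norm v)"
          using matrix_form_le[of "B *v v" Y v] by linarith
        also have "\<dots> \<le> norm Y * (norm B * norm v * norm v)"
          by (intro mult_left_mono mult_right_mono norm_matrix_vector_le) auto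
        finally show "- ((B *v v) \<bullet> (Y *v v)) \<le> norm Y * norm B" using v by simp
      qed (use T in simp)
      moreover have "C * norm X * T ^ 3 \<le> C * n\<^sup>2 * T ^ 3"
        using C(1) nX T by (intro mult_mono) auto
      ultimately show "T / n + T\<^sup>2 * (trace A / n\<^sup>2) - K * T ^ 3 \<le> v \<bullet> (gramian_op A T X *v v)"
        by (simp add: K_def algebra_simps)
    qed
    also have "\<dots> \<le> gamma_rel A T" by (rule gamma_rel_attained(2)[OF \<open>psd X\<close> trX])
    finally show "T / real CARD('n) + T\<^sup>2 * (trace A / (real CARD('n))\<^sup>2) - K * T ^ 3 \<le> gamma_rel A T"
      by (simp add: n_def)
  qed
qed

lemma gamma_rel_first_order:
  fixes A :: "real^'n^'n"
  shows "((\<lambda>T. (real CARD('n) * gamma_rel A T / T - 1) / T) \<longlongrightarrow> trace A / real CARD('n)) (at_right 0)"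
proof -
  define n where "n = real CARD('n)"
  have n0: "n > 0" by (simp add: n_def)
  define s where "s = trace A / n"
  obtain K where K: "\<And>T. 0 < T \<Longrightarrow> T \<le> 1 \<Longrightarrow> 0 \<le> gamma_rel A T \<Longrightarrow>
     gamma_rel A T * (n - T * trace A) \<le> T + K * T ^ 3"
    using gamma_rel_upper[of A] unfolding n_def by blast
  obtain L T0 where L: "0 < T0" "\<And>T. 0 < T \<Longrightarrow> T \<le> T0 \<Longrightarrow>
     T / n + T\<^sup>2 * (trace A / n\<^sup>2) - L * T ^ 3 \<le> gamma_rel A T"
    using gamma_rel_lower[of A] unfolding n_def by blast
  have lim: "((\<lambda>T. f T) \<longlongrightarrow> f 0) (at_right 0)" if "isCont f 0" for f :: "real \<Rightarrow> real"
    using that by (simp add: isCont_def filterlim_at_split)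
  have ev: "\<forall>\<^sub>F T in at_right 0. 0 < T \<and> T \<le> T0 \<and> T \<le> 1"
    using L(1) by (auto simp: eventually_at_right_field intro!: exI[of _ "min 1 T0"])
  have ev1: "\<forall>\<^sub>F T in at_right 0. 0 < 1 - T * s"
    using lim[of "\<lambda>T. 1 - T * s"] by (intro order_tendstoD(1)[where y=1]) auto
  \<comment> \<open>The lower bound makes \<open>gamma_rel A T\<close> eventually nonnegative, as
    \<open>gamma_rel_upper\<close> requires.\<close>
  have ev2: "\<forall>\<^sub>F T in at_right 0. 0 < 1 / n + T * (trace A / n\<^sup>2) - L * T\<^sup>2"
    using lim[of "\<lambda>T. 1 / n + T * (trace A / n\<^sup>2) - L * T\<^sup>2"] n0
    by (intro order_tendstoD(1)[where y="1 / n"]) auto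
  have "((\<lambda>T. (n * gamma_rel A T / T - 1) / T) \<longlongrightarrow> s) (at_right 0)"
  proof (rule tendsto_sandwich)
    show "\<forall>\<^sub>F T in at_right 0. s - n * L * T \<le> (n * gamma_rel A T / T - 1) / T"
      using ev
    proof eventually_elim
      case (elim T)
      then have T: "0 < T" and "T / n + T\<^sup>2 * (trace A / n\<^sup>2) - L * T ^ 3 \<le> gamma_rel A T"
        using L(2) by auto
      then have "n * (T / n + T\<^sup>2 * (trace A / n\<^sup>2) - L * T ^ 3) \<le> n * gamma_rel A T"
        using n0 by (intro mult_left_mono) auto
      moreover have "n * (T / n + T\<^sup>2 * (trace A / n\<^sup>2) - L * T ^ 3) = T + T * T * (s - n * L * T)"
        using n0 by (simp add: s_def field_simps power2_eq_square power3_eq_cube)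
      ultimately show ?case
        using T by (simp add: field_simps)
    qed
    show "\<forall>\<^sub>F T in at_right 0. (n * gamma_rel A T / T - 1) / T \<le> (K * T + s) / (1 - T * s)"
      using ev ev1 ev2
    proof eventually_elim
      case (elim T)
      then have T: "0 < T" "T \<le> 1" by auto
      have "0 \<le> T * (1 / n + T * (trace A / n\<^sup>2) - L * T\<^sup>2)" using elim T by (intro mult_nonneg_nonneg) auto
      also have "\<dots> \<le> gamma_rel A T"
        using L(2)[of T] elim by (simp add: algebra_simps power2_eq_square power3_eq_cube)
      finally have "gamma_rel A T * (n - T * trace A) \<le> T + K * T ^ 3" using K T by blast
      moreover have "n - T * trace A = n * (1 - T * s)" using n0 by (simp add: s_def field_simps)
      ultimately have *: "n * gamma_rel A T * (1 - T * s) \<le> T * (1 + K * T\<^sup>2)"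
        by (simp add: power2_eq_square power3_eq_cube algebra_simps)
      have "n * gamma_rel A T / T * (1 - T * s) \<le> 1 + K * T\<^sup>2"
        using * T by (simp add: field_simps)
      then have "(n * gamma_rel A T / T - 1) * (1 - T * s) \<le> T * (K * T + s)"
        by (simp add: algebra_simps power2_eq_square)
      then show ?case using elim T by (simp add: pos_le_divide_eq pos_divide_le_eq mult_ac)
    qed
    show "((\<lambda>T. s - n * L * T) \<longlongrightarrow> s) (at_right 0)"
      using lim[of "\<lambda>T. s - n * L * T"] by simp
    show "((\<lambda>T. (K * T + s) / (1 - T * s)) \<longlongrightarrow> s) (at_right 0)"
      using lim[of "\<lambda>T. (K * T + s) / (1 - T * s)"] by simp
  qed
  then show ?thesis by (simp add: n_def s_def)
qed

section \<open>Dual vectors of Krylov sequences\<close>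

definition dual_pair :: "real^'n^'n \<Rightarrow> real^'n \<Rightarrow> real^'n \<Rightarrow> bool" where
  "dual_pair A b u \<longleftrightarrow>
     (\<forall>k<CARD('n). u \<bullet> (mat_power A k *v b) = (if k = CARD('n) - 1 then 1 else 0))"

lemma inner_mat_power_transpose:
  fixes A :: "real^'n^'n"
  shows "u \<bullet> (mat_power A k *v b) = (mat_power (transpose A) k *v u) \<bullet> b"
  by (simp add: inner_transpose transpose_mat_power)

lemma inner_mat_power_shift:
  fixes A :: "real^'n^'n"
  shows "(mat_power (transpose A) j *v u) \<bullet> (mat_power A k *v b) = u \<bullet> (mat_power A (j + k) *v b)"
  by (simp add: inner_mat_power_transpose[symmetric] mat_power_add matrix_vector_mul_assoc)

text \<open>The pairing of \<open>B^i u\<close> with \<open>A^k b\<close> depends only on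
  \<open>i + k\<close>, so it is an anti-triangular matrix with ones on the antidiagonal. The
  coefficients therefore vanish one by one from \<open>k = n - 1\<close> downwards, and the
  induction variable \<open>i\<close> is the distance from the top.\<close>

lemma dual_pair_coefficients_zero:
  fixes A :: "real^'n^'n"
  assumes "dual_pair A b u" "(\<Sum>k<CARD('n). c k *\<^sub>R (mat_power A k *v b)) = 0" "k < CARD('n)"
  shows "c k = 0"
proof -
  let ?n = "CARD('n)"
  have "c (?n - 1 - i) = 0" if "i < ?n" for i
    using that
  proof (induction i rule: less_induct)
    case (less i)
    have "0 = (mat_power (transpose A) i *v u) \<bullet> (\<Sum>k<?n. c k *\<^sub>R (mat_power A k *v b))"
      using assms(2) by simp
    also have "\<dots> = (\<Sum>k<?n. c k * (u \<bullet> (mat_power A (i + k) *v b)))"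
      by (simp add: inner_sum_right inner_mat_power_shift)
    also have "\<dots> = (\<Sum>k<?n. if k = ?n - 1 - i then c k else 0)"
    proof (rule sum.cong[OF refl])
      fix k assume k: "k \<in> {..<?n}"
      consider "k < ?n - 1 - i" | "k = ?n - 1 - i" | "?n - 1 - i < k" by linarith
      then show "c k * (u \<bullet> (mat_power A (i + k) *v b)) = (if k = ?n - 1 - i then c k else 0)"
      proof cases
        case 3
        then have "?n - 1 - k < i" and "?n - 1 - (?n - 1 - k) = k" using k less.prems by auto
        with less.IH[of "?n - 1 - k"] less.prems have "c k = 0" by auto
        with 3 show ?thesis by simp
      qed (use assms(1) less.prems in \<open>auto simp: dual_pair_def\<close>)
    qed
    also have "\<dots> = c (?n - 1 - i)" by (simp add: sum.delta)
    finally show ?case by simp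
  qed
  from this[of "?n - 1 - k"] assms(3) show ?thesis by simp
qed

lemma dual_pair_basis:
  fixes A :: "real^'n^'n"
  assumes "dual_pair A b u"
  shows "inj_on (\<lambda>k. mat_power A k *v b) {..<CARD('n)}"
    and "independent ((\<lambda>k. mat_power A k *v b) ` {..<CARD('n)})"
    and "span ((\<lambda>k. mat_power A k *v b) ` {..<CARD('n)}) = UNIV"
proof -
  let ?x = "\<lambda>k. mat_power A k *v b" and ?n = "CARD('n)"
  show inj: "inj_on ?x {..<?n}"
  proof (rule inj_onI, rule ccontr)
    fix i j assume ij: "i \<in> {..<?n}" "j \<in> {..<?n}" "?x i = ?x j" "i \<noteq> j"
    let ?c = "\<lambda>k. if k = i then 1 else if k = j then - 1 else 0 :: real"
    have "(\<Sum>k<?n. ?c k *\<^sub>R ?x k) = (\<Sum>k<?n. (if k = i then ?x k else 0) - (if k = j then ?x k else 0))"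
      using ij(4) by (intro sum.cong) auto
    also have "\<dots> = 0" using ij by (simp add: sum_subtractf sum.delta)
    finally show False using dual_pair_coefficients_zero[OF assms, of ?c i] ij by simp
  qed
  show ind: "independent (?x ` {..<?n})"
  proof (rule independent_if_scalars_zero)
    fix f v assume *: "(\<Sum>v\<in>?x ` {..<?n}. f v *\<^sub>R v) = 0" and v: "v \<in> ?x ` {..<?n}"
    have "(\<Sum>k<?n. f (?x k) *\<^sub>R ?x k) = 0" using * by (simp add: sum.reindex[OF inj])
    from dual_pair_coefficients_zero[OF assms this] v show "f v = 0" by auto
  qed simp
  have "UNIV \<subseteq> span (?x ` {..<?n})"
    by (rule card_ge_dim_independent[OF _ ind]) (auto simp: card_image[OF inj] dim_UNIV)
  then show "span (?x ` {..<?n}) = UNIV" by blast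
qed

lemma dual_pair_cyclic: "dual_pair A b u \<Longrightarrow> cyclic_vector A b"
  by (simp add: cyclic_vector_def dual_pair_basis)

lemma dual_pair_unique:
  fixes A :: "real^'n^'n"
  assumes "dual_pair A b u" "dual_pair A b v"
  shows "u = v"
proof -
  have "(u - v) \<bullet> x = 0" if "x \<in> span ((\<lambda>k. mat_power A k *v b) ` {..<CARD('n)})" for x
    using that by (induction rule: span_induct_alt)
      (use assms in \<open>auto simp: dual_pair_def inner_diff_left inner_add_right\<close>)
  then have "(u - v) \<bullet> (u - v) = 0" using dual_pair_basis(3)[OF assms(1)] by blast
  then show ?thesis by simp
qed

lemma krylov_insert:
  fixes A :: "real^'n^'n"
  shows "(\<lambda>k. mat_power A k *v b) ` {..<CARD('n)} =
    insert (mat_power A (CARD('n) - 1) *v b) ((\<lambda>k. mat_power A k *v b) ` {..<CARD('n) - 1})"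
proof -
  have "{..<CARD('n)} = insert (CARD('n) - 1) {..<CARD('n) - 1}"
    by (metis Suc_pred' lessThan_Suc zero_less_card_finite)
  then show ?thesis by (metis image_insert)
qed

text \<open>Up to normalisation the dual vector is the component of \<open>A^(n-1) b\<close>
  orthogonal to the earlier Krylov vectors; it is nonzero because fewer than \<open>n\<close>
  vectors cannot span.\<close>

lemma cyclic_vector_dual:
  fixes A :: "real^'n^'n"
  assumes "cyclic_vector A b"
  obtains u where "dual_pair A b u"
proof -
  let ?x = "\<lambda>k. mat_power A k *v b" and ?n = "CARD('n)"
  let ?S = "?x ` {..<?n - 1}" and ?w = "?x (?n - 1)"
  have sp: "span (insert ?w ?S) = UNIV" using assms unfolding cyclic_vector_def krylov_insert .
  have "?w \<notin> span ?S"
  proof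
    assume "?w \<in> span ?S"
    then have "span ?S = UNIV" using sp by (metis span_redundant)
    then have "dim (UNIV :: (real^'n) set) = dim ?S" by (metis dim_span)
    also have "\<dots> \<le> card ?S" by (rule dim_le_card') simp
    also have "\<dots> \<le> ?n - 1" using card_image_le[of "{..<?n - 1}" ?x] by simp
    finally show False by (simp add: dim_UNIV) (metis diff_Suc_less less_le_not_le zero_less_card_finite One_nat_def)
  qed
  obtain y z where yz: "y \<in> span ?S" "\<And>w. w \<in> span ?S \<Longrightarrow> orthogonal z w" "?w = y + z"
    using orthogonal_subspace_decomp_exists[of ?S ?w] by metis
  have "z \<noteq> 0" using yz \<open>?w \<notin> span ?S\<close> by auto
  have zw: "z \<bullet> ?w = z \<bullet> z" using yz by (simp add: inner_add_right orthogonal_def)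
  have "dual_pair A b (z /\<^sub>R (z \<bullet> z))"
    unfolding dual_pair_def
  proof (intro allI impI)
    fix k assume k: "k < ?n"
    show "(z /\<^sub>R (z \<bullet> z)) \<bullet> ?x k = (if k = ?n - 1 then 1 else 0)"
    proof (cases "k = ?n - 1")
      case False
      then have "?x k \<in> span ?S" using k by (intro span_base) auto
      then show ?thesis using yz(2) False by (simp add: orthogonal_def)
    qed (use zw \<open>z \<noteq> 0\<close> in simp)
  qed
  then show thesis by (rule that)
qed

lemma dual_pair_nonzero:
  fixes A :: "real^'n^'n"
  shows "dual_pair A b u \<Longrightarrow> u \<noteq> 0"
  unfolding dual_pair_def by (auto dest: spec[of _ "CARD('n) - 1"])

text \<open>\<open>u\<close> is normal to the span of the earlier Krylov vectors and takes the value
  1 at the last one.\<close>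

lemma dual_pair_d_n:
  fixes A :: "real^'n^'n"
  assumes "dual_pair A b u"
  shows "d_n A b = 1 / norm u"
proof -
  let ?x = "\<lambda>k. mat_power A k *v b" and ?n = "CARD('n)"
  let ?S = "?x ` {..<?n - 1}" and ?w = "?x (?n - 1)"
  have u: "norm u > 0" using dual_pair_nonzero[OF assms] by simp
  have uw: "u \<bullet> ?w = 1" using assms by (simp add: dual_pair_def)
  have uS: "u \<bullet> s = 0" if "s \<in> span ?S" for s
    using that by (induction rule: span_induct_alt) (use assms in \<open>auto simp: dual_pair_def inner_add_right\<close>)
  \<comment> \<open>\<open>s\<close> is the foot of the perpendicular. To place it in the span, it
    is expanded in the whole Krylov basis; since \<open>u\<close> annihilates \<open>s\<close>, the
    coefficient of \<open>?w\<close> is zero.\<close>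
  define s where "s = ?w - u /\<^sub>R (u \<bullet> u)"
  have "s \<in> span ?S"
  proof -
    have "s \<in> span (insert ?w ?S)" using dual_pair_basis(3)[OF assms] by (simp add: krylov_insert)
    then obtain k where k: "s - k *\<^sub>R ?w \<in> span ?S" by (auto simp: span_insert)
    have "u \<bullet> s = 0" using uw u by (simp add: s_def inner_diff_right)
    then have "k = 0" using uS[OF k] uw by (simp add: inner_diff_right)
    then show ?thesis using k by simp
  qed
  have "dist ?w s = 1 / norm u"
    using u by (simp add: dist_norm s_def dot_square_norm power2_eq_square divide_inverse)
  then have "infdist ?w (span ?S) \<le> 1 / norm u" using infdist_le[OF \<open>s \<in> span ?S\<close>, of ?w] by simp
  moreover have nonempty: "span ?S \<noteq> {}" using span_zero[of ?S] by blast
  moreover have "1 / norm u \<le> infdist ?w (span ?S)"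
    unfolding infdist_notempty[OF nonempty]
  proof (rule cINF_greatest)
    fix y assume "y \<in> span ?S"
    then have "1 = u \<bullet> (?w - y)" using uw uS by (simp add: inner_diff_right)
    also have "\<dots> \<le> norm u * dist ?w y" unfolding dist_norm by (rule norm_cauchy_schwarz)
    finally show "1 / norm u \<le> dist ?w y" using u by (simp add: field_simps)
  qed (rule nonempty)
  ultimately show ?thesis using dual_pair_cyclic[OF assms] by (simp add: d_n_def)
qed

section \<open>The QR factorization of the Krylov matrix\<close>

text \<open>The last clause is there for the induction: it puts the projection \<open>s\<close> of
  \<open>x m\<close> into the span of the earlier vectors, so \<open>z\<close> is nonzero and the
  new diagonal entry \<open>norm z\<close> is positive.\<close>

lemma gram_schmidt_QR:
  fixes x :: "nat \<Rightarrow> 'a::euclidean_space"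
  assumes "\<forall>k<m. x k \<notin> span (x ` {..<k})"
  shows "\<exists>q r. (\<forall>i<m. \<forall>j<m. q i \<bullet> q j = (if i = j then 1 else 0)) \<and>
     (\<forall>j<m. \<forall>k<m. k < j \<longrightarrow> r j k = 0) \<and> (\<forall>j<m. 0 < r j j) \<and>
     (\<forall>k<m. x k = (\<Sum>j<m. r j k *\<^sub>R q j)) \<and> (\<forall>j<m. q j \<in> span (x ` {..<m}))"
  using assms
proof (induction m)
  case (Suc m)
  have prems: "\<forall>k<m. x k \<notin> span (x ` {..<k})" using Suc.prems by simp
  from Suc.IH[OF prems] obtain q r where
    "\<forall>i<m. \<forall>j<m. q i \<bullet> q j = (if i = j then 1 else 0)" and
    "\<forall>j<m. \<forall>k<m. k < j \<longrightarrow> r j k = (0::real)" and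
    "\<forall>j<m. 0 < r j j" and
    "\<forall>k<m. x k = (\<Sum>j<m. r j k *\<^sub>R q j)" and
    "\<forall>j<m. q j \<in> span (x ` {..<m})"
    by (elim exE conjE) (rule that)
  then have orth: "\<And>i j. i < m \<Longrightarrow> j < m \<Longrightarrow> q i \<bullet> q j = (if i = j then 1 else 0)" and
    tri: "\<And>j k. j < m \<Longrightarrow> k < m \<Longrightarrow> k < j \<Longrightarrow> r j k = 0" and
    diag: "\<And>j. j < m \<Longrightarrow> 0 < r j j" and
    dec: "\<And>k. k < m \<Longrightarrow> x k = (\<Sum>j<m. r j k *\<^sub>R q j)" and
    sp: "\<And>j. j < m \<Longrightarrow> q j \<in> span (x ` {..<m})"
    by blast+
  define s where "s = (\<Sum>j<m. (q j \<bullet> x m) *\<^sub>R q j)"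
  define z where "z = x m - s"
  have s: "s \<in> span (x ` {..<m})" unfolding s_def by (intro span_sum span_scale sp) simp
  then have "z \<noteq> 0" using Suc.prems by (auto simp: z_def)
  have qs: "q i \<bullet> s = q i \<bullet> x m" if "i < m" for i
  proof -
    have "q i \<bullet> s = (\<Sum>j<m. if j = i then q j \<bullet> x m else 0)"
      unfolding s_def inner_sum_right by (rule sum.cong) (use that orth in auto)
    then show ?thesis using that by (simp add: sum.delta)
  qed
  define q' where "q' = q(m := z /\<^sub>R norm z)"
  define r' where "r' j k = (if k = m then (if j = m then norm z else q j \<bullet> x m)
     else if j = m then 0 else r j k)" for j k
  have zq: "q i \<bullet> z = 0" if "i < m" for i using qs[OF that] by (simp add: z_def inner_diff_right)
  have nz: "norm z > 0" using \<open>z \<noteq> 0\<close> by simp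
  have zz: "inverse (norm z) * (inverse (norm z) * (z \<bullet> z)) = 1"
    using nz by (simp add: dot_square_norm power2_eq_square field_simps)
  have sub: "span (x ` {..<m}) \<subseteq> span (x ` {..<Suc m})" by (rule span_mono) auto
  have zsp: "z \<in> span (x ` {..<Suc m})"
    unfolding z_def using s sub by (intro span_diff[OF span_base]) auto
  show ?case
  proof (intro exI[of _ q'] exI[of _ r'] conjI allI impI)
    fix i j assume "i < Suc m" "j < Suc m"
    then show "q' i \<bullet> q' j = (if i = j then 1 else 0)"
      using orth zq nz zz by (auto simp: q'_def less_Suc_eq inner_commute[of z "q _"])
  next
    fix j k assume "j < Suc m" "k < Suc m" "k < j"
    then show "r' j k = 0" using tri by (auto simp: r'_def less_Suc_eq)
  next
    fix j assume "j < Suc m"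
    then show "0 < r' j j" using diag nz by (auto simp: r'_def less_Suc_eq)
  next
    fix k assume k: "k < Suc m"
    show "x k = (\<Sum>j<Suc m. r' j k *\<^sub>R q' j)"
    proof (cases "k = m")
      case True
      then show ?thesis using nz by (simp add: r'_def q'_def s_def[symmetric] z_def)
    next
      case False
      then have "(\<Sum>j<m. r' j k *\<^sub>R q' j) = (\<Sum>j<m. r j k *\<^sub>R q j)"
        by (intro sum.cong) (auto simp: r'_def q'_def)
      then show ?thesis using False k dec[of k] by (simp add: r'_def)
    qed
  next
    fix j assume "j < Suc m"
    then show "q' j \<in> span (x ` {..<Suc m})"
      using sp zsp sub
      by (auto simp: q'_def less_Suc_eq intro!: span_scale)
  qed
qed simp

text \<open>In every factorization, triangularity makes the last column of \<open>Q\<close>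
  orthogonal to all Krylov vectors except the last; divided by the last diagonal entry it is dual to
  \<open>b\<close>. Uniqueness of dual vectors and Gram-Schmidt together justify the
  \<open>THE\<close>.\<close>

lemma dual_pair_q_n:
  fixes A :: "real^'n^'n"
  assumes "dual_pair A b u"
  shows "q_n A b = u /\<^sub>R norm u"
proof -
  let ?x = "\<lambda>k. mat_power A k *v b" and ?n = "CARD('n)"
  have n: "?n - 1 < ?n" by simp
  have notin: "\<forall>k<?n. ?x k \<notin> span (?x ` {..<k})"
  proof (intro allI impI)
    fix k assume that: "k < ?n"
    have "?x k \<notin> span (?x ` {..<?n} - {?x k})"
      using dual_pair_basis(2)[OF assms] that by (auto simp: dependent_def)
    moreover have "?x ` {..<k} \<subseteq> ?x ` {..<?n} - {?x k}"
      using dual_pair_basis(1)[OF assms] that by (fastforce simp: inj_on_def)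
    ultimately show "?x k \<notin> span (?x ` {..<k})" using span_mono by blast
  qed
  have "\<exists>q r. krylov_QR A b q r"
  proof -
    have "\<exists>q r. krylov_QR A b q r \<and> (\<forall>j<?n. q j \<in> span (?x ` {..<?n}))"
      using gram_schmidt_QR[OF notin] unfolding krylov_QR_def conj_assoc .
    then show ?thesis by blast
  qed
  then obtain q0 r0 where q0: "krylov_QR A b q0 r0" by blast
  have uniq: "q (?n - 1) = u /\<^sub>R norm u" if "krylov_QR A b q r" for q r
  proof -
    note qr = that[unfolded krylov_QR_def]
    let ?v = "q (?n - 1)"
    have inner: "?v \<bullet> ?x k = r (?n - 1) k" if "k < ?n" for k
    proof -
      have "?v \<bullet> ?x k = (\<Sum>j<?n. r j k * (?v \<bullet> q j))" using qr that by (simp add: inner_sum_right)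
      also have "\<dots> = (\<Sum>j<?n. if j = ?n - 1 then r j k else 0)"
        by (rule sum.cong) (use qr n in \<open>auto\<close>)
      finally show ?thesis by (simp add: sum.delta)
    qed
    let ?r = "r (?n - 1) (?n - 1)"
    have r: "?r > 0" using qr n by blast
    have "dual_pair A b (?v /\<^sub>R ?r)"
      unfolding dual_pair_def
    proof (intro allI impI)
      fix k assume k: "k < ?n"
      show "(?v /\<^sub>R ?r) \<bullet> ?x k = (if k = ?n - 1 then 1 else 0)"
      proof (cases "k = ?n - 1")
        case False
        then have "r (?n - 1) k = 0" using k n qr by (metis Suc_pred' less_SucE zero_less_card_finite)
        then show ?thesis using inner[OF k] False by simp
      qed (use inner[OF n] r in simp)
    qed
    then have u: "u = ?v /\<^sub>R ?r" using dual_pair_unique[OF assms] by blast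
    have "norm ?v = 1" using qr n by (simp add: norm_eq_1)
    then show ?thesis using r by (simp add: u)
  qed
  show ?thesis unfolding q_n_def
  proof (rule the_equality)
    show "\<exists>q r. krylov_QR A b q r \<and> u /\<^sub>R norm u = q (?n - 1)"
      using q0 uniq[OF q0] by (intro exI[of _ q0] exI[of _ r0]) simp
  qed (use uniq in blast)
qed

section \<open>Optimal dual pairs\<close>

text \<open>Duality is a finite system of closed conditions, but the bound on \<open>norm u\<close>
  is essential: along cyclic vectors that tend to a non-cyclic one the dual vectors diverge.\<close>

lemma compact_dual_pairs:
  fixes A :: "real^'n^'n"
  shows "compact {(b, u). norm b = 1 \<and> dual_pair A b u \<and> norm u \<le> B}" (is "compact ?P")
proof -
  have "?P = (sphere 0 1 \<times> cball 0 B) \<inter>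
     (\<Inter>k\<in>{..<CARD('n)}. {p. snd p \<bullet> (mat_power A k *v fst p) = (if k = CARD('n) - 1 then 1 else 0)})"
    by (auto simp: dual_pair_def)
  moreover have "closed (\<Inter>k\<in>{..<CARD('n)}.
      {p :: (real^'n) \<times> (real^'n). snd p \<bullet> (mat_power A k *v fst p) = (if k = CARD('n) - 1 then 1 else 0)})"
    by (intro closed_INT ballI closed_Collect_eq continuous_intros
        bounded_linear.continuous_on[OF matrix_vector_mul_bounded_linear])
  ultimately show ?thesis by (simp add: compact_Int_closed compact_Times)
qed

lemma dual_pair_scale:
  "dual_pair A b u \<Longrightarrow> c \<noteq> 0 \<Longrightarrow> dual_pair A (c *\<^sub>R b) (u /\<^sub>R c)"
  by (auto simp: dual_pair_def matrix_vector_mult_scaleR)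

text \<open>A two-stage optimisation: \<open>delta_n A\<close> is the reciprocal of the least norm
  of a dual vector, and \<open>alpha_n A\<close> is the largest Rayleigh quotient of
  \<open>A\<close> among the dual vectors of that norm. One pair realises both.\<close>

lemma optimal_dual_pair:
  fixes A :: "real^'n^'n"
  assumes "cyclic_matrix A"
  obtains b u where "norm b = 1" "dual_pair A b u" "delta_n A * norm u = 1"
    "u \<bullet> (A *v u) = alpha_n A * (u \<bullet> u)"
    "\<And>b' u'. norm b' = 1 \<Longrightarrow> dual_pair A b' u' \<Longrightarrow> norm u \<le> norm u'"
    "\<And>b' u'. norm b' = 1 \<Longrightarrow> dual_pair A b' u' \<Longrightarrow> norm u' = norm u \<Longrightarrow>
       u' \<bullet> (A *v u') \<le> alpha_n A * (u \<bullet> u)"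
proof -
  obtain c where c: "cyclic_vector A c" using assms by (auto simp: cyclic_matrix_def)
  then obtain w where w: "dual_pair A c w" by (rule cyclic_vector_dual)
  have "c \<noteq> 0"
  proof
    assume "c = 0"
    then have "w \<bullet> (mat_power A (CARD('n) - 1) *v c) = 0" by simp
    then show False using w by (simp add: dual_pair_def)
  qed
  define b0 where "b0 = (1 / norm c) *\<^sub>R c"
  define u0 where "u0 = w /\<^sub>R (1 / norm c)"
  have b0: "norm b0 = 1" using \<open>c \<noteq> 0\<close> by (simp add: b0_def)
  have u0: "dual_pair A b0 u0" using dual_pair_scale[OF w, of "1 / norm c"] \<open>c \<noteq> 0\<close>
    by (simp add: b0_def u0_def)
  \<comment> \<open>Cutting off at the norm of one admissible dual vector leaves the minimum
    unchanged and makes the set compact.\<close>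
  let ?P = "{(b, u). norm b = 1 \<and> dual_pair A b u \<and> norm u \<le> norm u0}"
  have "continuous_on ?P (\<lambda>p. norm (snd p))" by (intro continuous_intros)
  then have "\<exists>p\<in>?P. \<forall>p'\<in>?P. norm (snd p) \<le> norm (snd p')"
    using continuous_attains_inf[OF compact_dual_pairs] b0 u0 by blast
  then obtain b2 u2 where 2: "norm b2 = 1" "dual_pair A b2 u2" "norm u2 \<le> norm u0"
    and min': "\<And>b u. norm b = 1 \<Longrightarrow> dual_pair A b u \<Longrightarrow> norm u \<le> norm u0 \<Longrightarrow> norm u2 \<le> norm u"
    by auto
  have min: "norm u2 \<le> norm u" if "norm b = 1" "dual_pair A b u" for b u
    using min'[OF that] 2(3) by linarith
  have u2: "norm u2 > 0" using dual_pair_nonzero[OF 2(2)] by simp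
  have delta: "delta_n A = 1 / norm u2"
    unfolding delta_n_def
  proof (rule Greatest_equality)
    show "1 / norm u2 \<in> d_n A ` {b. norm b = 1}" using dual_pair_d_n[OF 2(2)] 2(1) by force
    fix y assume "y \<in> d_n A ` {b. norm b = 1}"
    then obtain b where b: "norm b = 1" "y = d_n A b" by auto
    show "y \<le> 1 / norm u2"
    proof (cases "cyclic_vector A b")
      case True
      then obtain u where u: "dual_pair A b u" by (rule cyclic_vector_dual)
      have "1 / norm u \<le> 1 / norm u2" using min[OF b(1) u] u2 by (simp add: frac_le)
      then show ?thesis using dual_pair_d_n[OF u] b by simp
    qed (use u2 b in \<open>simp add: d_n_def\<close>)
  qed
  \<comment> \<open>By minimality of \<open>norm u2\<close>, the inequality selects exactly the
    pairs of least norm.\<close>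
  let ?M = "{(b, u). norm b = 1 \<and> dual_pair A b u \<and> norm u \<le> norm u2}"
  have "continuous_on ?M (\<lambda>p. snd p \<bullet> (A *v snd p))"
    by (intro continuous_intros bounded_linear.continuous_on[OF matrix_vector_mul_bounded_linear])
  then have "\<exists>p\<in>?M. \<forall>p'\<in>?M. snd p' \<bullet> (A *v snd p') \<le> snd p \<bullet> (A *v snd p)"
    using continuous_attains_sup[OF compact_dual_pairs] 2 by blast
  then obtain b u where bu: "norm b = 1" "dual_pair A b u" "norm u \<le> norm u2"
    and max: "\<And>b' u'. norm b' = 1 \<Longrightarrow> dual_pair A b' u' \<Longrightarrow> norm u' \<le> norm u2 \<Longrightarrow>
        u' \<bullet> (A *v u') \<le> u \<bullet> (A *v u)"
    by auto
  have nu: "norm u = norm u2" using min[OF bu(1,2)] bu(3) by simp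
  have q: "q_n A b' \<bullet> (A *v q_n A b') = u' \<bullet> (A *v u') / (norm u')\<^sup>2" if "dual_pair A b' u'" for b' u'
    by (simp add: dual_pair_q_n[OF that] matrix_vector_mult_scaleR divide_inverse power2_eq_square)
  have alpha: "alpha_n A = u \<bullet> (A *v u) / (norm u2)\<^sup>2"
    unfolding alpha_n_def
  proof (rule Greatest_equality)
    have "b \<in> maximizers A" using bu nu dual_pair_d_n[OF bu(2)] by (simp add: maximizers_def delta)
    then show "u \<bullet> (A *v u) / (norm u2)\<^sup>2 \<in> (\<lambda>b. q_n A b \<bullet> (A *v q_n A b)) ` maximizers A"
      using q[OF bu(2)] nu by force
    fix y assume "y \<in> (\<lambda>b. q_n A b \<bullet> (A *v q_n A b)) ` maximizers A"
    then obtain b' where b': "norm b' = 1" "d_n A b' = 1 / norm u2" "y = q_n A b' \<bullet> (A *v q_n A b')"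
      by (auto simp: maximizers_def delta)
    have "cyclic_vector A b'" using b' u2 by (auto simp: d_n_def split: if_splits)
    then obtain u' where u': "dual_pair A b' u'" by (rule cyclic_vector_dual)
    have "norm u' = norm u2" using dual_pair_d_n[OF u'] b' u2 dual_pair_nonzero[OF u'] by (simp add: field_simps)
    then show "y \<le> u \<bullet> (A *v u) / (norm u2)\<^sup>2"
      using max[OF b'(1) u'] b' q[OF u'] by (simp add: divide_right_mono)
  qed
  show thesis
  proof (rule that[OF bu(1,2)])
    show "delta_n A * norm u = 1" using delta nu u2 by simp
    show a: "u \<bullet> (A *v u) = alpha_n A * (u \<bullet> u)" using alpha nu u2 by (simp add: dot_square_norm)
    show "norm u \<le> norm u'" if "norm b' = 1" "dual_pair A b' u'" for b' u' using min that nu by simp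
    show "u' \<bullet> (A *v u') \<le> alpha_n A * (u \<bullet> u)"
      if "norm b' = 1" "dual_pair A b' u'" "norm u' = norm u" for b' u'
      using max[OF that(1,2)] that(3) nu a by simp
  qed
qed

section \<open>The extremal polynomial on the unit interval\<close>

definition unit_integral :: "real poly \<Rightarrow> real" where
  "unit_integral p = integral {0..1} (poly p)"

lemma poly_integrable [simp]: "poly (p :: real poly) integrable_on {a..b}"
  by (intro integrable_continuous_real continuous_intros)

lemma unit_integral_add: "unit_integral (p + q) = unit_integral p + unit_integral q"
proof -
  have "poly (p + q) = (\<lambda>x. poly p x + poly q x)" by auto
  then show ?thesis by (simp add: unit_integral_def integral_add)
qed

lemma unit_integral_smult: "unit_integral (smult c p) = c * unit_integral p"
proof -
  have "poly (smult c p) = (\<lambda>x. c * poly p x)" by auto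
  then show ?thesis by (simp add: unit_integral_def)
qed

lemma unit_integral_pderiv: "unit_integral (pderiv p) = poly p 1 - poly p 0"
  unfolding unit_integral_def
  by (intro integral_unique fundamental_theorem_of_calculus)
     (auto simp: has_real_derivative_iff_has_vector_derivative[symmetric]
       intro: has_field_derivative_at_within)

lemma unit_integral_by_parts:
  assumes "poly (q * p) 0 = 0" "poly (q * p) 1 = 0"
  shows "unit_integral (pderiv q * p) = - unit_integral (q * pderiv p)"
proof -
  have "unit_integral (pderiv (q * p)) = 0" using assms by (simp add: unit_integral_pderiv del: poly_mult)
  then show ?thesis by (simp add: pderiv_mult unit_integral_add mult.commute)
qed

text \<open>Euler's beta integral, with a sign because the factor is \<open>x - 1\<close>. Each
  integration by parts lowers \<open>b\<close> and raises \<open>a\<close>, hence the generalisation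
  over \<open>a\<close>.\<close>

lemma unit_integral_beta:
  "unit_integral (monom 1 a * [:- 1, 1:] ^ b) = (- 1) ^ b * (fact a * fact b / fact (a + b + 1))"
proof (induction b arbitrary: a)
  case 0
  have "pderiv (monom (1 / real (Suc a)) (Suc a)) = monom 1 a" by (simp add: pderiv_monom)
  then show ?case
    using unit_integral_pderiv[of "monom (1 / real (Suc a)) (Suc a)"] by (simp add: poly_monom)
next
  case (Suc b)
  let ?w = "[:- 1, 1:] :: real poly" and ?x = "monom (1 / real (Suc a)) (Suc a)"
  have "pderiv ?x = monom 1 a" by (simp add: pderiv_monom)
  then have "unit_integral (monom 1 a * ?w ^ Suc b) = - unit_integral (?x * pderiv (?w ^ Suc b))"
    using unit_integral_by_parts[of ?x "?w ^ Suc b"] by (simp add: poly_monom)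
  also have "pderiv (?w ^ Suc b) = smult (real (Suc b)) (?w ^ b)"
    by (simp only: pderiv_power_Suc) (simp add: pderiv_pCons)
  also have "?x * smult (real (Suc b)) (?w ^ b) = smult (real (Suc b) / real (Suc a)) (monom 1 (Suc a) * ?w ^ b)"
  proof -
    have "?x = smult (1 / real (Suc a)) (monom 1 (Suc a))" by (simp add: smult_monom)
    then show ?thesis by (simp add: field_simps)
  qed
  also have "unit_integral \<dots> = real (Suc b) / real (Suc a) * ((- 1) ^ b * (fact (Suc a) * fact b / fact (a + b + 2)))"
    using Suc[of "Suc a"] by (simp add: unit_integral_smult)
  also have "- \<dots> = (- 1) ^ Suc b * (fact a * fact (Suc b) / fact (a + Suc b + 1))"
  proof -
    have "fact (Suc a) = real (Suc a) * fact a" "fact (Suc b) = real (Suc b) * fact b" by simp_all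
    then show ?thesis by (simp del: of_nat_Suc fact_Suc)
  qed
  finally show ?case .
qed

lemma linear_power_dvd_pderiv:
  fixes p :: "real poly"
  assumes "[:a, 1:] ^ Suc k dvd p"
  shows "[:a, 1:] ^ k dvd pderiv p"
proof -
  obtain r where p: "p = [:a, 1:] ^ Suc k * r" using assms by auto
  have "pderiv p = [:a, 1:] ^ k * ([:a, 1:] * pderiv r + r * (smult (real (Suc k)) (pderiv [:a, 1:])))"
    unfolding p pderiv_mult pderiv_power_Suc by (simp add: algebra_simps)
  then show ?thesis by simp
qed

lemma linear_power_dvd_higher_pderiv:
  fixes p :: "real poly"
  assumes "[:a, 1:] ^ m dvd p" "j \<le> m"
  shows "[:a, 1:] ^ (m - j) dvd (pderiv ^^ j) p"
  using assms(2)
proof (induction j)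
  case (Suc j)
  then have "[:a, 1:] ^ Suc (m - Suc j) dvd (pderiv ^^ j) p" by (simp add: Suc_diff_Suc)
  then show ?case by (simp add: linear_power_dvd_pderiv)
qed (use assms(1) in simp)

text \<open>A differentiation lowers the multiplicity of a root by at most one.\<close>

lemma higher_pderiv_root:
  fixes p :: "real poly"
  assumes "[:a, 1:] ^ m dvd p" "j < m"
  shows "poly ((pderiv ^^ j) p) (- a) = 0"
proof -
  have "[:a, 1:] dvd [:a, 1:] ^ (m - j)" using assms(2) by (simp add: dvd_power)
  then have "[:a, 1:] dvd (pderiv ^^ j) p"
    using linear_power_dvd_higher_pderiv[of a m p j] assms dvd_trans by auto
  then show ?thesis by (auto simp: dvd_def)
qed

lemma unit_integral_higher_parts:
  fixes q p :: "real poly"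
  assumes roots: "\<And>j. j < m \<Longrightarrow> poly ((pderiv ^^ j) q) 0 = 0 \<and> poly ((pderiv ^^ j) q) 1 = 0"
  shows "unit_integral ((pderiv ^^ m) q * p) = (- 1) ^ m * unit_integral (q * (pderiv ^^ m) p)"
  using assms
proof (induction m arbitrary: p)
  case (Suc m)
  have "unit_integral ((pderiv ^^ Suc m) q * p) = - unit_integral ((pderiv ^^ m) q * pderiv p)"
    using unit_integral_by_parts[of "(pderiv ^^ m) q" p] Suc.prems[of m] by simp
  also have "unit_integral ((pderiv ^^ m) q * pderiv p) = (- 1) ^ m * unit_integral (q * (pderiv ^^ m) (pderiv p))"
    using Suc.IH Suc.prems by simp
  finally show ?case by (simp add: funpow_swap1)
qed simp

lemma higher_pderiv_eq_0: "degree p < m \<Longrightarrow> (pderiv ^^ m) (p :: real poly) = 0"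
  by (rule poly_eqI) (simp add: coeff_higher_pderiv coeff_eq_0)

lemma coeff_higher_pderiv_fact:
  "coeff ((pderiv ^^ j) p) i = fact (i + j) / fact i * coeff (p :: real poly) (i + j)"
proof (induction j arbitrary: i)
  case (Suc j)
  have "coeff ((pderiv ^^ Suc j) p) i = real (Suc i) * coeff ((pderiv ^^ j) p) (Suc i)"
    by (simp add: coeff_pderiv)
  then show ?case by (simp add: Suc)
qed simp

text \<open>An antiderivative of the multiple of the shifted Legendre polynomial of degree \<open>n - 1\<close> with
  leading coefficient \<open>1 / (n - 1)!\<close>; the choice of the constant makes it orthogonal
  to its derivative.\<close>

lemma extremal_polynomial:
  assumes "1 \<le> n"
  obtains N :: "real poly" where "degree N \<le> n" "coeff N n = 1 / fact n"
    "coeff N (n - 1) = - 1 / (2 * fact (n - 1))"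
    "unit_integral (pderiv N * pderiv N) = kappa n"
    "unit_integral (pderiv N * N) = 0"
    "\<And>p. degree p < n - 1 \<Longrightarrow> unit_integral (pderiv N * p) = 0"
proof (cases "n = 1")
  case True
  \<comment> \<open>Here \<open>N'\<close> is the constant 1, which is not orthogonal to constants,
    so the antiderivative is determined by orthogonality: its constant must be
    \<open>- 1 / 2\<close>.\<close>
  let ?N = "[:- 1 / 2, 1:] :: real poly"
  have 1: "pderiv [:0, -1/2, 1/2:] = ?N" by (simp add: pderiv_pCons)
  have 2: "pderiv [:0, 1:] = ([:1:] :: real poly)" by (simp add: pderiv_pCons)
  have "unit_integral ?N = 0" unfolding 1[symmetric] unit_integral_pderiv by simp
  moreover have "unit_integral [:1:] = 1" using unit_integral_pderiv[of "[:0, 1:]"] unfolding 2 by simp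
  ultimately show thesis
    using True by (intro that[of ?N]) (auto simp: pderiv_pCons kappa_def numeral_2_eq_2)
next
  case False
  define m where "m = n - 1"
  have n: "n = Suc m" and m: "1 \<le> m" using False assms by (auto simp: m_def)
  \<comment> \<open>Rodrigues' formula: the \<open>m\<close>-th derivative of \<open>q\<close> is a
    multiple of the shifted Legendre polynomial, and the \<open>m\<close>-fold roots at 0 and 1
    remove all boundary terms.\<close>
  define q :: "real poly" where "q = monom 1 m * [:- 1, 1:] ^ m"
  have root0: "poly ((pderiv ^^ j) q) 0 = 0" if "j < m" for j
    using higher_pderiv_root[of 0 m q j] that by (simp add: q_def monom_altdef)
  have root1: "poly ((pderiv ^^ j) q) 1 = 0" if "j < m" for j
    using higher_pderiv_root[of "- 1" m q j] that by (simp add: q_def)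
  have parts: "unit_integral ((pderiv ^^ m) q * p) = (- 1) ^ m * unit_integral (q * (pderiv ^^ m) p)" for p
    by (rule unit_integral_higher_parts) (simp add: root0 root1)
  have cq: "coeff q (m + i) = real (m choose i) * (- 1) ^ (m - i)" if "i \<le> m" for i
    using that by (simp add: q_def coeff_monom_mult coeff_linear_poly_power)
  have cq0: "coeff q i = 0" if "2 * m < i" for i
  proof -
    have "degree ([:- 1, 1:] ^ m :: real poly) \<le> m" using degree_power_le[of "[:- 1, 1:] :: real poly" m] by simp
    then have "degree q \<le> m + m" unfolding q_def
      by (intro order_trans[OF degree_mult_le] add_mono) (auto simp: degree_monom_le)
    then show ?thesis using that by (intro coeff_eq_0) simp
  qed
  \<comment> \<open>\<open>q\<close> is monic of degree \<open>2 m\<close>, so its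
    \<open>m\<close>-th derivative has leading coefficient \<open>(2 m)! / m!\<close>, which
    \<open>c\<close> rescales to \<open>1 / m!\<close>.\<close>
  define c where "c = 1 / (fact (2 * m) :: real)"
  define N where "N = smult c ((pderiv ^^ (m - 1)) q)"
  have N': "pderiv N = smult c ((pderiv ^^ m) q)"
  proof -
    have "(pderiv ^^ m) q = pderiv ((pderiv ^^ (m - 1)) q)"
      using m by (cases m) auto
    then show ?thesis by (simp add: N_def pderiv_smult)
  qed
  \<comment> \<open>Moving all derivatives onto one factor of the squared norm thus leaves a
    constant times the beta integral of \<open>q\<close>; this is the origin of
    \<open>kappa n\<close>.\<close>
  have q2: "(pderiv ^^ m) ((pderiv ^^ m) q) = [:fact (2 * m):]"
  proof (rule poly_eqI)
    fix i
    show "coeff ((pderiv ^^ m) ((pderiv ^^ m) q)) i = coeff [:fact (2 * m):] i"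
    proof (cases i)
      case 0
      then show ?thesis using cq[of m] by (simp add: coeff_higher_pderiv_fact mult_2)
    next
      case (Suc k)
      then have "coeff q (i + m + m) = 0" by (intro cq0) simp
      then show ?thesis using Suc by (simp add: coeff_higher_pderiv_fact)
    qed
  qed
  show thesis
  proof (rule that[of N])
    show "degree N \<le> n"
      by (rule degree_le) (use m n in \<open>auto simp: N_def coeff_higher_pderiv_fact intro!: cq0\<close>)
    show "coeff N n = 1 / fact n"
    proof -
      have e: "n + (m - Suc 0) = m + m" using n m by simp
      show ?thesis using cq[of m] by (simp add: N_def coeff_higher_pderiv_fact e c_def mult_2)
    qed
    show "coeff N (n - 1) = - 1 / (2 * fact (n - 1))"
    proof -
      have e: "m + (m - Suc 0) = 2 * m - Suc 0" using m by simp
      have "coeff q (2 * m - Suc 0) = - real m"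
        using cq[of "m - 1"] m binomial_symmetric[of 1 m] by (simp add: e)
      moreover have "fact (2 * m) = real (2 * m) * fact (2 * m - 1)"
        using m fact_reduce[of "2 * m", where 'a=real] by simp
      ultimately show ?thesis using m n
        by (simp add: N_def coeff_higher_pderiv_fact e c_def field_simps)
    qed
    show "unit_integral (pderiv N * pderiv N) = kappa n"
    proof -
      have "unit_integral ((pderiv ^^ m) q * (pderiv ^^ m) q) = (- 1) ^ m * (fact (2 * m) * unit_integral q)"
      proof -
        have "q * [:fact (2 * m):] = smult (fact (2 * m)) q" by simp
        then show ?thesis by (simp only: parts q2 unit_integral_smult)
      qed
      also have "unit_integral q = (- 1) ^ m * (fact m * fact m / fact (2 * m + 1))"
        unfolding q_def unit_integral_beta by (simp only: mult_2)
      also have "(- 1) ^ m * (fact (2 * m) * ((- 1) ^ m * (fact m * fact m / fact (2 * m + 1))))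
          = fact (2 * m) * (fact m * fact m / (fact (2 * m + 1) :: real))"
        by (cases "even m") simp_all
      finally show ?thesis
        by (simp add: N' unit_integral_smult c_def kappa_def n power2_eq_square del: fact_Suc)
    qed
    show "unit_integral (pderiv N * N) = 0"
    proof -
      have "poly N 0 = 0" "poly N 1 = 0" using m by (auto simp: N_def root0 root1)
      then have "unit_integral (pderiv N * N) = - unit_integral (N * pderiv N)"
        by (intro unit_integral_by_parts) auto
      then show ?thesis by (simp add: mult.commute)
    qed
    show "unit_integral (pderiv N * p) = 0" if "degree p < n - 1" for p
      using that parts[of p] higher_pderiv_eq_0[of p m] unit_integral_smult[of 0 0]
      by (simp add: N' unit_integral_smult m_def)
  qed
qed

text \<open>A nonzero combination of distinct monomials has finitely many roots, so its squared
  integral is positive. The constant \<open>\<mu>\<close> is the minimum of this form on the unit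
  sphere, extended by homogeneity.\<close>

lemma sum_monomials_form_pos:
  fixes e :: "'n::finite \<Rightarrow> nat" and w :: "'n \<Rightarrow> real"
  assumes inj: "inj e" and w: "\<And>i. w i \<noteq> 0"
  obtains \<mu> where "0 < \<mu>"
    "\<And>y :: real^'n. \<mu> * (norm y)\<^sup>2 \<le> integral {0..1} (\<lambda>x. (\<Sum>i\<in>UNIV. y $ i * w i * x ^ e i)\<^sup>2)"
proof -
  define p :: "real^'n \<Rightarrow> real poly" where "p y = (\<Sum>i\<in>UNIV. monom (y $ i * w i) (e i))" for y
  have pp: "poly (p y) x = (\<Sum>i\<in>UNIV. y $ i * w i * x ^ e i)" for y x
    by (simp add: p_def poly_sum poly_monom)
  define g where "g y = unit_integral (p y * p y)" for y
  have g: "g y = integral {0..1} (\<lambda>x. (\<Sum>i\<in>UNIV. y $ i * w i * x ^ e i)\<^sup>2)" for y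
    unfolding g_def unit_integral_def by (rule integral_cong) (simp add: pp power2_eq_square)
  have usum: "unit_integral (sum h S) = (\<Sum>i\<in>S. unit_integral (h i))" if "finite S" for h :: "'n \<Rightarrow> real poly" and S
    using that unit_integral_smult[of 0 0] by (induction) (auto simp: unit_integral_add)
  have "g y = (\<Sum>i\<in>UNIV. \<Sum>j\<in>UNIV. y $ i * y $ j * unit_integral (monom (w i) (e i) * monom (w j) (e j)))" for y
  proof -
    have "p y = (\<Sum>i\<in>UNIV. smult (y $ i) (monom (w i) (e i)))" by (simp add: p_def smult_monom)
    then show ?thesis
      unfolding g_def by (simp add: sum_product usum unit_integral_smult smult_monom mult_monom)
       (simp add: unit_integral_smult[symmetric] smult_monom mult_ac)
  qed
  then have cont: "continuous_on S g" for S by (intro continuous_intros | simp)+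
  have pos: "g y > 0" if "y \<noteq> 0" for y
  proof (rule ccontr)
    assume "\<not> g y > 0"
    moreover have "g y \<ge> 0" unfolding g by (intro integral_nonneg integrable_continuous_real continuous_intros) auto
    ultimately have "integral {0..1} (poly (p y * p y)) = 0" by (simp add: g_def unit_integral_def)
    then have "\<forall>x\<in>{0..1}. poly (p y * p y) x = 0"
      by (subst (asm) integral_eq_0_iff) (auto intro!: continuous_intros)
    then have "{0..1} \<subseteq> {x. poly (p y) x = 0}" by auto
    then have "infinite {x. poly (p y) x = 0}"
      using infinite_Icc[of 0 "1::real"] by (meson finite_subset zero_less_one)
    then have "p y = 0" using poly_roots_finite by blast
    have "y $ i = 0" for i
    proof -
      have "coeff (p y) (e i) = (\<Sum>j\<in>UNIV. if j = i then y $ j * w j else 0)"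
        unfolding p_def coeff_sum by (rule sum.cong) (use inj in \<open>auto simp: inj_def\<close>)
      then show ?thesis using \<open>p y = 0\<close> w[of i] by (simp add: sum.delta)
    qed
    then show False using that by (simp add: vec_eq_iff)
  qed
  obtain y0 where y0: "norm y0 = 1" "\<And>y. norm y = 1 \<Longrightarrow> g y0 \<le> g y"
    using continuous_attains_inf[of "sphere 0 1 :: (real^'n) set" g] cont vector_choose_size[of 1]
    by auto
  show thesis
  proof (rule that[of "g y0"])
    show "0 < g y0" using pos[of y0] y0(1) by fastforce
    fix y :: "real^'n"
    show "g y0 * (norm y)\<^sup>2 \<le> integral {0..1} (\<lambda>x. (\<Sum>i\<in>UNIV. y $ i * w i * x ^ e i)\<^sup>2)"
    proof (cases "y = 0")
      case False
      define z where "z = y /\<^sub>R norm y"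
      have "g y = (norm y)\<^sup>2 * g z"
      proof -
        have "p y = smult (norm y) (p z)"
          using False by (intro poly_eqI) (auto simp: p_def coeff_sum sum_distrib_left z_def intro!: sum.cong)
        then show ?thesis by (simp add: g_def unit_integral_smult power2_eq_square)
      qed
      moreover have "g y0 \<le> g z" using False by (intro y0) (simp add: z_def)
      ultimately show ?thesis unfolding g[symmetric]
        using mult_right_mono[of "g y0" "g z" "(norm y)\<^sup>2"] by (simp add: mult.commute)
    qed simp
  qed
qed

section \<open>Scaled responses of Krylov vectors\<close>

lemma integral_scale_unit:
  fixes f :: "real \<Rightarrow> real"
  assumes "0 < T" "continuous_on {0..T} f"
  shows "integral {0..T} f = T * integral {0..1} (\<lambda>x. f (T * x))"
proof -
  have "(f has_integral integral {0..T} f) {0..T}"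
    by (intro integrable_integral integrable_continuous_real assms)
  then have "((\<lambda>x. f (T * x)) has_integral integral {0..T} f / T) {0..1}"
    using has_integral_affinity_iff[OF assms(1), of f 0 "integral {0..T} f" 0 T] assms(1)
    by (simp add: divide_inverse mult.commute)
  then show ?thesis using assms(1) by (simp add: integral_unique)
qed

lemma poly_bounded_unit_interval:
  fixes p :: "real poly"
  obtains M where "0 \<le> M" "\<And>x. 0 \<le> x \<Longrightarrow> x \<le> 1 \<Longrightarrow> \<bar>poly p x\<bar> \<le> M"
proof -
  have "compact (poly p ` {0..1})" by (intro compact_continuous_image continuous_intros) auto
  then obtain M where "\<And>y. y \<in> poly p ` {0..1} \<Longrightarrow> norm y \<le> M"
    using compact_imp_bounded bounded_iff by metis
  then have "\<And>x. 0 \<le> x \<Longrightarrow> x \<le> 1 \<Longrightarrow> \<bar>poly p x\<bar> \<le> M" by simp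
  then show thesis using that[of "\<bar>M\<bar>"] by force
qed

locale krylov_test =
  fixes A :: "real^'n^'n" and N :: "real poly" and n :: nat
  assumes card_n: "n = CARD('n)"
    and degree_N: "degree N \<le> n"
    and coeff_N: "coeff N n = 1 / fact n"
    and coeff_N_1: "coeff N (n - 1) = - 1 / (2 * fact (n - 1))"
    and norm_N: "unit_integral (pderiv N * pderiv N) = kappa n"
    and orth_N: "unit_integral (pderiv N * N) = 0"
    and orth_low: "\<And>p. degree p < n - 1 \<Longrightarrow> unit_integral (pderiv N * p) = 0"
begin

abbreviation "dual_krylov u j \<equiv> mat_power (transpose A) j *v u"

text \<open>The summand 1 makes powers of this number increase with the exponent, so that one power
  can dominate all lower ones.\<close>

definition size_bound :: real where
  "size_bound = 1 + norm A + norm (transpose A)"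

text \<open>The coefficients of \<open>N\<close> in the basis of divided powers
  \<open>x^k / k!\<close>, counted from the top: the first two are 1 and
  \<open>- 1 / 2\<close>.\<close>

definition coef :: "nat \<Rightarrow> real" where
  "coef j = coeff N (n - j) * fact (n - j)"

text \<open>The vector \<open>w\<close> of the overview. The sum runs one step beyond the Krylov
  basis: the term \<open>j = n\<close> carries the constant term of \<open>N\<close>, and for
  \<open>n = 1\<close> it is the whole first-order correction.\<close>

definition test_vector :: "real \<Rightarrow> real^'n \<Rightarrow> real^'n" where
  "test_vector T u = (\<Sum>j\<le>n. (coef j * T ^ j) *\<^sub>R dual_krylov u j)"

text \<open>Division by \<open>T ^ (n - 1)\<close> is natural: the first nonzero moment of a dual
  vector has order \<open>n - 1\<close>, so its response starts with the power \<open>n - 1\<close>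
  of time.\<close>

definition response :: "real \<Rightarrow> real^'n \<Rightarrow> real^'n \<Rightarrow> real \<Rightarrow> real" where
  "response T b v x = (v \<bullet> (mat_exp ((T * x) *\<^sub>R A) *v b)) / T ^ (n - 1)"

definition energy :: "real \<Rightarrow> real^'n \<Rightarrow> real^'n \<Rightarrow> real" where
  "energy T b v = integral {0..1} (\<lambda>x. (response T b v x)\<^sup>2)"

text \<open>\<open>low j\<close> is the derivative of \<open>high j\<close>. The value 0 at
  \<open>j = n\<close> is the derivative of a constant and reflects that the response of
  \<open>B^n u\<close> has no part of this lower order.\<close>

definition low :: "nat \<Rightarrow> real \<Rightarrow> real" where
  "low j x = (if j < n then x ^ (n - 1 - j) / fact (n - 1 - j) else 0)"

definition high :: "nat \<Rightarrow> real \<Rightarrow> real" where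
  "high j x = x ^ (n - j) / fact (n - j)"

lemma n_pos: "1 \<le> n" by (simp add: card_n Suc_le_eq)

lemma dual_pairD:
  "dual_pair A b u \<Longrightarrow> k < n \<Longrightarrow> u \<bullet> (mat_power A k *v b) = (if k = n - 1 then 1 else 0)"
  by (simp add: dual_pair_def card_n)

lemma size_bound: "1 \<le> size_bound" "norm A \<le> size_bound" "norm (transpose A) \<le> size_bound"
  by (auto simp: size_bound_def)

lemma continuous_response: "continuous_on S (response T b v)"
proof -
  have "continuous_on S (\<lambda>x. mat_exp ((T * x) *\<^sub>R A))"
    by (rule continuous_on_compose2[OF continuous_on_mat_exp[of UNIV A]]) (auto intro!: continuous_intros)
  then show ?thesis unfolding response_def[abs_def] divide_inverse by (intro continuous_intros)
qed

lemma gramian_energy: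
  assumes "0 < T"
  shows "v \<bullet> (gramian A T b *v v) = T ^ (2 * n - 1) * energy T b v"
proof -
  have "v \<bullet> (gramian A T b *v v) = T * integral {0..1} (\<lambda>x. (v \<bullet> (mat_exp ((T * x) *\<^sub>R A) *v b))\<^sup>2)"
    unfolding gramian_form
    by (rule integral_scale_unit[OF assms]) (intro continuous_intros continuous_on_mat_exp)
  also have "(\<lambda>x. (v \<bullet> (mat_exp ((T * x) *\<^sub>R A) *v b))\<^sup>2) = (\<lambda>x. (T ^ (n - 1))\<^sup>2 * (response T b v x)\<^sup>2)"
    using assms by (simp add: response_def power_divide)
  also have "T * integral {0..1} \<dots> = (T * (T ^ (n - 1))\<^sup>2) * energy T b v"
    by (simp add: energy_def)
  also have "T * (T ^ (n - 1))\<^sup>2 = T ^ (2 * n - 1)"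
  proof -
    have "2 * n - 1 = Suc ((n - 1) * 2)" using n_pos by simp
    then show ?thesis by (simp only: power_Suc power_mult)
  qed
  finally show ?thesis .
qed

lemma response_add: "response T b (v + w) x = response T b v x + response T b w x"
  by (simp add: response_def inner_add_left add_divide_distrib)

lemma response_scaleR: "response T b (c *\<^sub>R v) x = c * response T b v x"
  by (simp add: response_def)

lemma response_sum: "response T b (sum f S) x = (\<Sum>i\<in>S. response T b (f i) x)"
  by (simp add: response_def inner_sum_left sum_divide_distrib)

lemma norm_dual_krylov:
  assumes "norm u \<le> R"
  shows "norm (dual_krylov u j) \<le> size_bound ^ j * R"
proof -
  have "norm (dual_krylov u j) \<le> norm (transpose A) ^ j * norm u" by (rule norm_mat_power_vec)
  also have "\<dots> \<le> size_bound ^ j * R" using assms size_bound by (intro mult_mono power_mono) auto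
  finally show ?thesis .
qed

lemma top_moment_le:
  assumes "norm b = 1" "norm u \<le> R"
  shows "\<bar>u \<bullet> (mat_power A n *v b)\<bar> \<le> size_bound ^ n * R"
proof -
  have "\<bar>u \<bullet> (mat_power A n *v b)\<bar> = \<bar>dual_krylov u n \<bullet> b\<bar>" by (simp add: inner_mat_power_transpose)
  also have "\<dots> \<le> norm (dual_krylov u n) * norm b" by (rule Cauchy_Schwarz_ineq2)
  finally show ?thesis using norm_dual_krylov[OF assms(2), of n] assms(1) by simp
qed

text \<open>In the Taylor polynomial only the moments of orders \<open>n - 1\<close> and
  \<open>n\<close> survive. The first equals 1 by duality, the second is the number \<open>c\<close>
  that depends on the pair.\<close>

lemma krylov_response_main_part:
  assumes "dual_pair A b u" "j \<le> n"
  shows "dual_krylov u j \<bullet> (\<Sum>k<n + 1 - j. (t ^ k / fact k) *\<^sub>R (mat_power A k *v b))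
    = low j t + u \<bullet> (mat_power A n *v b) * high j t"
proof -
  let ?h = "\<lambda>k. t ^ k / fact k * (u \<bullet> (mat_power A (j + k) *v b))"
  have "dual_krylov u j \<bullet> (\<Sum>k<n + 1 - j. (t ^ k / fact k) *\<^sub>R (mat_power A k *v b)) = (\<Sum>k<n + 1 - j. ?h k)"
    by (simp add: inner_sum_right inner_mat_power_shift)
  also have "\<dots> = low j t + u \<bullet> (mat_power A n *v b) * high j t"
  proof (cases "j < n")
    case True
    have m: "n + 1 - j = Suc (Suc (n - 1 - j))" using True by simp
    have "(\<Sum>k<n - 1 - j. ?h k) = 0"
      by (rule sum.neutral) (auto simp: dual_pairD[OF assms(1)])
    moreover have "u \<bullet> (mat_power A (j + (n - 1 - j)) *v b) = 1"
      using True by (simp add: dual_pairD[OF assms(1)])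
    moreover have "Suc (n - 1 - j) = n - j" "j + (n - j) = n" using True by auto
    ultimately show ?thesis unfolding m sum.lessThan_Suc using True
      by (simp add: low_def high_def del: fact_Suc power_Suc)
  next
    case False
    then show ?thesis using assms(2) by (simp add: low_def high_def)
  qed
  finally show ?thesis .
qed

text \<open>The Taylor remainder has order \<open>n + 1 - j\<close>; the scaling by
  \<open>T ^ j\<close> and the division by \<open>T ^ (n - 1)\<close> turn it into
  \<open>T\<^sup>2\<close> for every \<open>j\<close>. The constant depends on \<open>A\<close> and
  \<open>R\<close> only, not on the pair.\<close>

lemma krylov_response:
  obtains C where "0 \<le> C"
    "\<And>b u j T x. norm b = 1 \<Longrightarrow> dual_pair A b u \<Longrightarrow> norm u \<le> R \<Longrightarrow> j \<le> n \<Longrightarrow> 0 < T \<Longrightarrow> T \<le> 1 \<Longrightarrow>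
      0 \<le> x \<Longrightarrow> x \<le> 1 \<Longrightarrow>
      \<bar>response T b (T ^ j *\<^sub>R dual_krylov u j) x - (low j x + T * (u \<bullet> (mat_power A n *v b)) * high j x)\<bar> \<le> C * T\<^sup>2"
proof (rule that[of "size_bound ^ (n + 1) * exp size_bound * \<bar>R\<bar>"])
  show "0 \<le> size_bound ^ (n + 1) * exp size_bound * \<bar>R\<bar>" using size_bound by simp
  fix b u j and T x :: real
  assume b: "norm b = 1" and u: "dual_pair A b u" "norm u \<le> R" and j: "j \<le> n"
    and T: "0 < T" "T \<le> 1" and x: "0 \<le> x" "x \<le> 1"
  let ?m = "n + 1 - j" and ?t = "T * x" and ?c = "u \<bullet> (mat_power A n *v b)"
  let ?S = "\<Sum>k<?m. (?t ^ k / fact k) *\<^sub>R (mat_power A k *v b)"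
  let ?rem = "mat_exp (?t *\<^sub>R A) *v b - ?S"
  have t: "0 \<le> ?t" "?t \<le> 1" using T x by (auto intro: mult_le_one)
  have tT: "?t ^ ?m \<le> T ^ ?m" using T x t by (intro power_mono) (auto intro: mult_left_le)
  have "norm ?rem \<le> norm A ^ ?m * exp (norm A) * ?t ^ ?m * norm b" by (rule mat_exp_expansion[OF t])
  also have "\<dots> \<le> size_bound ^ ?m * exp size_bound * T ^ ?m * norm b"
  proof -
    have "norm A ^ ?m * exp (norm A) \<le> size_bound ^ ?m * exp size_bound"
      using size_bound by (intro mult_mono power_mono) auto
    from mult_mono[OF this tT] show ?thesis using b t size_bound by simp
  qed
  finally have rem: "norm ?rem \<le> size_bound ^ ?m * exp size_bound * T ^ ?m" using b by simp
  have "\<bar>dual_krylov u j \<bullet> ?rem\<bar> \<le> norm (dual_krylov u j) * norm ?rem" by (rule Cauchy_Schwarz_ineq2)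
  also have "\<dots> \<le> (size_bound ^ j * \<bar>R\<bar>) * (size_bound ^ ?m * exp size_bound * T ^ ?m)"
    using norm_dual_krylov[of u "\<bar>R\<bar>" j] u rem size_bound T by (intro mult_mono) auto
  also have "\<dots> = size_bound ^ (j + ?m) * exp size_bound * \<bar>R\<bar> * T ^ ?m" by (simp add: power_add)
  also have "j + ?m = n + 1" using j by simp
  finally have e: "\<bar>dual_krylov u j \<bullet> ?rem\<bar> \<le> size_bound ^ (n + 1) * exp size_bound * \<bar>R\<bar> * T ^ ?m" .
  have "dual_krylov u j \<bullet> (mat_exp (?t *\<^sub>R A) *v b) = low j ?t + ?c * high j ?t + dual_krylov u j \<bullet> ?rem"
    using krylov_response_main_part[OF u(1) j, of ?t] by (simp add: inner_diff_right)
  moreover have "T ^ j * low j ?t = T ^ (n - 1) * low j x"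
    using j by (cases "j < n") (auto simp: low_def power_mult_distrib simp flip: power_add mult.assoc)
  moreover have "T ^ j * high j ?t = T ^ (n - 1) * (T * high j x)"
  proof -
    have "T ^ j * T ^ (n - j) = T ^ n" using j by (simp flip: power_add)
    also have "\<dots> = T ^ (n - 1) * T" using n_pos power_minus_mult[of n T] by simp
    finally show ?thesis by (simp add: high_def power_mult_distrib flip: mult.assoc)
  qed
  ultimately have "response T b (T ^ j *\<^sub>R dual_krylov u j) x - (low j x + T * ?c * high j x)
      = T ^ j * (dual_krylov u j \<bullet> ?rem) / T ^ (n - 1)"
    using T by (simp add: response_def distrib_left field_simps)
  also have "\<bar>\<dots>\<bar> \<le> T ^ j * (size_bound ^ (n + 1) * exp size_bound * \<bar>R\<bar> * T ^ ?m) / T ^ (n - 1)"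
    unfolding abs_divide abs_mult using e T by (auto intro!: divide_right_mono mult_left_mono)
  also have "\<dots> = size_bound ^ (n + 1) * exp size_bound * \<bar>R\<bar> * T\<^sup>2"
  proof -
    have "T ^ j * T ^ ?m = T ^ (n + 1)" using j by (simp flip: power_add)
    also have "\<dots> = T ^ (n - 1 + 2)" using n_pos by simp
    finally have "T ^ j * T ^ ?m = T ^ (n - 1) * T\<^sup>2" by (simp only: power_add)
    then show ?thesis using T by (simp add: field_simps)
  qed
  finally show "\<bar>response T b (T ^ j *\<^sub>R dual_krylov u j) x - (low j x + T * ?c * high j x)\<bar>
      \<le> size_bound ^ (n + 1) * exp size_bound * \<bar>R\<bar> * T\<^sup>2" .
qed

lemma sum_coef_high: "(\<Sum>j\<le>n. coef j * high j x) = poly N x"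
proof -
  have "poly N x = poly (\<Sum>i\<le>n. monom (coeff N i) i) x"
    by (simp only: poly_as_sum_of_monoms'[OF degree_N])
  also have "\<dots> = (\<Sum>i\<le>n. coeff N i * x ^ i)" by (simp add: poly_sum poly_monom)
  also have "\<dots> = (\<Sum>j\<le>n. coef j * high j x)"
    by (rule sum.reindex_bij_witness[of _ "\<lambda>j. n - j" "\<lambda>i. n - i"]) (auto simp: coef_def high_def)
  finally show ?thesis by simp
qed

lemma sum_coef_low: "(\<Sum>j\<le>n. coef j * low j x) = poly (pderiv N) x"
proof -
  have "poly (pderiv N) x = poly (pderiv (\<Sum>i\<le>n. monom (coeff N i) i)) x"
    by (simp only: poly_as_sum_of_monoms'[OF degree_N])
  also have "\<dots> = (\<Sum>i\<le>n. real i * coeff N i * x ^ (i - 1))"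
    by (simp add: higher_pderiv_sum[of "Suc 0", simplified] pderiv_monom poly_sum poly_monom)
  also have "\<dots> = (\<Sum>j\<le>n. coef j * low j x)"
  proof (rule sum.reindex_bij_witness[of _ "\<lambda>j. n - j" "\<lambda>i. n - i"])
    fix i assume i: "i \<in> {..n}"
    show "coef (n - i) * low (n - i) x = real i * coeff N i * x ^ (i - 1)"
    proof (cases "i = 0")
      case False
      have "n - 1 - (n - i) = i - 1" "n - i < n" "n - (n - i) = i" using i False by auto
      then show ?thesis using fact_reduce[of i, where 'a=real] False
        by (simp add: coef_def low_def)
    qed (use i in \<open>simp add: coef_def low_def\<close>)
  qed auto
  finally show ?thesis by simp
qed

lemma test_response:
  obtains C where "0 \<le> C"
    "\<And>b u T x. norm b = 1 \<Longrightarrow> dual_pair A b u \<Longrightarrow> norm u \<le> R \<Longrightarrow> 0 < T \<Longrightarrow> T \<le> 1 \<Longrightarrow>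
      0 \<le> x \<Longrightarrow> x \<le> 1 \<Longrightarrow>
      \<bar>response T b (test_vector T u) x -
        (poly (pderiv N) x + T * (u \<bullet> (mat_power A n *v b)) * poly N x)\<bar> \<le> C * T\<^sup>2"
proof -
  obtain C where C: "0 \<le> C"
    "\<And>b u j T x. norm b = 1 \<Longrightarrow> dual_pair A b u \<Longrightarrow> norm u \<le> R \<Longrightarrow> j \<le> n \<Longrightarrow> 0 < T \<Longrightarrow> T \<le> 1 \<Longrightarrow>
      0 \<le> x \<Longrightarrow> x \<le> 1 \<Longrightarrow>
      \<bar>response T b (T ^ j *\<^sub>R dual_krylov u j) x - (low j x + T * (u \<bullet> (mat_power A n *v b)) * high j x)\<bar> \<le> C * T\<^sup>2"
    using krylov_response[of R] by blast
  show thesis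
  proof (rule that[of "(\<Sum>j\<le>n. \<bar>coef j\<bar>) * C"])
    show "0 \<le> (\<Sum>j\<le>n. \<bar>coef j\<bar>) * C" using C(1) by (simp add: sum_nonneg)
    fix b u and T x :: real
    assume *: "norm b = 1" "dual_pair A b u" "norm u \<le> R" "0 < T" "T \<le> 1" "0 \<le> x" "x \<le> 1"
    let ?c = "u \<bullet> (mat_power A n *v b)"
    let ?r = "\<lambda>j. response T b (T ^ j *\<^sub>R dual_krylov u j) x - (low j x + T * ?c * high j x)"
    have "response T b (test_vector T u) x = (\<Sum>j\<le>n. coef j * response T b (T ^ j *\<^sub>R dual_krylov u j) x)"
      by (simp add: test_vector_def response_sum response_scaleR mult.assoc)
    then have "response T b (test_vector T u) x - (poly (pderiv N) x + T * ?c * poly N x) = (\<Sum>j\<le>n. coef j * ?r j)"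
      unfolding sum_coef_low[symmetric] sum_coef_high[symmetric]
      by (simp add: sum_distrib_left sum.distrib[symmetric] sum_subtractf[symmetric] algebra_simps)
    also have "\<bar>\<dots>\<bar> \<le> (\<Sum>j\<le>n. \<bar>coef j\<bar> * (C * T\<^sup>2))"
    proof (rule order_trans[OF sum_abs], rule sum_mono)
      fix j assume "j \<in> {..n}"
      then show "\<bar>coef j * ?r j\<bar> \<le> \<bar>coef j\<bar> * (C * T\<^sup>2)"
        unfolding abs_mult using * by (intro mult_left_mono C(2)) auto
    qed
    also have "\<dots> = (\<Sum>j\<le>n. \<bar>coef j\<bar>) * C * T\<^sup>2" by (simp add: sum_distrib_right mult.assoc)
    finally show "\<bar>response T b (test_vector T u) x - (poly (pderiv N) x + T * ?c * poly N x)\<bar>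
        \<le> (\<Sum>j\<le>n. \<bar>coef j\<bar>) * C * T\<^sup>2" .
  qed
qed

lemma test_energy:
  obtains C where "0 \<le> C"
    "\<And>b u T. norm b = 1 \<Longrightarrow> dual_pair A b u \<Longrightarrow> norm u \<le> R \<Longrightarrow> 0 < T \<Longrightarrow> T \<le> 1 \<Longrightarrow>
      \<bar>energy T b (test_vector T u) - kappa n\<bar> \<le> C * T\<^sup>2"
proof -
  obtain C where C: "0 \<le> C"
    "\<And>b u T x. norm b = 1 \<Longrightarrow> dual_pair A b u \<Longrightarrow> norm u \<le> R \<Longrightarrow> 0 < T \<Longrightarrow> T \<le> 1 \<Longrightarrow>
      0 \<le> x \<Longrightarrow> x \<le> 1 \<Longrightarrow>
      \<bar>response T b (test_vector T u) x -
        (poly (pderiv N) x + T * (u \<bullet> (mat_power A n *v b)) * poly N x)\<bar> \<le> C * T\<^sup>2"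
    using test_response[of R] by blast
  obtain M1 where M1: "0 \<le> M1" "\<And>x. 0 \<le> x \<Longrightarrow> x \<le> 1 \<Longrightarrow> \<bar>poly (pderiv N) x\<bar> \<le> M1"
    using poly_bounded_unit_interval[of "pderiv N"] by blast
  obtain M0 where M0: "0 \<le> M0" "\<And>x. 0 \<le> x \<Longrightarrow> x \<le> 1 \<Longrightarrow> \<bar>poly N x\<bar> \<le> M0"
    using poly_bounded_unit_interval[of N] by blast
  define G where "G = size_bound ^ n * \<bar>R\<bar>"
  have G0: "0 \<le> G" using size_bound by (simp add: G_def)
  define D where "D = (G * M0)\<^sup>2 + 2 * ((M1 + G * M0) * C) + C\<^sup>2"
  show thesis
  proof (rule that[of D])
    show "0 \<le> D" using C(1) M0 M1 G0 by (simp add: D_def)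
    fix b u and T :: real
    assume *: "norm b = 1" "dual_pair A b u" "norm u \<le> R" "0 < T" "T \<le> 1"
    define c where "c = u \<bullet> (mat_power A n *v b)"
    have c: "\<bar>c\<bar> \<le> G" using top_moment_le[of b u "\<bar>R\<bar>"] * by (simp add: c_def G_def)
    let ?f = "response T b (test_vector T u)"
    \<comment> \<open>This is the square of \<open>N' + T c N\<close> without its term of order
      \<open>T\<^sup>2\<close>. By \<open>orth_N\<close> its integral is \<open>kappa n\<close>
      whatever \<open>c\<close> is.\<close>
    let ?p = "pderiv N * pderiv N + smult (2 * T * c) (pderiv N * N)"
    have pt: "norm ((?f x)\<^sup>2 - poly ?p x) \<le> D * T\<^sup>2" if x: "x \<in> {0..1}" for x
    proof -
      define e where "e = ?f x - (poly (pderiv N) x + T * c * poly N x)"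
      have e: "\<bar>e\<bar> \<le> C * T\<^sup>2" using C(2)[OF *(1-5), of x] x by (simp add: e_def c_def)
      have T2: "T\<^sup>2 \<le> 1" using * by (simp add: power_le_one)
      have eC: "\<bar>e\<bar> \<le> C" using e mult_left_le[OF T2 C(1)] by linarith
      have cN: "\<bar>c * poly N x\<bar> \<le> G * M0" unfolding abs_mult
        using c M0(2)[of x] x G0 by (intro mult_mono) auto
      have "\<bar>T * c * poly N x\<bar> \<le> 1 * (G * M0)"
        using mult_mono[OF *(5) cN] * by (simp add: abs_mult)
      then have g: "\<bar>poly (pderiv N) x + T * c * poly N x\<bar> \<le> M1 + G * M0"
        using M1(2)[of x] x by (intro order_trans[OF abs_triangle_ineq]) auto
      have "(?f x)\<^sup>2 - poly ?p x = T\<^sup>2 * (c * poly N x)\<^sup>2 + 2 * ((poly (pderiv N) x + T * c * poly N x) * e) + e * e"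
        by (simp add: e_def power2_eq_square algebra_simps)
      also have "\<bar>\<dots>\<bar> \<le> T\<^sup>2 * (G * M0)\<^sup>2 + 2 * ((M1 + G * M0) * (C * T\<^sup>2)) + (C * T\<^sup>2) * C"
      proof -
        have "(c * poly N x)\<^sup>2 \<le> (G * M0)\<^sup>2"
          using power_mono[OF cN abs_ge_zero, of 2] by (simp only: power2_abs)
        then have "\<bar>T\<^sup>2 * (c * poly N x)\<^sup>2\<bar> \<le> T\<^sup>2 * (G * M0)\<^sup>2"
          unfolding abs_of_nonneg[OF mult_nonneg_nonneg[OF zero_le_power2 zero_le_power2]]
          by (intro mult_left_mono) auto
        moreover have "\<bar>(poly (pderiv N) x + T * c * poly N x) * e\<bar> \<le> (M1 + G * M0) * (C * T\<^sup>2)"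
          unfolding abs_mult by (rule mult_mono[OF g e]) (use M1 M0 G0 in auto)
        moreover have "\<bar>e * e\<bar> \<le> (C * T\<^sup>2) * C"
          unfolding abs_mult by (rule mult_mono[OF e eC]) (use C in auto)
        ultimately show ?thesis by linarith
      qed
      also have "\<dots> = D * T\<^sup>2" by (simp add: D_def algebra_simps power2_eq_square)
      finally show ?thesis by simp
    qed
    have int: "(\<lambda>x. (?f x)\<^sup>2) integrable_on {0..1}"
      by (intro integrable_continuous_real continuous_intros continuous_response)
    have "unit_integral ?p = kappa n" by (simp add: unit_integral_add unit_integral_smult norm_N orth_N)
    then have "energy T b (test_vector T u) - kappa n = integral {0..1} (\<lambda>x. (?f x)\<^sup>2 - poly ?p x)"
      unfolding energy_def unit_integral_def by (subst integral_diff) (auto intro: int simp del: poly_add)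
    also have "norm \<dots> \<le> integral {0..1} (\<lambda>x::real. D * T\<^sup>2)"
      by (intro integral_norm_bound_integral integrable_diff int poly_integrable pt) auto
    finally show "\<bar>energy T b (test_vector T u) - kappa n\<bar> \<le> D * T\<^sup>2" by simp
  qed
qed

text \<open>Since \<open>coef 0 = 1\<close> and \<open>coef 1 = - 1 / 2\<close>, the cross term of
  the first two summands is \<open>- T (u . B u)\<close>, and \<open>u . B u = u . A u\<close>; all
  other contributions contain \<open>T\<^sup>2\<close>.\<close>

lemma test_vector_norm:
  obtains C where "0 \<le> C"
    "\<And>u T. norm u \<le> R \<Longrightarrow> 0 < T \<Longrightarrow> T \<le> 1 \<Longrightarrow>
      \<bar>(norm (test_vector T u))\<^sup>2 - ((norm u)\<^sup>2 - T * (u \<bullet> (A *v u)))\<bar> \<le> C * T\<^sup>2"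
proof -
  define r :: "real \<Rightarrow> real^'n \<Rightarrow> real^'n"
    where "r T u = (\<Sum>j\<in>{2..n}. (coef j * T ^ (j - 2)) *\<^sub>R dual_krylov u j)" for T u
  define D where "D = (\<Sum>j\<in>{2..n}. \<bar>coef j\<bar> * (size_bound ^ j * \<bar>R\<bar>))"
  define E where "E = size_bound * \<bar>R\<bar>"
  have D0: "0 \<le> D" using size_bound by (auto simp: D_def intro!: sum_nonneg)
  have E0: "0 \<le> E" using size_bound by (auto simp: E_def)
  have coef0: "coef 0 = 1" by (simp add: coef_def coeff_N)
  have coef1: "coef (Suc 0) = - 1 / 2" using coeff_N_1 by (simp add: coef_def)
  have dec: "test_vector T u = u - (T / 2) *\<^sub>R (transpose A *v u) + T\<^sup>2 *\<^sub>R r T u" for T u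
  proof -
    have "{..n} = insert 0 (insert 1 {2..n})" using n_pos by auto
    then have "test_vector T u = u + ((coef 1 * T) *\<^sub>R (transpose A *v u)
        + (\<Sum>j\<in>{2..n}. (coef j * T ^ j) *\<^sub>R dual_krylov u j))"
      by (simp add: test_vector_def coef0)
    moreover have "(\<Sum>j\<in>{2..n}. (coef j * T ^ j) *\<^sub>R dual_krylov u j) = T\<^sup>2 *\<^sub>R r T u"
      unfolding r_def scaleR_sum_right
    proof (rule sum.cong[OF refl])
      fix j assume "j \<in> {2..n}"
      then have "j = 2 + (j - 2)" by auto
      then have e: "T ^ j = T\<^sup>2 * T ^ (j - 2)" by (metis power_add)
      show "(coef j * T ^ j) *\<^sub>R dual_krylov u j = T\<^sup>2 *\<^sub>R (coef j * T ^ (j - 2)) *\<^sub>R dual_krylov u j"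
        by (simp only: e scaleR_scaleR mult.left_commute)
    qed
    ultimately show ?thesis by (simp add: coef1)
  qed
  define C where "C = E\<^sup>2 + 2 * ((\<bar>R\<bar> + E) * D) + D\<^sup>2"
  show thesis
  proof (rule that[of C])
    show "0 \<le> C" using D0 E0 by (simp add: C_def)
    fix u :: "real^'n" and T :: real assume u: "norm u \<le> R" and T: "0 < T" "T \<le> 1"
    have uR: "norm u \<le> \<bar>R\<bar>" using u by simp
    have rD: "norm (r T u) \<le> D" unfolding r_def D_def
    proof (rule order_trans[OF norm_sum], rule sum_mono)
      fix j assume "j \<in> {2..n}"
      have "\<bar>coef j * T ^ (j - 2)\<bar> \<le> \<bar>coef j\<bar>"
        using T by (simp add: abs_mult mult_left_le power_le_one)
      then show "norm ((coef j * T ^ (j - 2)) *\<^sub>R dual_krylov u j) \<le> \<bar>coef j\<bar> * (size_bound ^ j * \<bar>R\<bar>)"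
        unfolding norm_scaleR by (intro mult_mono norm_dual_krylov uR) auto
    qed
    let ?Bu = "transpose A *v u"
    have Bu: "norm ?Bu \<le> E" using norm_dual_krylov[OF uR, of 1] by (simp add: E_def)
    have uBu: "u \<bullet> ?Bu = u \<bullet> (A *v u)" using inner_transpose[of u A u] by (simp add: inner_commute)
    define s where "s = u - (T / 2) *\<^sub>R ?Bu"
    have "norm s \<le> norm u + norm ((T / 2) *\<^sub>R ?Bu)" unfolding s_def by (rule norm_triangle_ineq4)
    also have "norm ((T / 2) *\<^sub>R ?Bu) \<le> 1 * E" unfolding norm_scaleR using T Bu by (intro mult_mono) auto
    finally have s: "norm s \<le> \<bar>R\<bar> + E" using uR by simp
    have sr: "\<bar>s \<bullet> r T u\<bar> \<le> (\<bar>R\<bar> + E) * D"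
      by (rule order_trans[OF Cauchy_Schwarz_ineq2 mult_mono[OF s rD]]) (use E0 in auto)
    have rr: "\<bar>r T u \<bullet> r T u\<bar> \<le> D * D"
      by (rule order_trans[OF Cauchy_Schwarz_ineq2 mult_mono[OF rD rD]]) (use D0 in auto)
    have BB: "\<bar>?Bu \<bullet> ?Bu\<bar> \<le> E * E"
      by (rule order_trans[OF Cauchy_Schwarz_ineq2 mult_mono[OF Bu Bu]]) (use E0 in auto)
    have "(norm (test_vector T u))\<^sup>2 - ((norm u)\<^sup>2 - T * (u \<bullet> (A *v u)))
       = T\<^sup>2 * ((?Bu \<bullet> ?Bu) / 4 + 2 * (s \<bullet> r T u) + T\<^sup>2 * (r T u \<bullet> r T u))"
    proof -
      have "(norm (test_vector T u))\<^sup>2 = s \<bullet> s + 2 * T\<^sup>2 * (s \<bullet> r T u) + T\<^sup>2 * T\<^sup>2 * (r T u \<bullet> r T u)"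
        unfolding dec s_def[symmetric] power2_norm_eq_inner
        by (simp add: inner_add_left inner_add_right inner_commute algebra_simps)
      moreover have "s \<bullet> s = (norm u)\<^sup>2 - T * (u \<bullet> (A *v u)) + T\<^sup>2 * ((?Bu \<bullet> ?Bu) / 4)"
      proof -
        define w where "w = ?Bu"
        have "u \<bullet> w = u \<bullet> (A *v u)" using uBu by (simp only: w_def)
        then show ?thesis unfolding s_def power2_norm_eq_inner w_def[symmetric]
          by (simp add: inner_diff_left inner_diff_right inner_commute[of w u] power2_eq_square field_simps)
      qed
      ultimately show ?thesis by (simp add: algebra_simps)
    qed
    also have "\<bar>\<dots>\<bar> \<le> T\<^sup>2 * C"
      unfolding abs_mult
    proof (rule mult_mono)
      have "T\<^sup>2 * \<bar>r T u \<bullet> r T u\<bar> \<le> 1 * (D * D)"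
        using T by (intro mult_mono rr) (auto simp: power_le_one)
      then have "\<bar>T\<^sup>2 * (r T u \<bullet> r T u)\<bar> \<le> D * D" by (simp add: abs_mult)
      then show "\<bar>(?Bu \<bullet> ?Bu) / 4 + 2 * (s \<bullet> r T u) + T\<^sup>2 * (r T u \<bullet> r T u)\<bar> \<le> C"
        using sr BB unfolding C_def power2_eq_square by linarith
    qed auto
    finally show "\<bar>(norm (test_vector T u))\<^sup>2 - ((norm u)\<^sup>2 - T * (u \<bullet> (A *v u)))\<bar> \<le> C * T\<^sup>2"
      by (simp add: mult.commute)
  qed
qed

end

section \<open>Lower bound for a fixed dual pair\<close>

text \<open>In the application \<open>X\<close> is the coordinate along the test vector,
  \<open>y\<close> the size of the remaining coordinates, \<open>q\<close> the energy and
  \<open>s\<close> the squared norm. Completing the square against \<open>\<mu> * y\<^sup>2\<close>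
  turns mixed terms of order \<open>T\<close> into an error of order \<open>T\<^sup>2\<close> in the
  coefficient of \<open>X\<^sup>2\<close>.\<close>

lemma quadratic_form_comparison:
  fixes k \<mu> C V0 :: real
  assumes "0 < k" "0 < \<mu>" "0 \<le> C" "0 < V0"
  obtains K T0 where "0 < T0"
    "\<And>T X y q s V. 0 < T \<Longrightarrow> T \<le> T0 \<Longrightarrow> V0 \<le> V \<Longrightarrow> 0 \<le> y \<Longrightarrow>
      (k - C * T\<^sup>2) * X\<^sup>2 - 2 * C * T * \<bar>X\<bar> * y + (\<mu> - C * T) * y\<^sup>2 \<le> q \<Longrightarrow>
      s \<le> V * X\<^sup>2 + 2 * C * T * \<bar>X\<bar> * y + C * T\<^sup>2 * y\<^sup>2 \<Longrightarrow>
      k / V * (1 - K * T\<^sup>2) * s \<le> q"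
proof -
  \<comment> \<open>\<open>L\<close> collects the mixed terms of both forms: \<open>C\<close> from
    the energy, and \<open>C * l\<close> from the norm multiplied by the candidate bound
    \<open>l\<close>, which is at most \<open>k / V0\<close>.\<close>
  define L where "L = C + C * k / V0"
  \<comment> \<open>Chosen so that \<open>k * K - C\<close> is exactly what completing the square
    against \<open>(\<mu> / 2) * y\<^sup>2\<close> consumes.\<close>
  define K where "K = (C + 2 * L\<^sup>2 / \<mu>) / k"
  define T0 where "T0 = min 1 (min (1 / (K + 1)) (\<mu> / (2 * L + 1)))"
  have L: "0 \<le> L" "C * k / V0 = L - C" using assms by (auto simp: L_def)
  have K: "0 \<le> K" "k * K = C + 2 * L\<^sup>2 / \<mu>" using assms L by (auto simp: K_def)
  show thesis
  proof (rule that[of T0 K])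
    show "0 < T0" using assms K L by (auto simp: T0_def add_nonneg_pos)
    fix T X y q s V :: real
    assume T: "0 < T" "T \<le> T0" and V: "V0 \<le> V" and y: "0 \<le> y"
      and q: "(k - C * T\<^sup>2) * X\<^sup>2 - 2 * C * T * \<bar>X\<bar> * y + (\<mu> - C * T) * y\<^sup>2 \<le> q"
      and s: "s \<le> V * X\<^sup>2 + 2 * C * T * \<bar>X\<bar> * y + C * T\<^sup>2 * y\<^sup>2"
    have T1: "T \<le> 1" using T by (simp add: T0_def)
    have "T * (K + 1) \<le> 1" using T K by (simp add: T0_def pos_le_divide_eq)
    then have "T * K \<le> 1" using T by (simp add: algebra_simps)
    moreover have T2: "T\<^sup>2 \<le> T" using T T1 by (simp add: power2_eq_square mult_left_le)
    ultimately have KT: "K * T\<^sup>2 \<le> 1" using mult_left_mono[OF T2 K(1)] by (simp add: mult.commute)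
    have "T * (2 * L + 1) \<le> \<mu>" using T L by (simp add: T0_def pos_le_divide_eq)
    then have LT: "L * T \<le> \<mu> / 2" using T by (simp add: algebra_simps)
    define l where "l = k / V * (1 - K * T\<^sup>2)"
    have Vp: "0 < V" using V assms by simp
    have l0: "0 \<le> l" using Vp assms KT by (simp add: l_def)
    have "l \<le> k / V * 1" unfolding l_def using Vp assms K by (intro mult_left_mono) auto
    also have "\<dots> = k / V" by simp
    also have "\<dots> \<le> k / V0" using V assms by (intro divide_left_mono) auto
    finally have "C * l \<le> C * (k / V0)" using assms by (intro mult_left_mono) auto
    then have Cl: "C * l \<le> L - C" using L by simp
    have lV: "l * V = k * (1 - K * T\<^sup>2)" using Vp by (simp add: l_def)
    have "l * s \<le> l * (V * X\<^sup>2 + 2 * C * T * \<bar>X\<bar> * y + C * T\<^sup>2 * y\<^sup>2)" using s l0 by (rule mult_left_mono)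
    also have "\<dots> = (l * V) * X\<^sup>2 + (C * l) * (2 * T * \<bar>X\<bar> * y) + (C * l) * (T\<^sup>2 * y\<^sup>2)"
      by (simp add: algebra_simps)
    also have "\<dots> \<le> (l * V) * X\<^sup>2 + (L - C) * (2 * T * \<bar>X\<bar> * y) + (L - C) * (T * y\<^sup>2)"
    proof -
      have "(C * l) * (2 * T * \<bar>X\<bar> * y) \<le> (L - C) * (2 * T * \<bar>X\<bar> * y)"
        using Cl T y by (intro mult_right_mono) auto
      moreover have "(C * l) * (T\<^sup>2 * y\<^sup>2) \<le> (L - C) * (T * y\<^sup>2)"
      proof (rule mult_mono[OF Cl])
        show "T\<^sup>2 * y\<^sup>2 \<le> T * y\<^sup>2" using T2 by (rule mult_right_mono) simp
        show "0 \<le> L - C" using mult_nonneg_nonneg[OF assms(3) l0] Cl by linarith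
      qed simp
      ultimately show ?thesis by simp
    qed
    finally have ls: "l * s \<le> k * (1 - K * T\<^sup>2) * X\<^sup>2 + (L - C) * (2 * T * \<bar>X\<bar> * y) + (L - C) * (T * y\<^sup>2)"
      using lV by simp
    have "0 \<le> (2 * L * T * \<bar>X\<bar> - \<mu> * y)\<^sup>2 / (2 * \<mu>)" using assms by simp
    also have "\<dots> = 2 * L\<^sup>2 / \<mu> * T\<^sup>2 * X\<^sup>2 - 2 * L * T * \<bar>X\<bar> * y + (\<mu> / 2) * y\<^sup>2"
      using assms by (simp add: power2_diff power_mult_distrib field_simps) (simp add: power2_eq_square)
    also have "\<dots> \<le> 2 * L\<^sup>2 / \<mu> * T\<^sup>2 * X\<^sup>2 - 2 * L * T * \<bar>X\<bar> * y + (\<mu> - L * T) * y\<^sup>2"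
      using LT mult_right_mono[of "\<mu> / 2" "\<mu> - L * T" "y\<^sup>2"] by simp
    finally have "0 \<le> (k * K - C) * T\<^sup>2 * X\<^sup>2 - 2 * L * T * \<bar>X\<bar> * y + (\<mu> - L * T) * y\<^sup>2" using K by simp
    with ls q show "k / V * (1 - K * T\<^sup>2) * s \<le> q"
      unfolding l_def[symmetric] by (simp add: algebra_simps)
  qed
qed

text \<open>For small \<open>T\<close> the mixed term is absorbed by the diagonal ones. This turns
  the energy estimate into a proof of linear independence.\<close>

lemma quadratic_form_definite:
  fixes k \<mu> C T X y :: real
  assumes "0 < k" "0 < \<mu>" "0 \<le> C" "0 < T" "T \<le> 1" "4 * (C * T) \<le> k" "4 * (C * T) \<le> \<mu>"
    and "(k - C * T\<^sup>2) * X\<^sup>2 - 2 * C * T * \<bar>X\<bar> * y + (\<mu> - C * T) * y\<^sup>2 \<le> 0"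
  shows "X = 0 \<and> y = 0"
proof -
  have CT: "0 \<le> C * T" using assms by simp
  have "T\<^sup>2 \<le> T" using assms by (simp add: power2_eq_square mult_left_le)
  then have "C * T\<^sup>2 \<le> C * T" using assms by (intro mult_left_mono) auto
  then have 1: "(k - C * T\<^sup>2) * X\<^sup>2 \<ge> (3 * (k / 4)) * X\<^sup>2" using assms by (intro mult_right_mono) auto
  have 2: "(\<mu> - C * T) * y\<^sup>2 \<ge> (3 * (\<mu> / 4)) * y\<^sup>2" using assms by (intro mult_right_mono) auto
  have "0 \<le> (\<bar>X\<bar> - y)\<^sup>2" by simp
  then have "2 * \<bar>X\<bar> * y \<le> X\<^sup>2 + y\<^sup>2" by (simp add: power2_diff)
  then have "C * T * (2 * \<bar>X\<bar> * y) \<le> C * T * (X\<^sup>2 + y\<^sup>2)" using CT by (rule mult_left_mono)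
  also have "\<dots> \<le> k / 4 * X\<^sup>2 + \<mu> / 4 * y\<^sup>2"
    using mult_right_mono[of "C * T" "k / 4" "X\<^sup>2"] mult_right_mono[of "C * T" "\<mu> / 4" "y\<^sup>2"] assms
    by (simp add: distrib_left)
  finally have 3: "2 * C * T * \<bar>X\<bar> * y \<le> k / 4 * X\<^sup>2 + \<mu> / 4 * y\<^sup>2" by (simp add: mult_ac)
  have "k / 2 * X\<^sup>2 + \<mu> / 2 * y\<^sup>2 \<le> 0" using 1 2 3 assms(8) by (simp add: algebra_simps)
  moreover have "0 \<le> k / 2 * X\<^sup>2" "0 \<le> \<mu> / 2 * y\<^sup>2" using assms by auto
  ultimately have "k / 2 * X\<^sup>2 = 0" "\<mu> / 2 * y\<^sup>2 = 0" by linarith+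
  then show ?thesis using assms by simp
qed

lemma kappa_pos: "0 < kappa m"
  by (simp add: kappa_def)

context krylov_test
begin

text \<open>The index type has no order, so \<open>e\<close> enumerates it by Krylov exponents. The
  powers of \<open>T\<close> give all summands responses of order one, so that coordinates in
  \<open>y\<close> are comparable with the energy.\<close>

definition krylov_combination :: "('n \<Rightarrow> nat) \<Rightarrow> real \<Rightarrow> real^'n \<Rightarrow> real^'n \<Rightarrow> real^'n" where
  "krylov_combination e T u y = (\<Sum>i\<in>UNIV. (y $ i) *\<^sub>R (T ^ e i *\<^sub>R dual_krylov u (e i)))"

lemma sum_abs_components_le: "(\<Sum>i\<in>UNIV. \<bar>y $ i\<bar> * c) \<le> real n * norm (y :: real^'n) * c" if "0 \<le> c"
proof -
  have "(\<Sum>i\<in>UNIV. \<bar>y $ i\<bar> * c) \<le> (\<Sum>i\<in>(UNIV :: 'n set). norm y * c)"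
    using that by (intro sum_mono mult_right_mono component_le_norm_cart) auto
  then show ?thesis by (simp add: card_n)
qed

lemma combination_response:
  assumes b: "norm b = 1" "dual_pair A b u" and e: "\<And>i. e i < n"
  obtains C where "0 \<le> C"
    "\<And>T x y. 0 < T \<Longrightarrow> T \<le> 1 \<Longrightarrow> 0 \<le> x \<Longrightarrow> x \<le> 1 \<Longrightarrow>
      \<bar>response T b (krylov_combination e T u y) x - (\<Sum>i\<in>UNIV. y $ i * low (e i) x)\<bar> \<le> C * T * norm y"
proof -
  define R where "R = norm u"
  obtain C where C: "0 \<le> C"
    "\<And>b u j T x. norm b = 1 \<Longrightarrow> dual_pair A b u \<Longrightarrow> norm u \<le> R \<Longrightarrow> j \<le> n \<Longrightarrow> 0 < T \<Longrightarrow> T \<le> 1 \<Longrightarrow>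
      0 \<le> x \<Longrightarrow> x \<le> 1 \<Longrightarrow>
      \<bar>response T b (T ^ j *\<^sub>R dual_krylov u j) x - (low j x + T * (u \<bullet> (mat_power A n *v b)) * high j x)\<bar> \<le> C * T\<^sup>2"
    using krylov_response[of R] by blast
  define c where "c = u \<bullet> (mat_power A n *v b)"
  have D0: "0 \<le> \<bar>c\<bar> + C" using C(1) by simp
  show thesis
  proof (rule that[of "real n * (\<bar>c\<bar> + C)"])
    show "0 \<le> real n * (\<bar>c\<bar> + C)" using D0 by simp
    fix T x :: real and y :: "real^'n"
    assume T: "0 < T" "T \<le> 1" and x: "0 \<le> x" "x \<le> 1"
    let ?r = "\<lambda>i. response T b (T ^ e i *\<^sub>R dual_krylov u (e i)) x - low (e i) x"
    have r: "\<bar>?r i\<bar> \<le> (\<bar>c\<bar> + C) * T" for i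
    proof -
      have h: "0 \<le> high (e i) x" "high (e i) x \<le> 1"
        using x by (auto simp: high_def divide_le_eq_1 intro!: order_trans[OF power_le_one] fact_ge_1)
      have "\<bar>?r i - T * c * high (e i) x\<bar> \<le> C * T\<^sup>2"
        using C(2)[OF b, of "e i" T x] e[of i] T x by (simp add: c_def R_def algebra_simps)
      moreover have "C * T\<^sup>2 \<le> C * T" using T C(1) by (intro mult_left_mono) (auto simp: power2_eq_square mult_left_le)
      moreover have "\<bar>T * c * high (e i) x\<bar> \<le> T * \<bar>c\<bar> * 1"
        unfolding abs_mult using h T by (intro mult_mono) auto
      ultimately show ?thesis by (simp add: algebra_simps)
    qed
    have "response T b (krylov_combination e T u y) x - (\<Sum>i\<in>UNIV. y $ i * low (e i) x) = (\<Sum>i\<in>UNIV. y $ i * ?r i)"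
      by (simp add: krylov_combination_def response_sum response_scaleR sum_subtractf right_diff_distrib mult.assoc)
    also have "\<bar>\<dots>\<bar> \<le> (\<Sum>i\<in>UNIV. \<bar>y $ i\<bar> * ((\<bar>c\<bar> + C) * T))"
      by (rule order_trans[OF sum_abs], rule sum_mono) (auto simp: abs_mult intro: mult_left_mono r)
    also have "\<dots> \<le> real n * norm y * ((\<bar>c\<bar> + C) * T)"
      using D0 T by (intro sum_abs_components_le) auto
    finally show "\<bar>response T b (krylov_combination e T u y) x - (\<Sum>i\<in>UNIV. y $ i * low (e i) x)\<bar>
        \<le> real n * (\<bar>c\<bar> + C) * T * norm y" by (simp add: mult_ac)
  qed
qed

text \<open>With the component of \<open>u\<close> itself excluded, every summand contains at least
  one factor \<open>T\<close>.\<close>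

lemma norm_combination:
  assumes e: "\<And>i. e i < n" and y: "\<And>i. e i = 0 \<Longrightarrow> y $ i = 0" and T: "0 < T" "T \<le> 1"
  shows "norm (krylov_combination e T u y) \<le> real n * (size_bound ^ n * norm u) * T * norm y"
proof -
  have "norm (krylov_combination e T u y) \<le> (\<Sum>i\<in>UNIV. \<bar>y $ i\<bar> * (T * (size_bound ^ n * norm u)))"
    unfolding krylov_combination_def
  proof (rule order_trans[OF norm_sum], rule sum_mono)
    fix i
    show "norm ((y $ i) *\<^sub>R (T ^ e i *\<^sub>R dual_krylov u (e i))) \<le> \<bar>y $ i\<bar> * (T * (size_bound ^ n * norm u))"
    proof (cases "e i = 0")
      case False
      then have "T ^ e i \<le> T ^ 1" using T by (intro power_decreasing) auto
      moreover have "norm (dual_krylov u (e i)) \<le> size_bound ^ n * norm u"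
        using e[of i] size_bound
        by (intro order_trans[OF norm_dual_krylov[OF order_refl]] mult_right_mono power_increasing) auto
      ultimately have "T ^ e i * norm (dual_krylov u (e i)) \<le> T * (size_bound ^ n * norm u)"
        using T by (intro mult_mono) auto
      then have "\<bar>y $ i\<bar> * (T ^ e i * norm (dual_krylov u (e i))) \<le> \<bar>y $ i\<bar> * (T * (size_bound ^ n * norm u))"
        by (rule mult_left_mono) simp
      then show ?thesis using T by (simp add: abs_mult mult.assoc)
    qed (simp add: y)
  qed
  also have "\<dots> \<le> real n * norm y * (T * (size_bound ^ n * norm u))"
    using T size_bound by (intro sum_abs_components_le) auto
  finally show ?thesis by (simp add: mult_ac)
qed

lemma norm_test_vector:
  assumes "0 < T" "T \<le> 1"
  shows "norm (test_vector T u) \<le> (\<Sum>j\<le>n. \<bar>coef j\<bar> * (size_bound ^ j * norm u))"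
  unfolding test_vector_def
proof (rule order_trans[OF norm_sum], rule sum_mono)
  fix j
  have "\<bar>coef j * T ^ j\<bar> \<le> \<bar>coef j\<bar>"
    using assms by (simp add: abs_mult mult_left_le power_le_one)
  then show "norm ((coef j * T ^ j) *\<^sub>R dual_krylov u j) \<le> \<bar>coef j\<bar> * (size_bound ^ j * norm u)"
    unfolding norm_scaleR by (intro mult_mono norm_dual_krylov order_refl) auto
qed

text \<open>Excluding exponent 0 leaves monomials of degree below \<open>n - 1\<close>, to which the
  Legendre polynomial \<open>N'\<close> is orthogonal.\<close>

lemma orth_low_sum:
  assumes e: "\<And>i. e i < n" and y: "\<And>i. e i = 0 \<Longrightarrow> y $ i = 0"
  shows "integral {0..1} (\<lambda>x. poly (pderiv N) x * (\<Sum>i\<in>UNIV. y $ i * low (e i) x)) = 0"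
proof -
  have "integral {0..1} (\<lambda>x. poly (pderiv N) x * (y $ i * low (e i) x)) = 0" for i
  proof (cases "e i = 0")
    case False
    let ?p = "monom (y $ i / fact (n - 1 - e i)) (n - 1 - e i)"
    have "degree ?p < n - 1"
      using e[of i] False degree_monom_le[of "y $ i / fact (n - 1 - e i)" "n - 1 - e i"] by linarith
    then have "unit_integral (pderiv N * ?p) = 0" by (rule orth_low)
    moreover have "poly (pderiv N * ?p) = (\<lambda>x. poly (pderiv N) x * (y $ i * low (e i) x))"
      by (rule ext) (simp add: poly_monom low_def e)
    ultimately show ?thesis unfolding unit_integral_def by simp
  qed (simp add: y)
  note 0 = this
  have "((\<lambda>x. poly (pderiv N) x * (y $ i * low (e i) x)) has_integral 0) {0..1}" for i
  proof -
    have "continuous_on {0..1} (low (e i))" by (simp add: low_def[abs_def] e continuous_intros)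
    then have "(\<lambda>x. poly (pderiv N) x * (y $ i * low (e i) x)) integrable_on {0..1}"
      by (intro integrable_continuous_real continuous_intros)
    then show ?thesis using integrable_integral 0[of i] by fastforce
  qed
  then have "((\<lambda>x. \<Sum>i\<in>UNIV. poly (pderiv N) x * (y $ i * low (e i) x)) has_integral (\<Sum>i\<in>(UNIV::'n set). 0)) {0..1}"
    using has_integral_sum[of UNIV "\<lambda>i x. poly (pderiv N) x * (y $ i * low (e i) x)" "\<lambda>_. 0" "{0..1}"] by simp
  then show ?thesis by (simp add: sum_distrib_left integral_unique)
qed

text \<open>The orders in \<open>T\<close> are what matters: the coefficient of
  \<open>X\<^sup>2\<close> is known up to \<open>T\<^sup>2\<close>, while errors of order
  \<open>T\<close> are tolerated in the mixed and \<open>y\<close> terms. Orthogonality removes the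
  mixed term of order one.\<close>

lemma perturbed_energy_lower:
  assumes b: "norm b = 1" "dual_pair A b u" and e: "inj e" "\<And>i. e i < n"
  obtains \<mu> C where "0 < \<mu>" "0 \<le> C"
    "\<And>T X y. 0 < T \<Longrightarrow> T \<le> 1 \<Longrightarrow> (\<And>i. e i = 0 \<Longrightarrow> y $ i = 0) \<Longrightarrow>
      (kappa n - C * T\<^sup>2) * X\<^sup>2 - 2 * C * T * \<bar>X\<bar> * norm y + (\<mu> - C * T) * (norm y)\<^sup>2
        \<le> energy T b (X *\<^sub>R test_vector T u + krylov_combination e T u y)"
    "\<And>T X y. 0 < T \<Longrightarrow> T \<le> 1 \<Longrightarrow> (\<And>i. e i = 0 \<Longrightarrow> y $ i = 0) \<Longrightarrow>
      (norm (X *\<^sub>R test_vector T u + krylov_combination e T u y))\<^sup>2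
        \<le> (norm (test_vector T u))\<^sup>2 * X\<^sup>2 + 2 * C * T * \<bar>X\<bar> * norm y + C * T\<^sup>2 * (norm y)\<^sup>2"
proof -
  define R where "R = norm u"
  define d where "d i = n - 1 - e i" for i
  have "inj d"
  proof (rule injI)
    fix i j assume "d i = d j"
    then have "e i = e j" using e(2)[of i] e(2)[of j] by (simp add: d_def)
    then show "i = j" using e(1) by (simp add: inj_def)
  qed
  then obtain \<mu> where \<mu>: "0 < \<mu>"
    "\<And>y :: real^'n. \<mu> * (norm y)\<^sup>2 \<le> integral {0..1} (\<lambda>x. (\<Sum>i\<in>UNIV. y $ i * (1 / fact (d i)) * x ^ d i)\<^sup>2)"
    using sum_monomials_form_pos[of d "\<lambda>i. 1 / fact (d i)"] by auto
  define P where "P y x = (\<Sum>i\<in>UNIV. y $ i * low (e i) x)" for y :: "real^'n" and x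
  have P_eq: "P y = (\<lambda>x. \<Sum>i\<in>UNIV. y $ i * (1 / fact (d i)) * x ^ d i)" for y
    by (simp add: P_def[abs_def] low_def e d_def)
  have contP: "continuous_on S (P y)" for S y unfolding P_eq by (intro continuous_intros)
  have Ple: "\<bar>P y x\<bar> \<le> real n * norm y" if "0 \<le> x" "x \<le> 1" for y x
  proof -
    have "\<bar>low (e i) x\<bar> \<le> 1" for i
      using that by (auto simp: low_def divide_le_eq_1 intro!: order_trans[OF power_le_one] fact_ge_1)
    then have "\<bar>P y x\<bar> \<le> (\<Sum>i\<in>UNIV. \<bar>y $ i\<bar> * 1)" unfolding P_def
      by (intro order_trans[OF sum_abs] sum_mono) (simp add: abs_mult mult_left_le)
    also have "\<dots> \<le> real n * norm y * 1" by (rule sum_abs_components_le) simp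
    finally show ?thesis by simp
  qed
  obtain C1 where C1': "0 \<le> C1" "\<And>T x y. 0 < T \<Longrightarrow> T \<le> 1 \<Longrightarrow> 0 \<le> x \<Longrightarrow> x \<le> 1 \<Longrightarrow>
      \<bar>response T b (krylov_combination e T u y) x - (\<Sum>i\<in>UNIV. y $ i * low (e i) x)\<bar> \<le> C1 * T * norm y"
    apply (rule combination_response[of b u e])
    subgoal by (rule b)
    subgoal by (rule b)
    subgoal by (rule e)
    subgoal premises p by (rule p(1)[OF p(2)]) (rule p(3))
    done
  have C1: "0 \<le> C1" "\<And>T x y. 0 < T \<Longrightarrow> T \<le> 1 \<Longrightarrow> 0 \<le> x \<Longrightarrow> x \<le> 1 \<Longrightarrow>
      \<bar>response T b (krylov_combination e T u y) x - P y x\<bar> \<le> C1 * T * norm y"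
    unfolding P_def by (fact C1'(1), rule C1'(2))
  obtain C2 where C2': "0 \<le> C2"
    "\<And>b u T x. norm b = 1 \<Longrightarrow> dual_pair A b u \<Longrightarrow> norm u \<le> R \<Longrightarrow> 0 < T \<Longrightarrow> T \<le> 1 \<Longrightarrow>
      0 \<le> x \<Longrightarrow> x \<le> 1 \<Longrightarrow>
      \<bar>response T b (test_vector T u) x -
        (poly (pderiv N) x + T * (u \<bullet> (mat_power A n *v b)) * poly N x)\<bar> \<le> C2 * T\<^sup>2"
    using test_response[of R] by blast
  have C2: "0 \<le> C2"
    "\<And>T x. 0 < T \<Longrightarrow> T \<le> 1 \<Longrightarrow> 0 \<le> x \<Longrightarrow> x \<le> 1 \<Longrightarrow>
      \<bar>response T b (test_vector T u) x -
        (poly (pderiv N) x + T * (u \<bullet> (mat_power A n *v b)) * poly N x)\<bar> \<le> C2 * T\<^sup>2"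
    using C2'(1) C2'(2)[OF b] by (simp_all add: R_def)
  obtain C6 where C6': "0 \<le> C6" "\<And>b u T. norm b = 1 \<Longrightarrow> dual_pair A b u \<Longrightarrow> norm u \<le> R \<Longrightarrow>
      0 < T \<Longrightarrow> T \<le> 1 \<Longrightarrow> \<bar>energy T b (test_vector T u) - kappa n\<bar> \<le> C6 * T\<^sup>2"
    using test_energy[of R] by blast
  have C6: "0 \<le> C6" "\<And>T. 0 < T \<Longrightarrow> T \<le> 1 \<Longrightarrow> \<bar>energy T b (test_vector T u) - kappa n\<bar> \<le> C6 * T\<^sup>2"
    using C6'(1) C6'(2)[OF b] by (simp_all add: R_def)
  obtain M1 where M1: "0 \<le> M1" "\<And>x. 0 \<le> x \<Longrightarrow> x \<le> 1 \<Longrightarrow> \<bar>poly (pderiv N) x\<bar> \<le> M1"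
    using poly_bounded_unit_interval[of "pderiv N"] by blast
  obtain M0 where M0: "0 \<le> M0" "\<And>x. 0 \<le> x \<Longrightarrow> x \<le> 1 \<Longrightarrow> \<bar>poly N x\<bar> \<le> M0"
    using poly_bounded_unit_interval[of N] by blast
  define c where "c = u \<bullet> (mat_power A n *v b)"
  define C3 where "C3 = \<bar>c\<bar> * M0 + C2"
  have C30: "0 \<le> C3" using M0 C2 by (simp add: C3_def)
  define C4 where "C4 = C3 * (real n + C1) + M1 * C1"
  define C5 where "C5 = C1 * (2 * real n + C1)"
  have C40: "0 \<le> C4" using C30 C1 M1 by (simp add: C4_def)
  have C50: "0 \<le> C5" using C1 by (simp add: C5_def)
  define W where "W = (\<Sum>j\<le>n. \<bar>coef j\<bar> * (size_bound ^ j * norm u))"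
  define Z where "Z = real n * (size_bound ^ n * norm u)"
  have W0: "0 \<le> W" using size_bound by (auto simp: W_def intro!: sum_nonneg)
  have Z0: "0 \<le> Z" using size_bound by (auto simp: Z_def)
  define C where "C = C4 + C5 + C6 + W * Z + Z\<^sup>2"
  have C0: "0 \<le> C" and CC: "C4 \<le> C" "C5 \<le> C" "C6 \<le> C" "W * Z \<le> C" "Z\<^sup>2 \<le> C"
    using C40 C50 C6(1) W0 Z0 by (auto simp: C_def add_nonneg_nonneg)
  have energy: "(kappa n - C * T\<^sup>2) * X\<^sup>2 - 2 * C * T * \<bar>X\<bar> * norm y + (\<mu> - C * T) * (norm y)\<^sup>2
        \<le> energy T b (X *\<^sub>R test_vector T u + krylov_combination e T u y)"
    if T: "0 < T" "T \<le> 1" and y: "\<And>i. e i = 0 \<Longrightarrow> y $ i = 0" for T X y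
  proof -
    let ?F = "response T b (test_vector T u)" and ?G = "response T b (krylov_combination e T u y)"
    let ?Y = "norm y" and ?N' = "poly (pderiv N)"
    \<comment> \<open>The term in \<open>X\<^sup>2\<close> is kept exact, not replaced by
      \<open>N'\<close>: its integral is then given by \<open>test_energy\<close> up to
      \<open>T\<^sup>2\<close>, whereas a pointwise comparison would lose an error of order
      \<open>T\<close>.\<close>
    have pt: "X\<^sup>2 * (?F x)\<^sup>2 + (2 * X) * (?N' x * P y x) + (P y x)\<^sup>2 - (2 * \<bar>X\<bar> * (C4 * T * ?Y) + C5 * T * ?Y\<^sup>2)
        \<le> (response T b (X *\<^sub>R test_vector T u + krylov_combination e T u y) x)\<^sup>2" if x: "x \<in> {0..1}" for x
    proof -
      have x': "0 \<le> x" "x \<le> 1" using x by auto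
      have GP: "\<bar>?G x - P y x\<bar> \<le> C1 * T * ?Y" using C1(2)[OF T x'] .
      also have "\<dots> \<le> C1 * 1 * ?Y" using T C1(1) by (intro mult_right_mono mult_left_mono) auto
      finally have GP1: "\<bar>?G x - P y x\<bar> \<le> C1 * ?Y" by simp
      have G: "\<bar>?G x\<bar> \<le> (real n + C1) * ?Y" using GP1 Ple[OF x', of y] by (simp add: algebra_simps)
      have GPs: "\<bar>?G x + P y x\<bar> \<le> (2 * real n + C1) * ?Y"
        using G Ple[OF x', of y] by (simp add: algebra_simps)
      have "\<bar>?F x - (?N' x + T * c * poly N x)\<bar> \<le> C2 * T\<^sup>2" using C2(2)[OF T x'] by (simp add: c_def)
      moreover have "C2 * T\<^sup>2 \<le> C2 * T" using T C2(1) by (intro mult_left_mono) (auto simp: power2_eq_square mult_left_le)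
      moreover have "\<bar>T * c * poly N x\<bar> \<le> T * \<bar>c\<bar> * M0"
        unfolding abs_mult using M0(2)[OF x'] T by (intro mult_mono) auto
      ultimately have FN: "\<bar>?F x - ?N' x\<bar> \<le> C3 * T" by (simp add: C3_def algebra_simps)
      have "?F x * ?G x - ?N' x * P y x = (?F x - ?N' x) * ?G x + ?N' x * (?G x - P y x)"
        by (simp add: algebra_simps)
      also have "\<bar>\<dots>\<bar> \<le> C3 * T * ((real n + C1) * ?Y) + M1 * (C1 * T * ?Y)"
      proof (rule order_trans[OF abs_triangle_ineq], rule add_mono)
        show "\<bar>(?F x - ?N' x) * ?G x\<bar> \<le> C3 * T * ((real n + C1) * ?Y)"
          unfolding abs_mult by (rule mult_mono[OF FN G]) (use C30 T in auto)
        show "\<bar>?N' x * (?G x - P y x)\<bar> \<le> M1 * (C1 * T * ?Y)"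
          unfolding abs_mult by (rule mult_mono[OF M1(2)[OF x'] GP]) (use M1 in auto)
      qed
      also have "\<dots> = C4 * T * ?Y" by (simp add: C4_def algebra_simps)
      finally have "\<bar>X * (?F x * ?G x - ?N' x * P y x)\<bar> \<le> \<bar>X\<bar> * (C4 * T * ?Y)"
        unfolding abs_mult by (rule mult_left_mono) simp
      moreover have "\<bar>(?G x - P y x) * (?G x + P y x)\<bar> \<le> C1 * T * ?Y * ((2 * real n + C1) * ?Y)"
        unfolding abs_mult by (rule mult_mono[OF GP GPs]) (use C1 T in auto)
      moreover have "C1 * T * ?Y * ((2 * real n + C1) * ?Y) = C5 * T * ?Y\<^sup>2"
        by (simp add: C5_def power2_eq_square)
      moreover have "(response T b (X *\<^sub>R test_vector T u + krylov_combination e T u y) x)\<^sup>2 =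
          X\<^sup>2 * (?F x)\<^sup>2 + (2 * X) * (?N' x * P y x) + (P y x)\<^sup>2
          + 2 * (X * (?F x * ?G x - ?N' x * P y x)) + (?G x - P y x) * (?G x + P y x)"
        by (simp add: response_add response_scaleR power2_eq_square algebra_simps)
      ultimately show ?thesis by (simp add: abs_le_iff)
    qed
    have iF: "(\<lambda>x. (?F x)\<^sup>2) integrable_on {0..1}"
      by (intro integrable_continuous_real continuous_intros continuous_response)
    have "(\<lambda>x. ?N' x * P y x) integrable_on {0..1}"
      by (intro integrable_continuous_real continuous_intros contP)
    moreover have "integral {0..1} (\<lambda>x. ?N' x * P y x) = 0"
      unfolding P_def by (rule orth_low_sum) (use e y in auto)
    ultimately have iNP: "((\<lambda>x. ?N' x * P y x) has_integral 0) {0..1}"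
      using integrable_integral by fastforce
    have iP: "(\<lambda>x. (P y x)\<^sup>2) integrable_on {0..1}"
      by (intro integrable_continuous_real continuous_intros contP)
    let ?k = "2 * \<bar>X\<bar> * (C4 * T * ?Y) + C5 * T * ?Y\<^sup>2"
    have "((\<lambda>x. X\<^sup>2 * (?F x)\<^sup>2 + (2 * X) * (?N' x * P y x) + (P y x)\<^sup>2 - ?k) has_integral
        (X\<^sup>2 * energy T b (test_vector T u) + (2 * X) * 0 + integral {0..1} (\<lambda>x. (P y x)\<^sup>2) - ?k * (1 - 0))) {0..1}"
      using iF iNP iP unfolding energy_def
      by (intro has_integral_diff has_integral_add has_integral_mult_right)
        (auto simp: has_integral_integral has_integral_const_real[of _ 0 1, simplified])
    moreover have "((\<lambda>x. (response T b (X *\<^sub>R test_vector T u + krylov_combination e T u y) x)\<^sup>2) has_integral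
        energy T b (X *\<^sub>R test_vector T u + krylov_combination e T u y)) {0..1}"
      unfolding energy_def
      by (intro integrable_integral integrable_continuous_real continuous_intros continuous_response)
    ultimately have "X\<^sup>2 * energy T b (test_vector T u) + (2 * X) * 0 + integral {0..1} (\<lambda>x. (P y x)\<^sup>2) - ?k * (1 - 0)
        \<le> energy T b (X *\<^sub>R test_vector T u + krylov_combination e T u y)"
      by (rule has_integral_le) (rule pt)
    moreover have "\<mu> * ?Y\<^sup>2 \<le> integral {0..1} (\<lambda>x. (P y x)\<^sup>2)" unfolding P_eq by (rule \<mu>(2))
    moreover have "X\<^sup>2 * (kappa n - C * T\<^sup>2) \<le> X\<^sup>2 * energy T b (test_vector T u)"
    proof (rule mult_left_mono)
      have "C6 * T\<^sup>2 \<le> C * T\<^sup>2" using CC by (intro mult_right_mono) auto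
      then show "kappa n - C * T\<^sup>2 \<le> energy T b (test_vector T u)" using C6(2)[OF T] by linarith
    qed simp
    moreover have "2 * \<bar>X\<bar> * (C4 * T * ?Y) \<le> 2 * \<bar>X\<bar> * (C * T * ?Y)"
      using CC T by (intro mult_left_mono mult_right_mono) auto
    moreover have "C5 * T * ?Y\<^sup>2 \<le> C * T * ?Y\<^sup>2" using CC T by (intro mult_right_mono) auto
    ultimately show ?thesis by (simp add: algebra_simps)
  qed
  have norm: "(norm (X *\<^sub>R test_vector T u + krylov_combination e T u y))\<^sup>2
        \<le> (norm (test_vector T u))\<^sup>2 * X\<^sup>2 + 2 * C * T * \<bar>X\<bar> * norm y + C * T\<^sup>2 * (norm y)\<^sup>2"
    if T: "0 < T" "T \<le> 1" and y: "\<And>i. e i = 0 \<Longrightarrow> y $ i = 0" for T X y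
  proof -
    let ?v = "test_vector T u" and ?z = "krylov_combination e T u y"
    have v: "norm ?v \<le> W" unfolding W_def by (rule norm_test_vector[OF T])
    have z: "norm ?z \<le> Z * T * norm y" unfolding Z_def by (rule norm_combination[OF e(2) y T])
    have "norm (X *\<^sub>R ?v + ?z) \<le> \<bar>X\<bar> * norm ?v + norm ?z"
      using norm_triangle_ineq[of "X *\<^sub>R ?v" ?z] by simp
    then have "(norm (X *\<^sub>R ?v + ?z))\<^sup>2 \<le> (\<bar>X\<bar> * norm ?v + norm ?z)\<^sup>2" by (rule power_mono) simp
    also have "\<dots> = (norm ?v)\<^sup>2 * X\<^sup>2 + 2 * \<bar>X\<bar> * (norm ?v * norm ?z) + norm ?z * norm ?z"
      by (simp add: power2_sum power_mult_distrib power2_eq_square[of "norm ?z"])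
    also have "\<dots> \<le> (norm ?v)\<^sup>2 * X\<^sup>2 + 2 * \<bar>X\<bar> * (W * (Z * T * norm y)) + Z * T * norm y * (Z * T * norm y)"
      by (intro add_mono order_refl mult_left_mono mult_mono v z) (use W0 Z0 T in auto)
    also have "\<dots> = (norm ?v)\<^sup>2 * X\<^sup>2 + 2 * (W * Z) * T * \<bar>X\<bar> * norm y + Z\<^sup>2 * T\<^sup>2 * (norm y)\<^sup>2"
      by (simp add: power2_eq_square)
    also have "\<dots> \<le> (norm ?v)\<^sup>2 * X\<^sup>2 + 2 * C * T * \<bar>X\<bar> * norm y + C * T\<^sup>2 * (norm y)\<^sup>2"
      using CC T by (intro add_mono order_refl mult_right_mono mult_left_mono) auto
    finally show ?thesis .
  qed
  show thesis by (rule that[OF \<mu>(1) C0 energy norm])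
qed

text \<open>Every vector is written in a basis in which the test vector takes the place of
  \<open>u\<close> beside the scaled higher Krylov vectors; \<open>quadratic_form_comparison\<close>
  then bounds the energy by the squared norm.\<close>

lemma gramian_lower:
  assumes b: "norm b = 1" "dual_pair A b u"
  obtains K T0 where "0 < T0"
    "\<And>T. 0 < T \<Longrightarrow> T \<le> T0 \<Longrightarrow> 0 < norm (test_vector T u) \<and>
      T ^ (2 * n - 1) * (kappa n / (norm (test_vector T u))\<^sup>2 * (1 - K * T\<^sup>2)) \<le> lambda_min (gramian A T b)"
proof -
  obtain e :: "'n \<Rightarrow> nat" where bij: "bij_betw e UNIV {0..<CARD('n)}"
    using ex_bij_betw_finite_nat[of "UNIV :: 'n set"] by auto
  then have e: "inj e" "\<And>i. e i < n" by (auto simp: card_n bij_betw_def)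
  obtain i0 where i0: "e i0 = 0"
  proof -
    have "0 \<in> e ` UNIV" using bij by (simp add: bij_betw_def)
    then show thesis using that by auto
  qed
  obtain \<mu> C where C: "0 < \<mu>" "0 \<le> C"
    "\<And>T X y. 0 < T \<Longrightarrow> T \<le> 1 \<Longrightarrow> (\<And>i. e i = 0 \<Longrightarrow> y $ i = 0) \<Longrightarrow>
      (kappa n - C * T\<^sup>2) * X\<^sup>2 - 2 * C * T * \<bar>X\<bar> * norm y + (\<mu> - C * T) * (norm y)\<^sup>2
        \<le> energy T b (X *\<^sub>R test_vector T u + krylov_combination e T u y)"
    "\<And>T X y. 0 < T \<Longrightarrow> T \<le> 1 \<Longrightarrow> (\<And>i. e i = 0 \<Longrightarrow> y $ i = 0) \<Longrightarrow>
      (norm (X *\<^sub>R test_vector T u + krylov_combination e T u y))\<^sup>2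
        \<le> (norm (test_vector T u))\<^sup>2 * X\<^sup>2 + 2 * C * T * \<bar>X\<bar> * norm y + C * T\<^sup>2 * (norm y)\<^sup>2"
    using perturbed_energy_lower[OF b e] by blast
  define R where "R = norm u"
  obtain C7 where C7': "0 \<le> C7" "\<And>u T. norm u \<le> R \<Longrightarrow> 0 < T \<Longrightarrow> T \<le> 1 \<Longrightarrow>
      \<bar>(norm (test_vector T u))\<^sup>2 - ((norm u)\<^sup>2 - T * (u \<bullet> (A *v u)))\<bar> \<le> C7 * T\<^sup>2"
    using test_vector_norm[of R] by blast
  have C7: "0 \<le> C7" "\<And>T. 0 < T \<Longrightarrow> T \<le> 1 \<Longrightarrow>
      \<bar>(norm (test_vector T u))\<^sup>2 - ((norm u)\<^sup>2 - T * (u \<bullet> (A *v u)))\<bar> \<le> C7 * T\<^sup>2"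
    using C7'(1) C7'(2)[of u] by (simp_all add: R_def)
  have u: "0 < norm u" using dual_pair_nonzero[OF b(2)] by simp
  \<comment> \<open>A positive lower bound, valid for all small \<open>T\<close>, for the squared
    norm of the test vector.\<close>
  define V0 where "V0 = (norm u)\<^sup>2 / 2"
  have V0: "0 < V0" using u by (simp add: V0_def)
  obtain K T1 where K: "0 < T1"
    "\<And>T X y q s V. 0 < T \<Longrightarrow> T \<le> T1 \<Longrightarrow> V0 \<le> V \<Longrightarrow> 0 \<le> y \<Longrightarrow>
      (kappa n - C * T\<^sup>2) * X\<^sup>2 - 2 * C * T * \<bar>X\<bar> * y + (\<mu> - C * T) * y\<^sup>2 \<le> q \<Longrightarrow>
      s \<le> V * X\<^sup>2 + 2 * C * T * \<bar>X\<bar> * y + C * T\<^sup>2 * y\<^sup>2 \<Longrightarrow>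
      kappa n / V * (1 - K * T\<^sup>2) * s \<le> q"
    apply (rule quadratic_form_comparison[OF kappa_pos[of n] C(1,2) V0])
    subgoal premises p by (rule p(1)[OF p(2)]) (rule p(3))
    done
  define D where "D = \<bar>u \<bullet> (A *v u)\<bar> + C7"
  define T0 where "T0 = Min {1, T1, kappa n / (4 * C + 1), \<mu> / (4 * C + 1), V0 / (D + 1)}"
  have D0: "0 \<le> D" using C7(1) by (simp add: D_def)
  have T0: "0 < T0" using K(1) C V0 D0 kappa_pos[of n] by (auto simp: T0_def)
  show thesis
  proof (rule that[OF T0, of K])
    fix T assume T: "0 < T" "T \<le> T0"
    then have T1: "T \<le> 1" "T \<le> T1" and "T \<le> kappa n / (4 * C + 1)" "T \<le> \<mu> / (4 * C + 1)" "T \<le> V0 / (D + 1)"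
      by (auto simp: T0_def)
    then have "T * (4 * C + 1) \<le> kappa n" "T * (4 * C + 1) \<le> \<mu>" "T * (D + 1) \<le> V0"
      using C D0 by (simp_all add: pos_le_divide_eq)
    then have small: "4 * (C * T) \<le> kappa n" "4 * (C * T) \<le> \<mu>" "D * T \<le> V0"
      using T by (simp_all add: algebra_simps)
    let ?V = "(norm (test_vector T u))\<^sup>2"
    have V: "V0 \<le> ?V"
    proof -
      have "T * (u \<bullet> (A *v u)) \<le> T * \<bar>u \<bullet> (A *v u)\<bar>" using T by (intro mult_left_mono) auto
      moreover have "C7 * T\<^sup>2 \<le> C7 * T"
        using T T1 C7(1) by (intro mult_left_mono) (auto simp: power2_eq_square mult_left_le)
      ultimately have "(norm u)\<^sup>2 - D * T \<le> ?V"
        using C7(2)[OF T(1) T1(1)] by (simp add: D_def abs_le_iff algebra_simps)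
      then show ?thesis using small(3) by (simp add: V0_def)
    qed
    \<comment> \<open>\<open>proj\<close> clears the coordinate \<open>i0\<close>, the place of
      \<open>u\<close>; that coordinate becomes the coefficient of the test vector.\<close>
    define proj where "proj a = (\<chi> i. if e i = 0 then 0 else a $ i)" for a :: "real^'n"
    have proj: "e i = 0 \<Longrightarrow> proj a $ i = 0" for a i by (simp add: proj_def)
    define L where "L a = (a $ i0) *\<^sub>R test_vector T u + krylov_combination e T u (proj a)" for a
    have linL: "linear L"
    proof (rule linearI)
      fix x y :: "real^'n" and r :: real
      have "krylov_combination e T u (proj (x + y)) =
          krylov_combination e T u (proj x) + krylov_combination e T u (proj y)"
        unfolding krylov_combination_def sum.distrib[symmetric]
        by (rule sum.cong) (auto simp: proj_def scaleR_add_left distrib_right)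
      then show "L (x + y) = L x + L y" by (simp add: L_def scaleR_add_left)
      have "krylov_combination e T u (proj (r *\<^sub>R x)) = r *\<^sub>R krylov_combination e T u (proj x)"
        unfolding krylov_combination_def scaleR_sum_right by (rule sum.cong) (auto simp: proj_def)
      then show "L (r *\<^sub>R x) = r *\<^sub>R L x" by (simp add: L_def scaleR_add_right)
    qed
    \<comment> \<open>The energy estimate itself shows that test vector and Krylov vectors form a basis.\<close>
    have "inj L" unfolding linear_injective_0[OF linL]
    proof (intro allI impI)
      fix a assume "L a = 0"
      then have "energy T b (L a) = 0" by (simp add: energy_def response_def)
      then have "a $ i0 = 0 \<and> norm (proj a) = 0"
        using C(3)[where y = "proj a" and X = "a $ i0", OF T(1) T1(1) proj] small
        by (intro quadratic_form_definite[OF kappa_pos C(1,2) T(1) T1(1) small(1,2)]) (simp add: L_def)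
      then have "a $ i = 0" for i
      proof (cases "e i = 0")
        case True
        then have "i = i0" using i0 e(1) by (simp add: inj_def)
        then show ?thesis using \<open>a $ i0 = 0 \<and> norm (proj a) = 0\<close> by simp
      next
        case False
        then have "a $ i = proj a $ i" by (simp add: proj_def)
        then show ?thesis using \<open>a $ i0 = 0 \<and> norm (proj a) = 0\<close> by simp
      qed
      then show "a = 0" by (simp add: vec_eq_iff)
    qed
    then have "surj L" using linL linear_injective_imp_surjective by blast
    have Vpos: "0 < norm (test_vector T u)" using V V0 by (cases "test_vector T u = 0") auto
    have "T ^ (2 * n - 1) * (kappa n / ?V * (1 - K * T\<^sup>2)) \<le> lambda_min (gramian A T b)"
    proof (rule lambda_min_ge)
      show "transpose (gramian A T b) = gramian A T b"
        unfolding gramian_def by (rule transpose_gramian_op[OF transpose_outer])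
      fix v :: "real^'n" assume v: "norm v = 1"
      obtain a where a: "v = L a" using \<open>surj L\<close> by (metis surjD)
      have "kappa n / ?V * (1 - K * T\<^sup>2) * (norm v)\<^sup>2 \<le> energy T b v"
        unfolding a L_def
        by (rule K(2)[OF T(1) T1(2) V norm_ge_zero C(3)[OF T(1) T1(1) proj] C(4)[OF T(1) T1(1) proj]])
      then show "T ^ (2 * n - 1) * (kappa n / ?V * (1 - K * T\<^sup>2)) \<le> v \<bullet> (gramian A T b *v v)"
        unfolding gramian_energy[OF T(1)] using v T by (intro mult_left_mono) auto
    qed
    then show "0 < norm (test_vector T u) \<and>
      T ^ (2 * n - 1) * (kappa n / ?V * (1 - K * T\<^sup>2)) \<le> lambda_min (gramian A T b)" using Vpos by blast
  qed
qed

end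

section \<open>Asymptotics of the optimal rank-one excitation\<close>

text \<open>Where \<open>h\<close> is below \<open>M + \<epsilon>\<close>, the bound
  \<open>m \<le> f\<close> suffices. The rest is compact and contains no minimiser, so there
  \<open>f\<close> exceeds \<open>m\<close> by a fixed gap \<open>\<eta>\<close>, which dominates
  \<open>T * h\<close> for small \<open>T\<close>.\<close>

lemma danskin_lower:
  fixes f h :: "'a::metric_space \<Rightarrow> real"
  assumes "compact P" and f: "continuous_on P f" and h: "continuous_on P h"
    and m: "\<And>p. p \<in> P \<Longrightarrow> m \<le> f p" and M: "\<And>p. p \<in> P \<Longrightarrow> f p = m \<Longrightarrow> h p \<le> M" and "0 < \<epsilon>"
  obtains T0 where "0 < T0"
    "\<And>T p. 0 < T \<Longrightarrow> T \<le> T0 \<Longrightarrow> p \<in> P \<Longrightarrow> m - T * (M + \<epsilon>) \<le> f p - T * h p"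
proof -
  define P' where "P' = {p \<in> P. M + \<epsilon> \<le> h p}"
  have away: "m - T * (M + \<epsilon>) \<le> f p - T * h p" if "0 < T" "p \<in> P" "p \<notin> P'" for T p
  proof -
    have "T * h p \<le> T * (M + \<epsilon>)" using that by (intro mult_left_mono) (auto simp: P'_def)
    then show ?thesis using m[OF that(2)] by linarith
  qed
  show thesis
  proof (cases "P' = {}")
    case True
    then show thesis using away by (intro that[of 1]) auto
  next
    case False
    have "P' = P \<inter> h -` {M + \<epsilon>..}" by (auto simp: P'_def)
    moreover have "closed (P \<inter> h -` {M + \<epsilon>..})"
      by (rule continuous_closed_preimage[OF h compact_imp_closed[OF assms(1)]]) simp
    ultimately have "compact P'" using compact_Int_closed[OF assms(1)] by (metis inf.left_idem)
    moreover have "continuous_on P' f" by (rule continuous_on_subset[OF f]) (auto simp: P'_def)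
    ultimately obtain p0 where p0: "p0 \<in> P'" "\<And>p. p \<in> P' \<Longrightarrow> f p0 \<le> f p"
      using continuous_attains_inf[of P' f] False by blast
    define \<eta> where "\<eta> = f p0 - m"
    have "f p0 \<noteq> m" using M[of p0] p0(1) \<open>0 < \<epsilon>\<close> by (auto simp: P'_def)
    then have \<eta>: "0 < \<eta>" using m[of p0] p0(1) by (auto simp: P'_def \<eta>_def)
    obtain B where B: "\<And>p. p \<in> P \<Longrightarrow> \<bar>h p\<bar> \<le> B"
      using compact_imp_bounded[OF compact_continuous_image[OF h assms(1)]] by (auto simp: bounded_iff)
    define T0 where "T0 = \<eta> / (\<bar>B\<bar> + \<bar>M + \<epsilon>\<bar> + 1)"
    have den: "0 < \<bar>B\<bar> + \<bar>M + \<epsilon>\<bar> + 1" by simp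
    show thesis
    proof (rule that[of T0])
      show "0 < T0" using \<eta> den by (simp add: T0_def)
      fix T p assume T: "0 < T" "T \<le> T0" and p: "p \<in> P"
      show "m - T * (M + \<epsilon>) \<le> f p - T * h p"
      proof (cases "p \<in> P'")
        case True
        have "T * (\<bar>B\<bar> + \<bar>M + \<epsilon>\<bar> + 1) \<le> \<eta>" using T den by (simp add: T0_def pos_le_divide_eq)
        moreover have "T * h p - T * (M + \<epsilon>) \<le> T * (\<bar>B\<bar> + \<bar>M + \<epsilon>\<bar>)"
          unfolding right_diff_distrib[symmetric] using T B[OF p] by (intro mult_left_mono) auto
        ultimately show ?thesis using p0(2)[OF True] T by (simp add: \<eta>_def algebra_simps)
      qed (use away T p in blast)
    qed
  qed
qed

context krylov_test
begin

text \<open>A unit vector \<open>v\<close> orthogonal to the first \<open>n - 1\<close> Krylov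
  vectors has only the leading moment \<open>p\<close> and a small remainder. A large eigenvalue
  forces \<open>p\<close> away from 0, and then \<open>v / p\<close> is a dual vector of norm
  \<open>1 / \<bar>p\<bar>\<close>.\<close>

lemma bounded_dual_of_large_eigenvalue:
  assumes "0 < c"
  obtains R T0 where "0 < T0"
    "\<And>T b. 0 < T \<Longrightarrow> T \<le> T0 \<Longrightarrow> norm b = 1 \<Longrightarrow> c * T ^ (2 * n - 1) \<le> lambda_min (gramian A T b) \<Longrightarrow>
      \<exists>u. dual_pair A b u \<and> norm u \<le> R"
proof -
  define C where "C = norm A ^ n * exp (norm A)"
  \<comment> \<open>Half of \<open>sqrt c\<close> is given to the remainder \<open>C * T\<close>,
    the other half is left as a lower bound for \<open>p\<close>.\<close>
  define r where "r = sqrt c / 2"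
  have C0: "0 \<le> C" by (simp add: C_def)
  have r: "0 < r" using assms by (simp add: r_def)
  define T0 where "T0 = min 1 (r / (C + 1))"
  show thesis
  proof (rule that[of T0 "1 / r"])
    show "0 < T0" using r C0 by (simp add: T0_def)
    fix T b assume T: "0 < T" "T \<le> T0" and b: "norm b = 1"
      and large: "c * T ^ (2 * n - 1) \<le> lambda_min (gramian A T b)"
    have T1: "T \<le> 1" and "T * (C + 1) \<le> r" using T C0 by (auto simp: T0_def pos_le_divide_eq)
    then have CT: "C * T \<le> r" using T by (simp add: algebra_simps)
    let ?S = "(\<lambda>k. mat_power A k *v b) ` {..<n - 1}"
    have "dim ?S \<le> card ?S" by (rule dim_le_card') simp
    also have "\<dots> \<le> n - 1" using card_image_le[of "{..<n - 1}" "\<lambda>k. mat_power A k *v b"] by simp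
    also have "\<dots> < DIM(real^'n)" using n_pos by (simp add: card_n)
    finally obtain v0 where v0: "v0 \<noteq> 0" "\<And>y. y \<in> span ?S \<Longrightarrow> orthogonal v0 y"
      using orthogonal_to_subspace_exists[of ?S] by blast
    define v where "v = v0 /\<^sub>R norm v0"
    have v: "norm v = 1" using v0 by (simp add: v_def)
    have vS: "v \<bullet> (mat_power A k *v b) = 0" if "k < n - 1" for k
      using v0(2)[OF span_base[of "mat_power A k *v b"]] that by (simp add: v_def orthogonal_def)
    define p where "p = v \<bullet> (mat_power A (n - 1) *v b)"
    have resp: "\<bar>response T b v x\<bar> \<le> \<bar>p\<bar> + C * T" if x: "0 \<le> x" "x \<le> 1" for x
    proof -
      let ?t = "T * x"
      let ?rem = "mat_exp (?t *\<^sub>R A) *v b - (\<Sum>k<n. (?t ^ k / fact k) *\<^sub>R (mat_power A k *v b))"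
      have t: "0 \<le> ?t" "?t \<le> 1" "?t \<le> T" using T T1 x by (auto intro: mult_le_one mult_left_le)
      have "norm ?rem \<le> C * ?t ^ n * norm b" unfolding C_def by (rule mat_exp_expansion[OF t(1,2)])
      also have "\<dots> \<le> C * T ^ n * norm b" using t C0 by (intro mult_right_mono mult_left_mono power_mono) auto
      finally have r1: "\<bar>v \<bullet> ?rem\<bar> \<le> C * T ^ n"
        using Cauchy_Schwarz_ineq2[of v ?rem] v b by simp
      have r2: "v \<bullet> (\<Sum>k<n. (?t ^ k / fact k) *\<^sub>R (mat_power A k *v b)) = ?t ^ (n - 1) / fact (n - 1) * p"
      proof -
        have "v \<bullet> (\<Sum>k<n. (?t ^ k / fact k) *\<^sub>R (mat_power A k *v b)) =
            (\<Sum>k<Suc (n - 1). ?t ^ k / fact k * (v \<bullet> (mat_power A k *v b)))"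
          using n_pos by (simp add: inner_sum_right)
        also have "\<dots> = ?t ^ (n - 1) / fact (n - 1) * p"
          unfolding sum.lessThan_Suc p_def by (simp add: vS)
        finally show ?thesis .
      qed
      have r3: "\<bar>?t ^ (n - 1) / fact (n - 1) * p\<bar> \<le> T ^ (n - 1) * \<bar>p\<bar>"
      proof -
        have "?t ^ (n - 1) / fact (n - 1) \<le> T ^ (n - 1) / 1"
          using t by (intro frac_le power_mono) auto
        then show ?thesis unfolding abs_mult using t by (intro mult_right_mono) auto
      qed
      have "v \<bullet> (mat_exp (?t *\<^sub>R A) *v b) = v \<bullet> ?rem + ?t ^ (n - 1) / fact (n - 1) * p"
        by (simp only: inner_diff_right r2)
      then have "\<bar>v \<bullet> (mat_exp (?t *\<^sub>R A) *v b)\<bar> \<le> T ^ (n - 1) * \<bar>p\<bar> + C * T ^ n"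
        using r1 r3 by linarith
      also have "\<dots> = T ^ (n - 1) * (\<bar>p\<bar> + C * T)"
        using power_minus_mult[of n T] n_pos by (simp add: algebra_simps)
      finally show ?thesis using T by (simp add: response_def abs_divide pos_divide_le_eq mult.commute)
    qed
    have "energy T b v \<le> integral {0..1} (\<lambda>x::real. (\<bar>p\<bar> + C * T)\<^sup>2)"
      unfolding energy_def
    proof (rule integral_le)
      show "(\<lambda>x. (response T b v x)\<^sup>2) integrable_on {0..1}"
        by (intro integrable_continuous_real continuous_intros continuous_response)
      show "(response T b v x)\<^sup>2 \<le> (\<bar>p\<bar> + C * T)\<^sup>2" if "x \<in> {0..1}" for x
        using power_mono[OF resp[of x] abs_ge_zero, of 2] that by simp
    qed auto
    then have en: "energy T b v \<le> (\<bar>p\<bar> + C * T)\<^sup>2" by simp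
    have "c * T ^ (2 * n - 1) \<le> v \<bullet> (gramian A T b *v v)"
      using lambda_min_rayleigh(1)[OF transpose_gramian_op[OF transpose_outer], of A T b v] large v
      by (simp add: gramian_def dot_square_norm)
    also have "\<dots> \<le> (\<bar>p\<bar> + C * T)\<^sup>2 * T ^ (2 * n - 1)"
      unfolding gramian_energy[OF T(1)] using en T by (subst mult.commute) (intro mult_right_mono, auto)
    finally have "c \<le> (\<bar>p\<bar> + C * T)\<^sup>2" using T by (simp add: mult_le_cancel_right)
    then have "sqrt c \<le> \<bar>p\<bar> + C * T" using C0 T by (intro real_le_lsqrt) auto
    then have p: "r \<le> \<bar>p\<bar>" using CT by (simp add: r_def)
    have "dual_pair A b (v /\<^sub>R p)"
      unfolding dual_pair_def card_n[symmetric]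
    proof (intro allI impI)
      fix k assume "k < n"
      show "(v /\<^sub>R p) \<bullet> (mat_power A k *v b) = (if k = n - 1 then 1 else 0)"
      proof (cases "k = n - 1")
        case True
        then have "v \<bullet> (mat_power A k *v b) = p" by (simp only: p_def)
        then show ?thesis using p r True by auto
      qed (use vS[of k] \<open>k < n\<close> in auto)
    qed
    moreover have "norm (v /\<^sub>R p) \<le> 1 / r" using v p r by (simp add: divide_inverse[symmetric] inverse_eq_divide frac_le)
    ultimately show "\<exists>u. dual_pair A b u \<and> norm u \<le> 1 / r" by blast
  qed
qed

text \<open>The quotient is estimated below with one optimal pair, and above by every slope
  \<open>\<beta>\<close> larger than \<open>\<alpha>\<close>, using the test vector of a dual of the
  maximiser at horizon \<open>T\<close>.\<close>

lemma gamma1_first_order: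
  assumes cyc: "cyclic_matrix A"
  shows "0 < delta_n A"
    and "((\<lambda>T. (gamma1 A T / (kappa n * (delta_n A)\<^sup>2 * T ^ (2 * n - 1)) - 1) / T) \<longlongrightarrow> alpha_n A) (at_right 0)"
proof -
  obtain b1 u1 where b1: "norm b1 = 1" "dual_pair A b1 u1" "delta_n A * norm u1 = 1"
    "u1 \<bullet> (A *v u1) = alpha_n A * (u1 \<bullet> u1)"
    and min: "\<And>b' u'. norm b' = 1 \<Longrightarrow> dual_pair A b' u' \<Longrightarrow> norm u1 \<le> norm u'"
    and max: "\<And>b' u'. norm b' = 1 \<Longrightarrow> dual_pair A b' u' \<Longrightarrow> norm u' = norm u1 \<Longrightarrow>
       u' \<bullet> (A *v u') \<le> alpha_n A * (u1 \<bullet> u1)"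
    using optimal_dual_pair[OF cyc] by blast
  define s where "s = (norm u1)\<^sup>2"
  define \<alpha> where "\<alpha> = alpha_n A"
  have u1: "0 < norm u1" using dual_pair_nonzero[OF b1(2)] by simp
  then have s: "0 < s" by (simp add: s_def)
  have delta: "delta_n A = 1 / norm u1" using b1(3) u1 by (simp add: field_simps)
  then show "0 < delta_n A" using u1 by simp
  define g where "g T = gamma1 A T * s / (kappa n * T ^ (2 * n - 1))" for T
  have g_eq: "gamma1 A T / (kappa n * (delta_n A)\<^sup>2 * T ^ (2 * n - 1)) = g T" for T
    using u1 by (simp add: g_def delta s_def power_divide field_simps)
  have k: "0 < kappa n" by (rule kappa_pos)
  have lim: "((\<lambda>T. f T) \<longlongrightarrow> f 0) (at_right 0)" if "isCont f 0" for f :: "real \<Rightarrow> real"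
    using that by (simp add: isCont_def filterlim_at_split)
  obtain K T1 where K: "0 < T1"
    "\<And>T. 0 < T \<Longrightarrow> T \<le> T1 \<Longrightarrow> 0 < norm (test_vector T u1) \<and>
      T ^ (2 * n - 1) * (kappa n / (norm (test_vector T u1))\<^sup>2 * (1 - K * T\<^sup>2)) \<le> lambda_min (gramian A T b1)"
    apply (rule gramian_lower[OF b1(1,2)])
    subgoal premises p by (rule p(1)[OF p(2)]) (rule p(3))
    done
  obtain C where C: "0 \<le> C" "\<And>u T. norm u \<le> norm u1 \<Longrightarrow> 0 < T \<Longrightarrow> T \<le> 1 \<Longrightarrow>
      \<bar>(norm (test_vector T u))\<^sup>2 - ((norm u)\<^sup>2 - T * (u \<bullet> (A *v u)))\<bar> \<le> C * T\<^sup>2"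
    using test_vector_norm[of "norm u1"] by blast
  define D where "D = C / s"
  have lower: "(1 - K * T\<^sup>2) / (1 - \<alpha> * T + D * T\<^sup>2) \<le> g T \<and> 0 < 1 - \<alpha> * T + D * T\<^sup>2"
    if T: "0 < T" "T \<le> T1" "T \<le> 1" and KT: "0 \<le> 1 - K * T\<^sup>2" for T
  proof -
    let ?V = "(norm (test_vector T u1))\<^sup>2"
    have V: "0 < ?V" and ge: "T ^ (2 * n - 1) * (kappa n / ?V * (1 - K * T\<^sup>2)) \<le> gamma1 A T"
      using K(2)[OF T(1,2)] gamma1_attained(2)[OF b1(1), of A T] by auto
    have "?V \<le> s - T * (\<alpha> * s) + C * T\<^sup>2"
      using C(2)[OF order_refl T(1,3)] b1(4) by (simp add: s_def \<alpha>_def dot_square_norm abs_le_iff)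
    also have "\<dots> = s * (1 - \<alpha> * T + D * T\<^sup>2)" using s by (simp add: D_def algebra_simps)
    finally have Vs: "?V \<le> s * (1 - \<alpha> * T + D * T\<^sup>2)" .
    then have "0 < s * (1 - \<alpha> * T + D * T\<^sup>2)" using V by linarith
    then have pos: "0 < 1 - \<alpha> * T + D * T\<^sup>2" using s by (simp add: zero_less_mult_iff)
    have "(1 - K * T\<^sup>2) / (1 - \<alpha> * T + D * T\<^sup>2) = s * (1 - K * T\<^sup>2) / (s * (1 - \<alpha> * T + D * T\<^sup>2))"
      using s by simp
    also have "\<dots> \<le> s * (1 - K * T\<^sup>2) / ?V" using Vs V KT s pos by (intro divide_left_mono mult_pos_pos) auto
    also have "\<dots> = T ^ (2 * n - 1) * (kappa n / ?V * (1 - K * T\<^sup>2)) * (s / (kappa n * T ^ (2 * n - 1)))"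
      using k T by simp
    also have "\<dots> \<le> gamma1 A T * (s / (kappa n * T ^ (2 * n - 1)))"
      using ge k s T by (intro mult_right_mono) auto
    finally show ?thesis using pos by (simp add: g_def)
  qed
  have evT: "\<forall>\<^sub>F T in at_right (0::real). 0 < T \<and> T \<le> T'" if "0 < T'" for T'
    using that by (auto simp: eventually_at_right_field intro!: exI[of _ T'])
  have evK: "\<forall>\<^sub>F T in at_right 0. 1 / 2 < 1 - K * T\<^sup>2"
    using lim[of "\<lambda>T. 1 - K * T\<^sup>2"] by (intro order_tendstoD(1)[where y = 1]) auto
  have evD: "\<forall>\<^sub>F T in at_right 0. 1 - \<alpha> * T + D * T\<^sup>2 < 2"
    using lim[of "\<lambda>T. 1 - \<alpha> * T + D * T\<^sup>2"] by (intro order_tendstoD(2)[where y = 1]) auto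
  \<comment> \<open>The second conjunct is a crude bound; its role is to show that the maximal
    eigenvalue is large enough for its maximiser to have a dual vector of norm at most
    \<open>R\<close>.\<close>
  have ev_lower: "\<forall>\<^sub>F T in at_right 0. (\<alpha> - (K + D) * T) / (1 - \<alpha> * T + D * T\<^sup>2) \<le> (g T - 1) / T \<and> 1 / 4 \<le> g T"
    using evT[OF K(1)] evT[OF zero_less_one] evK evD
  proof eventually_elim
    case (elim T)
    then have l: "(1 - K * T\<^sup>2) / (1 - \<alpha> * T + D * T\<^sup>2) \<le> g T" and pos: "0 < 1 - \<alpha> * T + D * T\<^sup>2"
      using lower[of T] by auto
    have "(\<alpha> - (K + D) * T) / (1 - \<alpha> * T + D * T\<^sup>2) = ((1 - K * T\<^sup>2) / (1 - \<alpha> * T + D * T\<^sup>2) - 1) / T"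
    proof -
      define q where "q = 1 - \<alpha> * T + D * T\<^sup>2"
      have "(1 - K * T\<^sup>2) / q - 1 = (1 - K * T\<^sup>2 - q) / q"
        using pos by (simp add: q_def[symmetric] diff_divide_distrib)
      also have "1 - K * T\<^sup>2 - q = T * (\<alpha> - (K + D) * T)"
        by (simp add: q_def power2_eq_square algebra_simps)
      finally show ?thesis using elim by (simp add: q_def)
    qed
    also have "\<dots> \<le> (g T - 1) / T" using l elim by (intro divide_right_mono) auto
    finally have 1: "(\<alpha> - (K + D) * T) / (1 - \<alpha> * T + D * T\<^sup>2) \<le> (g T - 1) / T" .
    have "(1 / 2) / 2 \<le> (1 - K * T\<^sup>2) / (1 - \<alpha> * T + D * T\<^sup>2)"
      using elim pos by (intro frac_le) auto
    then have "1 / 4 \<le> g T" using l by linarith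
    with 1 show ?case by blast
  qed
  have lo_lim: "((\<lambda>T. (\<alpha> - (K + D) * T) / (1 - \<alpha> * T + D * T\<^sup>2)) \<longlongrightarrow> \<alpha>) (at_right 0)"
    using lim[of "\<lambda>T. (\<alpha> - (K + D) * T) / (1 - \<alpha> * T + D * T\<^sup>2)"] by simp
  \<comment> \<open>The constant that turns \<open>1 / 4 \<le> g T\<close> into the eigenvalue bound
    \<open>c * T ^ (2 * n - 1) \<le> gamma1 A T\<close>.\<close>
  define c where "c = kappa n / (4 * s)"
  have c: "0 < c" using k s by (simp add: c_def)
  obtain R T2 where R: "0 < T2"
    "\<And>T b. 0 < T \<Longrightarrow> T \<le> T2 \<Longrightarrow> norm b = 1 \<Longrightarrow> c * T ^ (2 * n - 1) \<le> lambda_min (gramian A T b) \<Longrightarrow>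
      \<exists>u. dual_pair A b u \<and> norm u \<le> R"
    apply (rule bounded_dual_of_large_eigenvalue[OF c])
    subgoal premises p by (rule p(1)[OF p(2)]) (rule p(3))
    done
  obtain C2 where C2: "0 \<le> C2" "\<And>u T. norm u \<le> R \<Longrightarrow> 0 < T \<Longrightarrow> T \<le> 1 \<Longrightarrow>
      \<bar>(norm (test_vector T u))\<^sup>2 - ((norm u)\<^sup>2 - T * (u \<bullet> (A *v u)))\<bar> \<le> C2 * T\<^sup>2"
    using test_vector_norm[of R] by blast
  obtain C3 where C3: "0 \<le> C3" "\<And>b u T. norm b = 1 \<Longrightarrow> dual_pair A b u \<Longrightarrow> norm u \<le> R \<Longrightarrow>
      0 < T \<Longrightarrow> T \<le> 1 \<Longrightarrow> \<bar>energy T b (test_vector T u) - kappa n\<bar> \<le> C3 * T\<^sup>2"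
    using test_energy[of R] by blast
  define E where "E = C2 / s"
  define F where "F = C3 / kappa n"
  let ?P = "{(b, u). norm b = 1 \<and> dual_pair A b u \<and> norm u \<le> R}"
  have upper: "\<forall>\<^sub>F T in at_right 0. (g T - 1) / T \<le> (\<beta> + (F + E) * T) / (1 - \<beta> * T - E * T\<^sup>2)" if "\<alpha> < \<beta>" for \<beta>
  proof -
    have e: "0 < (\<beta> - \<alpha>) * s" using that s by simp
    have contf: "continuous_on ?P (\<lambda>p. (norm (snd p))\<^sup>2)" by (intro continuous_intros)
    have conth: "continuous_on ?P (\<lambda>p. snd p \<bullet> (A *v snd p))"
      by (intro continuous_intros bounded_linear.continuous_on[OF matrix_vector_mul_bounded_linear])
    have m: "s \<le> (norm (snd p))\<^sup>2" if "p \<in> ?P" for p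
      using that min unfolding s_def by (auto intro!: power_mono)
    have M: "snd p \<bullet> (A *v snd p) \<le> \<alpha> * s" if "p \<in> ?P" "(norm (snd p))\<^sup>2 = s" for p
      using that max unfolding s_def \<alpha>_def by (auto simp: dot_square_norm)
    obtain T3 where T3: "0 < T3" "\<And>T p. 0 < T \<Longrightarrow> T \<le> T3 \<Longrightarrow> p \<in> ?P \<Longrightarrow>
        s - T * (\<alpha> * s + (\<beta> - \<alpha>) * s) \<le> (norm (snd p))\<^sup>2 - T * (snd p \<bullet> (A *v snd p))"
      apply (rule danskin_lower[where m = s and M = "\<alpha> * s" and \<epsilon> = "(\<beta> - \<alpha>) * s",
          OF compact_dual_pairs contf conth m M e])
      subgoal by assumption
      subgoal by assumption
      subgoal by assumption
      subgoal premises p by (rule p(1)[OF p(2)]) (rule p(3))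
      done
    have evd: "\<forall>\<^sub>F T in at_right 0. 0 < 1 - \<beta> * T - E * T\<^sup>2"
      using lim[of "\<lambda>T. 1 - \<beta> * T - E * T\<^sup>2"] by (intro order_tendstoD(1)[where y = 1]) auto
    show ?thesis
      using evT[OF R(1)] evT[OF T3(1)] evT[OF zero_less_one] ev_lower evd
    proof eventually_elim
      case (elim T)
      then have T: "0 < T" "T \<le> T2" "T \<le> T3" "T \<le> 1" and g4: "1 / 4 \<le> g T"
        and d: "0 < 1 - \<beta> * T - E * T\<^sup>2" by auto
      obtain b where b: "norm b = 1" "lambda_min (gramian A T b) = gamma1 A T"
        using gamma1_attained(1) by blast
      have kT: "0 < kappa n * T ^ (2 * n - 1)" using k T by simp
      have "c * T ^ (2 * n - 1) = 1 / 4 * (kappa n * T ^ (2 * n - 1)) / s" by (simp add: c_def)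
      also have "\<dots> \<le> g T * (kappa n * T ^ (2 * n - 1)) / s"
        using g4 kT s by (intro divide_right_mono mult_right_mono) auto
      also have "\<dots> = gamma1 A T" using kT s k T by (simp add: g_def)
      finally have cg: "c * T ^ (2 * n - 1) \<le> gamma1 A T" .
      then obtain u where u: "dual_pair A b u" "norm u \<le> R" using R(2)[OF T(1,2) b(1)] b(2) by auto
      \<comment> \<open>The sign is needed because the squared norm of the test vector is next
        replaced by a lower bound under the factor \<open>gamma1 A T\<close>.\<close>
      have g0: "0 \<le> gamma1 A T" using cg c T by (intro order_trans[OF _ cg]) auto
      let ?V = "(norm (test_vector T u))\<^sup>2"
      have "s - T * (\<alpha> * s + (\<beta> - \<alpha>) * s) \<le> (norm u)\<^sup>2 - T * (u \<bullet> (A *v u))"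
        using T3(2)[OF T(1,3), of "(b, u)"] b u by simp
      then have "s - T * (\<beta> * s) - C2 * T\<^sup>2 \<le> ?V"
        using C2(2)[OF u(2) T(1,4)] by (simp add: abs_le_iff algebra_simps)
      moreover have "s - T * (\<beta> * s) - C2 * T\<^sup>2 = s * (1 - \<beta> * T - E * T\<^sup>2)"
        using s by (simp add: E_def algebra_simps)
      ultimately have V: "s * (1 - \<beta> * T - E * T\<^sup>2) \<le> ?V" by simp
      have "gamma1 A T * (s * (1 - \<beta> * T - E * T\<^sup>2)) \<le> gamma1 A T * ?V" using V g0 by (rule mult_left_mono)
      also have "\<dots> \<le> test_vector T u \<bullet> (gramian A T b *v test_vector T u)"
        using lambda_min_rayleigh(1)[OF transpose_gramian_op[OF transpose_outer], of A T b "test_vector T u"] b(2)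
        by (simp add: gramian_def dot_square_norm)
      also have "\<dots> \<le> T ^ (2 * n - 1) * (kappa n + C3 * T\<^sup>2)"
        unfolding gramian_energy[OF T(1)] using C3(2)[OF b(1) u T(1,4)] T
        by (intro mult_left_mono) (auto simp: abs_le_iff)
      also have "\<dots> = (kappa n * T ^ (2 * n - 1)) * (1 + F * T\<^sup>2)" using k by (simp add: F_def algebra_simps)
      finally have "gamma1 A T * s * (1 - \<beta> * T - E * T\<^sup>2) / (kappa n * T ^ (2 * n - 1)) \<le> 1 + F * T\<^sup>2"
        using kT by (simp add: pos_divide_le_eq mult_ac)
      then have "g T * (1 - \<beta> * T - E * T\<^sup>2) \<le> 1 + F * T\<^sup>2" by (simp add: g_def)
      then have "(g T - 1) * (1 - \<beta> * T - E * T\<^sup>2) \<le> (\<beta> + (F + E) * T) * T"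
        by (simp add: algebra_simps power2_eq_square)
      then have "(g T - 1) / T * (1 - \<beta> * T - E * T\<^sup>2) \<le> \<beta> + (F + E) * T"
        using T by (simp add: pos_divide_le_eq)
      then show ?case using d by (simp only: pos_le_divide_eq)
    qed
  qed
  have "((\<lambda>T. (g T - 1) / T) \<longlongrightarrow> \<alpha>) (at_right 0)"
  proof (rule order_tendstoI)
    fix a assume "a < \<alpha>"
    then have "\<forall>\<^sub>F T in at_right 0. a < (\<alpha> - (K + D) * T) / (1 - \<alpha> * T + D * T\<^sup>2)"
      by (rule order_tendstoD(1)[OF lo_lim])
    with ev_lower show "\<forall>\<^sub>F T in at_right 0. a < (g T - 1) / T" by eventually_elim linarith
  next
    fix a assume a: "\<alpha> < a"
    define \<beta> where "\<beta> = (\<alpha> + a) / 2"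
    have \<beta>: "\<alpha> < \<beta>" "\<beta> < a" using a by (auto simp: \<beta>_def)
    have "((\<lambda>T. (\<beta> + (F + E) * T) / (1 - \<beta> * T - E * T\<^sup>2)) \<longlongrightarrow> \<beta>) (at_right 0)"
      using lim[of "\<lambda>T. (\<beta> + (F + E) * T) / (1 - \<beta> * T - E * T\<^sup>2)"] by simp
    from order_tendstoD(2)[OF this \<beta>(2)] upper[OF \<beta>(1)]
    show "\<forall>\<^sub>F T in at_right 0. (g T - 1) / T < a" by eventually_elim linarith
  qed
  then show "((\<lambda>T. (gamma1 A T / (kappa n * (delta_n A)\<^sup>2 * T ^ (2 * n - 1)) - 1) / T) \<longlongrightarrow> alpha_n A) (at_right 0)"
    by (simp only: g_eq \<alpha>_def)
qed

end

section \<open>From difference quotients to remainder terms\<close>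

lemma first_order_remainder:
  fixes g :: "real \<Rightarrow> real"
  assumes "((\<lambda>T. (g T - 1) / T) \<longlongrightarrow> a) (at_right 0)"
  shows "(\<lambda>T. g T - 1 - a * T) \<in> o[at_right 0](\<lambda>T. T)"
proof (rule smalloI_tendsto)
  have "((\<lambda>T. (g T - 1) / T - a) \<longlongrightarrow> a - a) (at_right 0)" by (intro tendsto_intros assms)
  moreover have "\<forall>\<^sub>F T in at_right 0. (g T - 1) / T - a = (g T - 1 - a * T) / T"
    by (auto simp: eventually_at_right_field diff_divide_distrib intro!: exI[of _ 1])
  ultimately show "((\<lambda>T. (g T - 1 - a * T) / T) \<longlongrightarrow> 0) (at_right 0)"
    using tendsto_cong by fastforce
  show "\<forall>\<^sub>F T in at_right 0. T \<noteq> (0::real)"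
    by (auto simp: eventually_at_right_field intro!: exI[of _ 1])
qed

text \<open>Rests on \<open>(g / h - 1) / T = ((g - 1) / T - (h - 1) / T) / h\<close> and on
  \<open>h\<close> tending to 1, which follows from its own difference quotient.\<close>

lemma first_order_quotient:
  fixes g h :: "real \<Rightarrow> real"
  assumes g: "((\<lambda>T. (g T - 1) / T) \<longlongrightarrow> a) (at_right 0)"
    and h: "((\<lambda>T. (h T - 1) / T) \<longlongrightarrow> c) (at_right 0)"
  shows "((\<lambda>T. (g T / h T - 1) / T) \<longlongrightarrow> a - c) (at_right 0)"
proof -
  have pos: "\<forall>\<^sub>F T in at_right (0::real). 0 < T"
    by (auto simp: eventually_at_right_field intro!: exI[of _ 1])
  have "((\<lambda>T. 1 + T * ((h T - 1) / T)) \<longlongrightarrow> 1 + 0 * c) (at_right 0)"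
    by (intro tendsto_intros h tendsto_ident_at)
  moreover have "\<forall>\<^sub>F T in at_right 0. 1 + T * ((h T - 1) / T) = h T"
    using pos by eventually_elim simp
  ultimately have h1: "(h \<longlongrightarrow> 1) (at_right 0)" using tendsto_cong by fastforce
  then have "\<forall>\<^sub>F T in at_right 0. 0 < h T" by (rule order_tendstoD) simp
  with pos have "\<forall>\<^sub>F T in at_right 0. ((g T - 1) / T - (h T - 1) / T) / h T = (g T / h T - 1) / T"
    by eventually_elim (simp add: field_simps)
  moreover have "((\<lambda>T. ((g T - 1) / T - (h T - 1) / T) / h T) \<longlongrightarrow> (a - c) / 1) (at_right 0)"
    by (intro tendsto_intros g h h1) simp
  ultimately show ?thesis using tendsto_cong by fastforce
qed

theorem theorem2p4:
  fixes A :: "real^'n^'n"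
  assumes "cyclic_matrix A"
  shows "(\<exists>\<epsilon>. \<epsilon> \<in> o[at_right 0](\<lambda>T. T) \<and>
            (\<forall>T>0. gamma1 A T =
               kappa CARD('n) * (delta_n A)\<^sup>2 * T ^ (2 * CARD('n) - 1) *
               (1 + alpha_n A * T + \<epsilon> T))) \<and>
         (\<exists>\<epsilon>. \<epsilon> \<in> o[at_right 0](\<lambda>T. T) \<and>
            (\<forall>T>0. rho1 A T =
               real CARD('n) * kappa CARD('n) * (delta_n A)\<^sup>2 * T ^ (2 * CARD('n) - 2) *
               (1 + (alpha_n A - trace A / real CARD('n)) * T + \<epsilon> T)))"
proof -
  let ?n = "CARD('n)"
  have n: "1 \<le> ?n" by (simp add: Suc_le_eq)
  obtain N where N: "degree N \<le> ?n" "coeff N ?n = 1 / fact ?n"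
    "coeff N (?n - 1) = - 1 / (2 * fact (?n - 1))"
    "unit_integral (pderiv N * pderiv N) = kappa ?n"
    "unit_integral (pderiv N * N) = 0"
    "\<And>p. degree p < ?n - 1 \<Longrightarrow> unit_integral (pderiv N * p) = 0"
    using extremal_polynomial[OF n] by blast
  interpret krylov_test A N ?n
    by (unfold_locales) (simp_all only: N)
  note delta = gamma1_first_order(1)[OF assms]
  define g where "g T = gamma1 A T / (kappa ?n * (delta_n A)\<^sup>2 * T ^ (2 * ?n - 1))" for T
  define h where "h T = real ?n * gamma_rel A T / T" for T
  have g: "((\<lambda>T. (g T - 1) / T) \<longlongrightarrow> alpha_n A) (at_right 0)"
    unfolding g_def by (rule gamma1_first_order(2)[OF assms])
  have h: "((\<lambda>T. (h T - 1) / T) \<longlongrightarrow> trace A / real ?n) (at_right 0)"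
    unfolding h_def by (rule gamma_rel_first_order)
  have gamma: "gamma1 A T = kappa ?n * (delta_n A)\<^sup>2 * T ^ (2 * ?n - 1) * g T" if "0 < T" for T
    using that delta kappa_pos[of ?n] by (simp add: g_def)
  have rho: "rho1 A T = real ?n * kappa ?n * (delta_n A)\<^sup>2 * T ^ (2 * ?n - 2) * (g T / h T)" if T: "0 < T" for T
  proof -
    have "2 * ?n - 1 = Suc (2 * ?n - 2)" using n by linarith
    then have "T ^ (2 * ?n - 1) = T * T ^ (2 * ?n - 2)" by (simp only: power_Suc)
    moreover have "gamma_rel A T = T * h T / real ?n" using T by (simp add: h_def)
    ultimately show ?thesis using T unfolding rho1_def gamma[OF T] by simp
  qed
  \<comment> \<open>The witnesses are the exact remainders of \<open>g\<close> and
    \<open>g / h\<close>, so the identities hold for every positive \<open>T\<close>; only their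
    smallness is asymptotic.\<close>
  show ?thesis
  proof (intro conjI exI allI impI)
    show "(\<lambda>T. g T - 1 - alpha_n A * T) \<in> o[at_right 0](\<lambda>T. T)" by (rule first_order_remainder[OF g])
    show "(\<lambda>T. g T / h T - 1 - (alpha_n A - trace A / real ?n) * T) \<in> o[at_right 0](\<lambda>T. T)"
      by (rule first_order_remainder[OF first_order_quotient[OF g h]])
  qed (simp_all add: gamma rho)
qed

end
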